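(* Let $k$ be a field, $R=k[x_1,\ldots,x_d]$ ($d\ge 2$), $\mathfrak{m}=(x_1,\ldots,x_d)$, and let $I=(a_1,\ldots,a_d,a_{d+1})$ be an $\mathfrak{m}$-primary ideal minimally generated by $d+1$ forms of the same degree, such that $J=(a_1,\ldots,a_d)$ is a minimal reduction of $I$. Let $\varphi$ be a minimal presentation map of $I$. Then $$\nu(L_2/S_1L_1)=\nu\big((I_1(\varphi):\mathfrak{m})/I_1(\varphi)\big).$$ In particular, if $I_1(\varphi)=\mathfrak{m}^s$ with $s\ge1$, then $$\nu(L_2/S_1L_1)=\binom{d+s-2}{d-1};$$ moreover, in this case $\delta(I)$ is generated by the last $s$ graded components (those in the $s$ highest degrees, ending with the top nonzero degree) of the first Koszul homology module $H_1(I)$.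
   Context: $\nu(\cdot)$ denotes the minimal number of generators of an $R$-module. $\varphi$ is the matrix in a minimal graded free presentation $\bigoplus_jR(-n_j)\xrightarrow{\varphi}R^{d+1}(-n)\to I\to0$ and $I_1(\varphi)$ is the ideal generated by its entries. $S=R[T_1,\ldots,T_{d+1}]$, $L=\ker(S\to R[It])$, $T_i\mapsto a_it$; $L_i$, $S_i$ are the components of degree $i$ in the $T$'s. $H_1(I)=Z_1/B_1$ is the first Koszul homology of the generators $a_1,\ldots,a_{d+1}$, where $Z_1\subset R^{d+1}$ is the module of syzygies and $B_1\subset Z_1$ is the submodule of Koszul relations. The syzygetic module of $I$ is $\delta(I)=(Z_1\cap IR^{d+1})/B_1\subset H_1(I)$. $J$ is a reduction of $I$ if $I^{q+1}=JI^q$ for some $q$. *)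

theory Defs
  imports "HOL-Analysis.Analysis" "HOL-Library.Poly_Mapping" "HOL-Library.Set_Algebras"
    "HOL-Library.Extended_Nat" "HOL-Computational_Algebra.Polynomial"
begin

section \<open>Polynomial rings\<close>

text \<open>
  Polynomials with coefficients in \<open>'b\<close> and variables indexed by the finite type \<open>'v\<close>: the
  keys of the inner map are exponent vectors. For \<open>R = k[x\<^sub>1,\<dots>,x\<^sub>d]\<close> the index type is some
  \<open>'n\<close> with \<open>CARD('n) = d\<close>. The \<open>d + 1\<close> generators of the ideal, and the variables of
  \<open>S = R[T\<^sub>1,\<dots>,T\<^bsub>d+1\<^esub>]\<close>, are indexed by \<open>'n option\<close>, where \<open>None\<close> is the index \<open>d + 1\<close>.
\<close>

type_synonym ('v, 'b) mpoly = "('v \<Rightarrow>\<^sub>0 nat) \<Rightarrow>\<^sub>0 'b"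

definition var :: "'v \<Rightarrow> ('v, 'b::comm_ring_1) mpoly"
  where "var i = Poly_Mapping.single (Poly_Mapping.single i 1) 1"

text \<open>As usual, the zero polynomial is homogeneous of every degree.\<close>

definition homogeneous :: "nat \<Rightarrow> ('v::finite, 'b::zero) mpoly \<Rightarrow> bool"
  where "homogeneous e p \<longleftrightarrow>
    (\<forall>m \<in> Poly_Mapping.keys p. (\<Sum>i\<in>UNIV. Poly_Mapping.lookup m i) = e)"


section \<open>Modules, quotient modules and numbers of generators\<close>

text \<open>
  A module is given by its scalar multiplication, as in the locale \<open>module\<close>; submodules and
  generated submodules are \<open>module.subspace\<close> and \<open>module.span\<close>.
\<close>

lemma module_ring: "module ((*) :: 'a::comm_ring_1 \<Rightarrow> 'a \<Rightarrow> 'a)"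
  by unfold_locales (simp_all add: algebra_simps)

lemma module_vec: "module ((*s) :: 'a::comm_ring_1 \<Rightarrow> 'a ^ 'i \<Rightarrow> 'a ^ 'i)"
  by unfold_locales (simp_all add: vec_eq_iff algebra_simps)

definition minimally_generates ::
    "('a::comm_ring_1 \<Rightarrow> 'b::ab_group_add \<Rightarrow> 'b) \<Rightarrow> ('i \<Rightarrow> 'b) \<Rightarrow> 'b set \<Rightarrow> bool"
  where "minimally_generates smul g M \<longleftrightarrow>
    module.span smul (range g) = M \<and> (\<forall>i. module.span smul (g ` (UNIV - {i})) \<noteq> M)"

text \<open>The module \<open>M / N\<close> as a set of cosets. Addition of cosets is elementwise (\<open>Set_Algebras\<close>),
  so its zero element is \<open>N\<close>. In a scalar multiple, \<open>N\<close> has to be added to the elementwise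
  multiple, since \<open>r N\<close> may be smaller than \<open>N\<close>.\<close>

definition quot :: "'b::ab_group_add set \<Rightarrow> 'b set \<Rightarrow> 'b set set"
  where "quot M N = (\<lambda>m. m +o N) ` M"

definition quot_scale ::
    "('a::comm_ring_1 \<Rightarrow> 'b::ab_group_add \<Rightarrow> 'b) \<Rightarrow> 'b set \<Rightarrow> 'a \<Rightarrow> 'b set \<Rightarrow> 'b set"
  where "quot_scale smul N r C = smul r ` C + N"

definition quot_submodule ::
    "('a::comm_ring_1 \<Rightarrow> 'b::ab_group_add \<Rightarrow> 'b) \<Rightarrow> 'b set \<Rightarrow> 'b set set \<Rightarrow> bool"
  where "quot_submodule smul N P \<longleftrightarrow> P \<subseteq> quot UNIV N \<and> N \<in> P \<and>
    (\<forall>C\<in>P. \<forall>D\<in>P. C + D \<in> P) \<and> (\<forall>r. \<forall>C\<in>P. quot_scale smul N r C \<in> P)"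

definition quot_span ::
    "('a::comm_ring_1 \<Rightarrow> 'b::ab_group_add \<Rightarrow> 'b) \<Rightarrow> 'b set \<Rightarrow> 'b set set \<Rightarrow> 'b set set"
  where "quot_span smul N X = \<Inter>{P. quot_submodule smul N P \<and> X \<subseteq> P}"

text \<open>\<open>\<nu>(M / N)\<close>; it is \<open>\<infinity>\<close> if \<open>M / N\<close> is not finitely generated.\<close>

definition nu :: "('a::comm_ring_1 \<Rightarrow> 'b::ab_group_add \<Rightarrow> 'b) \<Rightarrow> 'b set \<Rightarrow> 'b set \<Rightarrow> enat"
  where "nu smul M N =
    (INF G \<in> {G. finite G \<and> G \<subseteq> quot M N \<and> quot_span smul N G = quot M N}. enat (card G))"


section \<open>Ideals\<close>

abbreviation is_ideal :: "'a::comm_ring_1 set \<Rightarrow> bool"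
  where "is_ideal \<equiv> module.subspace (*)"

abbreviation ideal_gen :: "'a::comm_ring_1 set \<Rightarrow> 'a set"
  where "ideal_gen \<equiv> module.span (*)"

definition ideal_prod :: "'a::comm_ring_1 set \<Rightarrow> 'a set \<Rightarrow> 'a set"
  where "ideal_prod A B = ideal_gen {x * y |x y. x \<in> A \<and> y \<in> B}"

fun ideal_pow :: "'a::comm_ring_1 set \<Rightarrow> nat \<Rightarrow> 'a set"
  where
    "ideal_pow A 0 = UNIV"
  | "ideal_pow A (Suc q) = ideal_prod A (ideal_pow A q)"

definition colon :: "'a::comm_ring_1 set \<Rightarrow> 'a set \<Rightarrow> 'a set"
  where "colon A B = {r. \<forall>b\<in>B. r * b \<in> A}"

definition ideal_radical :: "'a::comm_ring_1 set \<Rightarrow> 'a set"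
  where "ideal_radical A = {r. \<exists>q. r ^ q \<in> A}"

definition primary_ideal :: "'a::comm_ring_1 set \<Rightarrow> bool"
  where "primary_ideal Q \<longleftrightarrow> is_ideal Q \<and> Q \<noteq> UNIV \<and>
    (\<forall>x y. x * y \<in> Q \<longrightarrow> x \<in> Q \<or> (\<exists>q. y ^ q \<in> Q))"

definition max_ideal :: "('v, 'b::comm_ring_1) mpoly set"
  where "max_ideal = ideal_gen (range var)"

definition reduction :: "'a::comm_ring_1 set \<Rightarrow> 'a set \<Rightarrow> bool"
  where "reduction J I \<longleftrightarrow> is_ideal J \<and> J \<subseteq> I \<and>
    (\<exists>q. ideal_pow I (q + 1) = ideal_prod J (ideal_pow I q))"

definition minimal_reduction :: "'a::comm_ring_1 set \<Rightarrow> 'a set \<Rightarrow> bool"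
  where "minimal_reduction J I \<longleftrightarrow> reduction J I \<and> (\<forall>J'. reduction J' I \<and> J' \<subseteq> J \<longrightarrow> J' = J)"


section \<open>Syzygies, presentations and first Koszul homology\<close>

definition syzygies :: "'a::comm_ring_1 ^ 'g \<Rightarrow> ('a ^ 'g) set"
  where "syzygies a = {z. (\<Sum>i\<in>UNIV. z $ i * a $ i) = 0}"

definition koszul_relations :: "'a::comm_ring_1 ^ 'g \<Rightarrow> ('a ^ 'g) set"
  where "koszul_relations a =
    module.span (*s) {axis j (a $ i) - axis i (a $ j) |i j. i \<noteq> j}"

text \<open>\<open>homogeneous_vec e\<close> describes the component of degree \<open>e\<close> of the free module with basis in
  degree \<open>0\<close>. The Koszul complex of forms of degree \<open>n\<close> uses the basis degree \<open>n\<close> instead;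
  all degrees below are lower by \<open>n\<close> than in that convention.\<close>

definition homogeneous_vec :: "nat \<Rightarrow> ('v::finite, 'b::zero) mpoly ^ 'g \<Rightarrow> bool"
  where "homogeneous_vec e z \<longleftrightarrow> (\<forall>i. homogeneous e (z $ i))"

text \<open>The matrix \<open>\<phi>\<close> of a minimal graded free presentation: its columns are homogeneous and form
  a minimal generating set of the syzygies of the (minimal, equigenerated) generators \<open>a\<close>.\<close>

definition minimal_presentation ::
    "('v::finite, 'b::comm_ring_1) mpoly ^ 'g \<Rightarrow> ('v, 'b) mpoly ^ 'c ^ 'g \<Rightarrow> bool"
  where "minimal_presentation a \<phi> \<longleftrightarrow>
    (\<forall>j. \<exists>e. homogeneous_vec e (column j \<phi>)) \<and>
    minimally_generates (*s) (\<lambda>j. column j \<phi>) (syzygies a)"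

definition entries_ideal :: "'a::comm_ring_1 ^ 'c ^ 'g \<Rightarrow> 'a set"
  where "entries_ideal \<phi> = ideal_gen {\<phi> $ i $ j |i j. True}"

definition H1 :: "'a::comm_ring_1 ^ 'g \<Rightarrow> ('a ^ 'g) set set"
  where "H1 a = quot (syzygies a) (koszul_relations a)"

definition H1_component :: "('v::finite, 'b::comm_ring_1) mpoly ^ 'g \<Rightarrow> nat \<Rightarrow>
    (('v, 'b) mpoly ^ 'g) set set"
  where "H1_component a e = {C \<in> H1 a. \<exists>z\<in>C. homogeneous_vec e z}"

definition H1_top_degree :: "('v::finite, 'b::comm_ring_1) mpoly ^ 'g \<Rightarrow> nat \<Rightarrow> bool"
  where "H1_top_degree a t \<longleftrightarrow> H1_component a t \<noteq> {koszul_relations a} \<and>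
    (\<forall>e>t. H1_component a e = {koszul_relations a})"

definition syzygetic_module :: "'a::comm_ring_1 ^ 'g \<Rightarrow> ('a ^ 'g) set set"
  where "syzygetic_module a =
    quot (syzygies a \<inter> module.span (*s) {r *s v |r v. r \<in> ideal_gen (range (($) a))})
      (koszul_relations a)"


section \<open>The defining ideal of the Rees algebra\<close>

definition const_scale :: "'a::comm_ring_1 \<Rightarrow> ('g, 'a) mpoly \<Rightarrow> ('g, 'a) mpoly"
  where "const_scale r F = Poly_Mapping.single 0 r * F"

lemma module_const_scale: "module const_scale"
  by unfold_locales
    (simp_all add: const_scale_def algebra_simps single_add mult_single flip: mult.assoc)

text \<open>The \<open>R\<close>-algebra homomorphism \<open>S \<rightarrow> R[t]\<close>, \<open>T\<^sub>i \<mapsto> a\<^sub>i t\<close>; its image is the Rees algebra \<open>R[It]\<close>.\<close>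

definition rees_map :: "'a::comm_ring_1 ^ 'g \<Rightarrow> ('g::finite, 'a) mpoly \<Rightarrow> 'a poly"
  where "rees_map a F = (\<Sum>m\<in>Poly_Mapping.keys F.
    [:Poly_Mapping.lookup F m:] * (\<Prod>i\<in>UNIV. monom (a $ i) 1 ^ Poly_Mapping.lookup m i))"

text \<open>Degrees are taken in the variables \<open>T\<close> only.\<close>

definition S_comp :: "nat \<Rightarrow> ('g::finite, 'a::comm_ring_1) mpoly set"
  where "S_comp i = {F. homogeneous i F}"

definition L_comp :: "'a::comm_ring_1 ^ 'g \<Rightarrow> nat \<Rightarrow> ('g::finite, 'a) mpoly set"
  where "L_comp a i = {F \<in> S_comp i. rees_map a F = 0}"

definition S1L1 :: "'a::comm_ring_1 ^ 'g \<Rightarrow> ('g::finite, 'a) mpoly set"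
  where "S1L1 a = module.span const_scale {F * G |F G. F \<in> S_comp 1 \<and> G \<in> L_comp a 1}"

end

theory Submission
  imports Defs "HOL-Library.Multiset"
begin

text \<open>
  Write \<open>f\<close> for the family of the first \<open>d\<close> generators, \<open>b\<close> for the last one and \<open>K\<close> for the ideal
  generated by all entries of all syzygies of \<open>I\<close>; any presentation matrix has \<open>I\<^sub>1(\<phi>) = K\<close>
  (\<open>entries_ideal_minimal_presentation\<close>). The proof identifies \<open>L\<^sub>2 / S\<^sub>1L\<^sub>1\<close> with \<open>(J : K) / J\<close> and then
  uses that \<open>R / J\<close> is an Artinian Gorenstein ring, in which \<open>(J : K) / J\<close> is dual to \<open>R / K\<close>: generators
  of the former correspond to the socle \<open>(K : \<mm>) / K\<close> of the latter.

  The Gorenstein property is obtained by hand. As \<open>J\<close> is a reduction of an \<open>\<mm>\<close>-primary ideal, it contains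
  powers \<open>x\<^sub>i\<^sup>N\<close>. These form a regular sequence, and multiplication by an element of \<open>J\<close> is homotopic to
  zero on the Koszul complex of \<open>f\<close>; hence the complex is acyclic above degree \<open>|T|\<close> modulo the powers
  indexed by \<open>T\<close> (\<open>koszul_acyclic_mod\<close>). For \<open>T = {}\<close> this says that the syzygies of \<open>f\<close> are the Koszul
  ones. Lifting the class of \<open>1\<close> along connecting homomorphisms, once for each \<open>x\<^sub>i\<^sup>N\<close>, yields a polynomial
  \<open>D\<close> with \<open>J = (x\<^sub>1\<^sup>N, \<dots>, x\<^sub>d\<^sup>N) : D\<close> (\<open>ideal_gen_colon_generator\<close>). Modulo the powers, taking the
  coefficient of \<open>(x\<^sub>1 \<cdots> x\<^sub>d)\<^bsup>N-1\<^esup>\<close> in a product is a perfect pairing, for which complementary monomials are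
  dual; so \<open>\<psi>(p)\<close>, this coefficient of \<open>D p\<close>, induces a perfect pairing \<open>\<psi>(p q)\<close> on \<open>R / J\<close> (\<open>gorenstein_form_exists\<close>). Dual bases with respect to \<open>\<psi>\<close> give
  \<open>\<nu>((J : K) / J) = \<nu>((K : \<mm>) / K)\<close> (\<open>nu_colon_dual\<close>).

  For two syzygies \<open>z\<close>, \<open>w\<close> the combination of \<open>z\<close> and \<open>w\<close> that cancels the last entry is a syzygy of \<open>f\<close>,
  so its entries lie in \<open>J\<close>. With \<open>J : (J : I) = I\<close> this shows that all entries of \<open>z\<close> lie in \<open>I\<close> exactly
  if its last entry lies in \<open>J : K\<close> (\<open>syzygy_entries_in_I_iff\<close>). Sending a quadratic relation
  \<open>\<Sum> c\<^sub>i\<^sub>j T\<^sub>iT\<^sub>j\<close> to \<open>c b\<close>, where \<open>c\<close> is the coefficient of the square of the last variable, then becomes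
  the isomorphism from \<open>L\<^sub>2 / S\<^sub>1L\<^sub>1\<close> to \<open>(J : K) / J\<close> (\<open>nu_L2_mod_S1L1\<close>).

  If \<open>K = \<mm>\<^sup>s\<close>, then \<open>K : \<mm> = \<mm>\<^bsup>s-1\<^esup>\<close> is generated modulo \<open>K\<close> by the monomials of degree \<open>s - 1\<close>, which
  gives the binomial coefficient. Taking the last entry embeds \<open>H\<^sub>1\<close> into \<open>R / J\<close> and maps the syzygetic
  module onto \<open>(J : \<mm>\<^sup>s) / J\<close>. The socle of \<open>R / J\<close> is a line, situated in the top degree \<open>t\<close>; a form of
  degree at most \<open>t - s\<close> outside \<open>J\<close> cannot be killed by \<open>\<mm>\<^sup>s\<close>, since otherwise multiplying it by fewer
  than \<open>s\<close> variables would lead to a socle element of degree below \<open>t\<close>. Hence \<open>J : \<mm>\<^sup>s\<close> is \<open>J\<close> together with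
  everything of degree above \<open>t - s\<close> (\<open>syzygetic_module_generated_by_top_components\<close>).
\<close>


section \<open>Koszul complexes and regular sequences\<close>

interpretation ideal: module "(*) :: 'a::comm_ring_1 \<Rightarrow> 'a \<Rightarrow> 'a"
  by (rule module_ring)

declare ideal.scale_scale [simp del]

lemma ideal_gen_range_iff:
  fixes f :: "'i::finite \<Rightarrow> 'a::comm_ring_1"
  shows "p \<in> ideal_gen (range f) \<longleftrightarrow> (\<exists>c. p = (\<Sum>i\<in>UNIV. c i * f i))"
proof
  assume "p \<in> ideal_gen (range f)"
  then show "\<exists>c. p = (\<Sum>i\<in>UNIV. c i * f i)"
  proof (induction rule: ideal.span_induct_alt)
    case base
    show ?case by (rule exI[of _ "\<lambda>_. 0"]) simp
  next
    case (step r x q)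
    then obtain j c where jc: "x = f j" "q = (\<Sum>i\<in>UNIV. c i * f i)" by blast
    have "r * x + q = (\<Sum>i\<in>UNIV. (if i = j then r else 0) * f i) + (\<Sum>i\<in>UNIV. c i * f i)"
      using jc by (simp add: if_distrib[of "\<lambda>t. t * f _"] cong: if_cong)
    also have "\<dots> = (\<Sum>i\<in>UNIV. ((if i = j then r else 0) + c i) * f i)"
      by (simp add: sum.distrib[symmetric] distrib_right)
    finally show ?case by (rule exI[of _ "\<lambda>i. (if i = j then r else 0) + c i"])
  qed
next
  assume "\<exists>c. p = (\<Sum>i\<in>UNIV. c i * f i)"
  then show "p \<in> ideal_gen (range f)"
    by (elim exE, simp only:) (intro ideal.span_sum ideal.span_scale ideal.span_base rangeI)
qed

text \<open>
  A chain of degree \<open>p\<close> of the Koszul complex of \<open>f\<close> is a function on sets of indices that vanishes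
  outside sets of size \<open>p\<close>; the value at \<open>S\<close> is the coefficient of the exterior product of the basis
  vectors in \<open>S\<close>, taken in increasing order. \<open>koszul_sign i S\<close> is the sign of moving \<open>i\<close> to its place
  in \<open>S\<close>.
\<close>

definition koszul_sign :: "'i::linorder \<Rightarrow> 'i set \<Rightarrow> 'a::comm_ring_1"
  where "koszul_sign i S = (-1) ^ card {j \<in> S. j < i}"

definition koszul_diff ::
    "('i::{finite,linorder} \<Rightarrow> 'a::comm_ring_1) \<Rightarrow> ('i set \<Rightarrow> 'a) \<Rightarrow> 'i set \<Rightarrow> 'a"
  where "koszul_diff f c S = (\<Sum>i\<in>-S. koszul_sign i S * f i * c (insert i S))"

text \<open>
  Exterior multiplication by \<open>\<Sum> r\<^sub>i e\<^sub>i\<close>, the homotopy in \<open>koszul_homotopy\<close>.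
\<close>

definition koszul_mult ::
    "('i::{finite,linorder} \<Rightarrow> 'a::comm_ring_1) \<Rightarrow> ('i set \<Rightarrow> 'a) \<Rightarrow> 'i set \<Rightarrow> 'a"
  where "koszul_mult r c S = (\<Sum>i\<in>S. koszul_sign i S * r i * c (S - {i}))"

definition koszul_chain :: "nat \<Rightarrow> ('i::finite set \<Rightarrow> 'a::zero) \<Rightarrow> bool"
  where "koszul_chain p c \<longleftrightarrow> (\<forall>S. card S \<noteq> p \<longrightarrow> c S = 0)"

lemma koszul_sign_insert:
  assumes "i \<notin> (S :: 'i::{finite,linorder} set)"
  shows "koszul_sign j (insert i S) = (if i < j then - koszul_sign j S else koszul_sign j S :: 'a::comm_ring_1)"
proof -
  have "{k \<in> insert i S. k < j} = (if i < j then insert i {k \<in> S. k < j} else {k \<in> S. k < j})"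
    by auto
  then show ?thesis using assms by (simp add: koszul_sign_def)
qed

lemma koszul_sign_remove:
  assumes "i \<in> (S :: 'i::{finite,linorder} set)"
  shows "koszul_sign j S = (if i < j then - koszul_sign j (S - {i}) else koszul_sign j (S - {i}) :: 'a::comm_ring_1)"
  using koszul_sign_insert[of i "S - {i}" j] assms by (simp add: insert_absorb)

lemma koszul_sign_square:
  "koszul_sign i S * koszul_sign i S = (1 :: 'a::comm_ring_1)"
  "koszul_sign i S * (koszul_sign i S * p) = (p :: 'a)"
  by (simp_all add: koszul_sign_def mult.assoc[symmetric] power_mult_distrib[symmetric])

lemma sum_alternating:
  fixes g :: "'i \<Rightarrow> 'i \<Rightarrow> 'b::ab_group_add"
  assumes "finite A" and anti: "\<And>i j. g i j = - g j i" and diag: "\<And>i. g i i = 0"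
  shows "(\<Sum>i\<in>A. \<Sum>j\<in>A. g i j) = 0"
  using assms(1)
proof (induction A)
  case (insert x A)
  have "(\<Sum>i\<in>A. g i x) = - (\<Sum>i\<in>A. g x i)"
    unfolding sum_negf[symmetric] by (intro sum.cong refl anti)
  then show ?case using insert by (simp add: sum.distrib diag)
qed simp

lemma koszul_diff_diff: "koszul_diff f (koszul_diff f c) S = (0 :: 'a::comm_ring_1)"
proof -
  define g where "g i j = (if i = j then 0 else (if i < j then - 1 else 1) *
      (koszul_sign i S * koszul_sign j S * f i * f j * c (insert i (insert j S))))" for i j
  have "koszul_sign i S * f i * koszul_diff f c (insert i S) = (\<Sum>j\<in>-S. g i j)" if "i \<in> -S" for i
    unfolding koszul_diff_def sum_distrib_left
  proof (rule sum.mono_neutral_cong_left)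
    fix j assume "j \<in> - insert i S"
    then have "i \<noteq> j" by auto
    have "c (insert j (insert i S)) = c (insert i (insert j S))" by (simp only: insert_commute)
    then show "koszul_sign i S * f i * (koszul_sign j (insert i S) * f j * c (insert j (insert i S))) = g i j"
      unfolding g_def koszul_sign_insert[of i S j, OF that[unfolded Compl_iff]] if_not_P[OF \<open>i \<noteq> j\<close>]
      by (cases "i < j") (simp_all only: if_True if_False mult_minus_left mult_minus_right mult_1_left
          mult.left_commute mult.commute mult.assoc)
  qed (auto simp: g_def)
  then have "koszul_diff f (koszul_diff f c) S = (\<Sum>i\<in>-S. \<Sum>j\<in>-S. g i j)"
    by (simp only: koszul_diff_def[of f "koszul_diff f c" S] cong: sum.cong)
  also have "\<dots> = 0"
  proof (rule sum_alternating)
    show "g i j = - g j i" for i j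
    proof -
      have c: "c (insert j (insert i S)) = c (insert i (insert j S))" by (simp only: insert_commute)
      show ?thesis unfolding g_def c by (cases i j rule: linorder_cases) (auto simp: mult.left_commute mult.commute)
    qed
  qed (simp_all add: g_def)
  finally show ?thesis .
qed

text \<open>
  Consequently the ideal generated by \<open>f\<close> annihilates the Koszul homology of \<open>f\<close>. The terms in which an
  index outside \<open>S\<close> is inserted and another one inside \<open>S\<close> is removed occur in both compositions with
  opposite signs; what remains is the diagonal.
\<close>

lemma koszul_homotopy:
  "koszul_diff f (koszul_mult r c) S + koszul_mult r (koszul_diff f c) S
    = (\<Sum>i\<in>UNIV. r i * f i) * (c S :: 'a::comm_ring_1)"
proof -
  define g where "g i j = koszul_sign i S * koszul_sign j (insert i S) * f i * r j * c (insert i (S - {j}))"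
    for i j
  have sgn: "koszul_sign j S * koszul_sign i (S - {j}) = - (koszul_sign i S * koszul_sign j (insert i S) :: 'a)"
    if "i \<notin> S" "j \<in> S" for i j
    unfolding koszul_sign_remove[OF that(2), of i] koszul_sign_insert[OF that(1), of j]
    using that by (cases i j rule: linorder_cases) (auto simp: mult.commute)
  have D: "koszul_diff f (koszul_mult r c) S = (\<Sum>i\<in>-S. r i * f i * c S) + (\<Sum>i\<in>-S. \<Sum>j\<in>S. g i j)"
  proof -
    have "koszul_sign i S * f i * koszul_mult r c (insert i S) = r i * f i * c S + (\<Sum>j\<in>S. g i j)"
      if i: "i \<in> -S" for i
    proof -
      have eq: "insert i S - {j} = insert i (S - {j})" if "j \<in> S" for j using that i by auto
      have "koszul_mult r c (insert i S) = koszul_sign i S * r i * c S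
        + (\<Sum>j\<in>S. koszul_sign j (insert i S) * r j * c (insert i (S - {j})))"
        unfolding koszul_mult_def using i by (simp add: eq koszul_sign_insert)
      then show ?thesis
        by (simp add: distrib_left g_def sum_distrib_left koszul_sign_square ac_simps)
    qed
    then show ?thesis
      by (simp add: koszul_diff_def sum.distrib)
  qed
  have M: "koszul_mult r (koszul_diff f c) S = (\<Sum>i\<in>S. r i * f i * c S) - (\<Sum>i\<in>-S. \<Sum>j\<in>S. g i j)"
  proof -
    have "koszul_sign j S * r j * koszul_diff f c (S - {j}) = r j * f j * c S - (\<Sum>i\<in>-S. g i j)"
      if j: "j \<in> S" for j
    proof -
      have compl: "-(S - {j}) = insert j (-S)" using j by auto
      have same: "koszul_sign j (S - {j}) = (koszul_sign j S :: 'a)"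
        using koszul_sign_remove[OF j, of j, where 'a = 'a] by simp
      have "koszul_diff f c (S - {j}) = koszul_sign j S * f j * c S
        + (\<Sum>i\<in>-S. koszul_sign i (S - {j}) * f i * c (insert i (S - {j})))"
        unfolding koszul_diff_def compl using j by (simp add: insert_absorb same)
      moreover have "koszul_sign j S * r j * (\<Sum>i\<in>-S. koszul_sign i (S - {j}) * f i * c (insert i (S - {j})))
          = - (\<Sum>i\<in>-S. g i j)"
        unfolding sum_distrib_left sum_negf[symmetric]
      proof (rule sum.cong[OF refl])
        fix i assume i: "i \<in> -S"
        have "koszul_sign j S * r j * (koszul_sign i (S - {j}) * f i * c (insert i (S - {j})))
          = (koszul_sign j S * koszul_sign i (S - {j})) * (r j * f i * c (insert i (S - {j})))"
          by (simp add: ac_simps)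
        also have "\<dots> = - g i j"
          using sgn[of i j] i j by (simp only: Compl_iff) (simp add: g_def ac_simps)
        finally show "koszul_sign j S * r j * (koszul_sign i (S - {j}) * f i * c (insert i (S - {j}))) = - g i j" .
      qed
      ultimately show ?thesis
        by (simp add: distrib_left koszul_sign_square ac_simps)
    qed
    then have "koszul_mult r (koszul_diff f c) S = (\<Sum>j\<in>S. r j * f j * c S - (\<Sum>i\<in>-S. g i j))"
      by (simp add: koszul_mult_def)
    then show ?thesis by (simp add: sum_subtractf sum.swap[of _ S "-S"])
  qed
  have U: "(\<Sum>i\<in>UNIV. r i * f i) = (\<Sum>i\<in>-S. r i * f i) + (\<Sum>i\<in>S. r i * f i)"
    by (subst sum.union_disjoint[symmetric]) (auto intro!: sum.cong)
  show ?thesis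
    unfolding D M U by (simp add: distrib_right sum_distrib_right)
qed

lemma koszul_diff_linear:
  "koszul_diff f (\<lambda>S. b S - p * c S) S = koszul_diff f b S - p * (koszul_diff f c S :: 'a::comm_ring_1)"
proof -
  have "p * koszul_diff f c S = (\<Sum>i\<in>-S. koszul_sign i S * f i * (p * c (insert i S)))"
    unfolding koszul_diff_def sum_distrib_left by (rule sum.cong[OF refl]) (simp only: mult.left_commute mult.commute mult.assoc)
  then show ?thesis
    unfolding koszul_diff_def by (simp only: right_diff_distrib sum_subtractf)
qed

lemma koszul_diff_mem:
  assumes "\<And>S. c S \<in> ideal_gen X" shows "koszul_diff f c S \<in> ideal_gen X"
  unfolding koszul_diff_def by (intro ideal.span_sum ideal.span_scale assms)

lemma koszul_mult_mem:
  assumes "\<And>S. c S \<in> ideal_gen X" shows "koszul_mult f c S \<in> ideal_gen X"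
  unfolding koszul_mult_def by (intro ideal.span_sum ideal.span_scale assms)

lemma koszul_chain_diff: "koszul_chain (Suc p) c \<Longrightarrow> koszul_chain p (koszul_diff f c)"
  unfolding koszul_chain_def koszul_diff_def by (auto intro!: sum.neutral)

lemma koszul_chain_mult:
  assumes "koszul_chain p c" shows "koszul_chain (Suc p) (koszul_mult f c)"
  unfolding koszul_chain_def koszul_mult_def
proof (intro allI impI sum.neutral ballI)
  fix S :: "'a set" and i assume "card S \<noteq> Suc p" "i \<in> S"
  then have "card (S - {i}) \<noteq> p" by (auto simp: card_Diff_singleton) (metis Suc_pred card_gt_0_iff emptyE finite)
  then show "koszul_sign i S * f i * c (S - {i}) = 0" using assms by (simp add: koszul_chain_def)
qed

text \<open>
  The regularity condition is imposed for all subfamilies, so that the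
  inductions below can run over sets of indices and adjoin them in any order.
\<close>

locale regular_sequence_in_ideal =
  fixes f y :: "'i::{finite,linorder} \<Rightarrow> 'a::comm_ring_1"
  assumes regular: "i \<notin> T \<Longrightarrow> y i * p \<in> ideal_gen (y ` T) \<Longrightarrow> p \<in> ideal_gen (y ` T)"
    and in_ideal: "y i \<in> ideal_gen (range f)"
begin

definition multipliers :: "'i \<Rightarrow> 'i \<Rightarrow> 'a"
  where "multipliers i = (SOME r. y i = (\<Sum>j\<in>UNIV. r j * f j))"

lemma multipliers: "y i = (\<Sum>j\<in>UNIV. multipliers i j * f j)"
proof -
  have "\<exists>r. y i = (\<Sum>j\<in>UNIV. r j * f j)" using in_ideal[of i] by (simp add: ideal_gen_range_iff)
  then show ?thesis unfolding multipliers_def by (rule someI_ex)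
qed

lemma koszul_section:
  assumes "\<And>S. koszul_diff f c S \<in> ideal_gen (y ` T)"
  shows "koszul_diff f (koszul_mult (multipliers i) c) S - y i * c S \<in> ideal_gen (y ` T)"
proof -
  have "koszul_diff f (koszul_mult (multipliers i) c) S - y i * c S
      = - koszul_mult (multipliers i) (koszul_diff f c) S"
    using koszul_homotopy[of f "multipliers i" c S]
    by (simp add: multipliers[of i] algebra_simps eq_neg_iff_add_eq_0)
  then show ?thesis by (metis assms ideal.span_neg koszul_mult_mem)
qed

text \<open>
  Let \<open>Q\<close> be generated by the \<open>y\<close> indexed by \<open>T\<close>. As \<open>y\<^sub>i\<close> kills homology, the connecting homomorphism
  from \<open>H\<^bsub>p+1\<^esub>\<close> with coefficients in \<open>R/(Q + y\<^sub>i R)\<close> to \<open>H\<^sub>p\<close> with coefficients in \<open>R/Q\<close>, which comes from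
  multiplication by \<open>y\<^sub>i\<close> on \<open>R/Q\<close>, is surjective. Exterior multiplication by the multipliers of \<open>y\<^sub>i\<close>
  lifts cycles back along it: the differential of the lift is \<open>y\<^sub>i c\<close> modulo \<open>Q\<close>.
\<close>

lemma koszul_section_cycle:
  assumes "\<And>S. koszul_diff f c S \<in> ideal_gen (y ` T)"
  shows "koszul_diff f (koszul_mult (multipliers i) c) S \<in> ideal_gen (y ` insert i T)"
proof -
  have "(koszul_diff f (koszul_mult (multipliers i) c) S - y i * c S) + c S * y i \<in> ideal_gen (y ` insert i T)"
  proof (rule ideal.span_add)
    show "koszul_diff f (koszul_mult (multipliers i) c) S - y i * c S \<in> ideal_gen (y ` insert i T)"
      using koszul_section[OF assms] ideal.span_mono[of "y ` T" "y ` insert i T"] by blast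
    show "c S * y i \<in> ideal_gen (y ` insert i T)" by (intro ideal.span_scale ideal.span_base) simp
  qed
  then show ?thesis by (simp add: ac_simps)
qed

text \<open>
  If \<open>s\<close> times the lift of \<open>c\<close> is a boundary modulo \<open>Q + y\<^sub>i R\<close>, then \<open>s c\<close>, its image under the connecting
  homomorphism, is a boundary modulo \<open>Q\<close>: one writes the difference as \<open>y\<^sub>i b\<close> modulo \<open>Q\<close>, applies the
  differential and cancels \<open>y\<^sub>i\<close>.
\<close>

lemma koszul_section_injective:
  assumes i: "i \<notin> T" and c: "koszul_chain p c" "\<And>S. koszul_diff f c S \<in> ideal_gen (y ` T)"
    and e: "koszul_chain (Suc (Suc p)) e"
      "\<And>S. s * koszul_mult (multipliers i) c S - koszul_diff f e S \<in> ideal_gen (y ` insert i T)"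
  shows "\<exists>b. koszul_chain (Suc p) b \<and> (\<forall>S. s * c S - koszul_diff f b S \<in> ideal_gen (y ` T))"
proof -
  let ?Q = "ideal_gen (y ` T)"
  define d where "d = koszul_mult (multipliers i) c"
  have "\<exists>k. s * d S - koszul_diff f e S - k * y i \<in> ?Q" for S
    using e(2)[of S] by (simp add: ideal.span_breakdown_eq d_def)
  then obtain b0 where b0: "\<And>S. s * d S - koszul_diff f e S - b0 S * y i \<in> ?Q" by metis
  define b where "b S = (if card S = Suc p then b0 S else 0)" for S
  have b: "s * d S - koszul_diff f e S - y i * b S \<in> ?Q" for S
  proof (cases "card S = Suc p")
    case True
    then show ?thesis using b0[of S] by (simp add: b_def ac_simps)
  next
    case False
    then have "d S = 0" "koszul_diff f e S = 0"
      using koszul_chain_mult[OF c(1)] koszul_chain_diff[OF e(1)] by (auto simp: d_def koszul_chain_def)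
    then show ?thesis using False by (simp add: b_def ideal.span_zero)
  qed
  show ?thesis
  proof (intro exI conjI allI)
    show "koszul_chain (Suc p) b" by (simp add: koszul_chain_def b_def)
    fix S
    have "koszul_diff f (\<lambda>S. (0 - (-s) * d S) - 1 * koszul_diff f e S - y i * b S) S \<in> ?Q"
      by (rule koszul_diff_mem) (use b in simp)
    then have "s * koszul_diff f d S - y i * koszul_diff f b S \<in> ?Q"
      unfolding koszul_diff_linear by (simp add: koszul_diff_diff koszul_diff_def[of f "\<lambda>_. 0"])
    moreover have "s * (koszul_diff f d S - y i * c S) \<in> ?Q"
      unfolding d_def by (rule ideal.span_scale[OF koszul_section[OF c(2)]])
    ultimately have "(s * koszul_diff f d S - y i * koszul_diff f b S) - s * (koszul_diff f d S - y i * c S) \<in> ?Q"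
      by (rule ideal.span_diff)
    then have "y i * (s * c S - koszul_diff f b S) \<in> ?Q"
      by (simp add: algebra_simps)
    then show "s * c S - koszul_diff f b S \<in> ?Q" by (rule regular[OF i])
  qed
qed

text \<open>
  Induction on the complement of \<open>T\<close>. For \<open>T = UNIV\<close> there are no nonzero chains of degree \<open>p > |T|\<close>;
  otherwise a cycle is lifted to a cycle modulo a larger \<open>T\<close>, which is a boundary by induction, and
  then the cycle itself is a boundary.
\<close>

theorem koszul_acyclic_mod:
  assumes "card T < p" "koszul_chain p c" "\<And>S. koszul_diff f c S \<in> ideal_gen (y ` T)"
  shows "\<exists>b. koszul_chain (Suc p) b \<and> (\<forall>S. c S - koszul_diff f b S \<in> ideal_gen (y ` T))"
  using assms
proof (induction "card (-T)" arbitrary: T p c)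
  case 0
  then have T: "T = UNIV" by (metis boolean_algebra.compl_zero card_eq_0_iff double_complement finite)
  have "c S = 0" for S
  proof -
    have "card S \<le> card T" unfolding T by (rule card_mono) auto
    then show ?thesis using 0 by (auto simp: koszul_chain_def)
  qed
  then show ?case
    by (intro exI[of _ "\<lambda>_. 0"]) (auto simp: koszul_chain_def koszul_diff_def ideal.span_zero)
next
  case (Suc m)
  then obtain i where i: "i \<notin> T"
    by (metis ComplD all_not_in_conv card.empty nat.distinct(1))
  have card: "m = card (- insert i T)" "card (insert i T) < Suc p"
    using Suc(2,3) i by (simp_all add: Compl_insert card_Diff_singleton)
  from Suc.hyps(1)[OF card koszul_chain_mult[OF Suc.prems(2)] koszul_section_cycle[OF Suc.prems(3)]]
  obtain e where e: "koszul_chain (Suc (Suc p)) e"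
    "\<And>S. koszul_mult (multipliers i) c S - koszul_diff f e S \<in> ideal_gen (y ` insert i T)"
    by blast
  show ?case
    using koszul_section_injective[OF i Suc.prems(2,3) e(1), of 1] e(2) by simp
qed

text \<open>
  Acyclicity in degree \<open>1\<close>, written out: the values of a \<open>2\<close>-chain on pairs form an alternating matrix.
\<close>

lemma koszul_syzygies_alternating:
  assumes z: "(\<Sum>i\<in>UNIV. z i * f i) = 0"
  shows "\<exists>e. (\<forall>i j. e i j = - e j i) \<and> (\<forall>i. e i i = 0) \<and> (\<forall>i. z i = (\<Sum>j\<in>UNIV. e i j * f j))"
proof -
  define c :: "'i set \<Rightarrow> 'a" where "c S = (if card S = 1 then z (the_elem S) else 0)" for S
  have c: "koszul_chain 1 c" by (simp add: koszul_chain_def c_def)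
  have "koszul_diff f c S = 0" for S
  proof (cases "S = {}")
    case True
    then show ?thesis using z by (simp add: koszul_diff_def c_def koszul_sign_def ac_simps)
  next
    case False
    then have "card S \<noteq> 0" by simp
    then show ?thesis using koszul_chain_diff[of 0 c f] c by (simp add: koszul_chain_def)
  qed
  then obtain b where b: "\<And>S. c S = koszul_diff f b S"
    using koszul_acyclic_mod[of "{}" 1 c] c by auto
  define e where "e i j = (if i = j then 0 else (if i < j then -1 else 1) * b {i, j})" for i j
  have "z i = (\<Sum>j\<in>UNIV. e i j * f j)" for i
  proof -
    have "z i = koszul_diff f b {i}" using b[of "{i}"] by (simp add: c_def)
    also have "\<dots> = (\<Sum>j\<in>-{i}. e i j * f j)"
    proof -
      have "koszul_sign j {i} = (if i < j then -1 else 1 :: 'a)" for j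
      proof -
        have "koszul_sign j {} = (1 :: 'a)" by (simp add: koszul_sign_def)
        then show ?thesis using koszul_sign_insert[of i "{}" j, where 'a = 'a] by simp
      qed
      then show ?thesis
        unfolding koszul_diff_def e_def
        by (intro sum.cong refl) (simp add: insert_commute[of _ i] mult.assoc mult.commute[of "f _"])
    qed
    also have "\<dots> = (\<Sum>j\<in>UNIV. e i j * f j)"
      by (rule sum.mono_neutral_left) (auto simp: e_def)
    finally show ?thesis .
  qed
  moreover have "e i j = - e j i" for i j
  proof -
    have b: "b {j, i} = b {i, j}" by (simp only: insert_commute)
    show ?thesis unfolding e_def b by (cases i j rule: linorder_cases) auto
  qed
  moreover have "e i i = 0" for i by (simp add: e_def)
  ultimately show ?thesis by blast
qed

text \<open>
  Starting from the class of \<open>1\<close> in degree \<open>0\<close>, lifting once for each index leads to a cycle modulo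
  all \<open>y\<close> in the top degree, which is a single ring element \<open>D\<close>. As lifting reflects boundaries
  and there are no nonzero boundaries in the top degree, \<open>r D\<close> lies in the ideal of the \<open>y\<close> exactly if
  \<open>r\<close> vanishes in the homology of degree \<open>0\<close>, the quotient by \<open>f\<close>. (\<open>D\<close> is the determinant that expresses the \<open>y\<close> by
  the \<open>f\<close>.) The induction carries along that a multiple of the current cycle is a boundary only if
  the factor lies in the ideal of \<open>f\<close>.
\<close>

lemma ideal_gen_colon_generator:
  "\<exists>D. \<forall>r. r \<in> ideal_gen (range f) \<longleftrightarrow> r * D \<in> ideal_gen (range y)"
proof -
  have "\<exists>b. koszul_chain (card T) b \<and> (\<forall>S. koszul_diff f b S \<in> ideal_gen (y ` T)) \<and>
     (\<forall>r e. koszul_chain (Suc (card T)) e \<longrightarrow> (\<forall>S. r * b S - koszul_diff f e S \<in> ideal_gen (y ` T)) \<longrightarrow> r \<in> ideal_gen (range f))"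
    for T :: "'i set"
  proof (induction T rule: finite_induct[OF finite])
    case 1
    show ?case
    proof (intro exI[of _ "\<lambda>S. if S = {} then 1 else 0"] conjI allI impI)
      fix r e assume "\<forall>S. r * (if S = {} then 1 else 0) - koszul_diff f e S \<in> ideal_gen (y ` {})"
      then have "r = koszul_diff f e {}" by (auto dest: spec[of _ "{}"])
      also have "\<dots> \<in> ideal_gen (range f)"
        unfolding koszul_diff_def
      proof (rule ideal.span_sum)
        fix i
        have "koszul_sign i {} * e (insert i {}) * f i \<in> ideal_gen (range f)"
          by (intro ideal.span_scale ideal.span_base) simp
        then show "koszul_sign i {} * f i * e (insert i {}) \<in> ideal_gen (range f)"
          by (simp only: mult.left_commute mult.commute mult.assoc)
      qed
      finally show "r \<in> ideal_gen (range f)" .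
    qed (auto simp: koszul_chain_def koszul_diff_def)
  next
    case (2 i T)
    then obtain b where b: "koszul_chain (card T) b" "\<And>S. koszul_diff f b S \<in> ideal_gen (y ` T)"
       "\<And>r e. koszul_chain (Suc (card T)) e \<Longrightarrow> (\<And>S. r * b S - koszul_diff f e S \<in> ideal_gen (y ` T)) \<Longrightarrow> r \<in> ideal_gen (range f)"
      by blast
    have card: "card (insert i T) = Suc (card T)" using 2 by simp
    show ?case
      unfolding card
    proof (intro exI[of _ "koszul_mult (multipliers i) b"] conjI allI impI)
      show "koszul_chain (Suc (card T)) (koszul_mult (multipliers i) b)" by (rule koszul_chain_mult[OF b(1)])
      show "koszul_diff f (koszul_mult (multipliers i) b) S \<in> ideal_gen (y ` insert i T)" for S
        by (rule koszul_section_cycle[OF b(2)])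
    next
      fix r e assume "koszul_chain (Suc (Suc (card T))) e"
        "\<forall>S. r * koszul_mult (multipliers i) b S - koszul_diff f e S \<in> ideal_gen (y ` insert i T)"
      then obtain b' where "koszul_chain (Suc (card T)) b'" "\<And>S. r * b S - koszul_diff f b' S \<in> ideal_gen (y ` T)"
        using koszul_section_injective[OF 2(2) b(1,2)] by blast
      then show "r \<in> ideal_gen (range f)" by (rule b(3))
    qed
  qed
  from this[of UNIV] obtain b where b: "koszul_chain (card (UNIV :: 'i set)) b"
     "\<And>S. koszul_diff f b S \<in> ideal_gen (range y)"
     "\<And>r e. koszul_chain (Suc (card (UNIV :: 'i set))) e \<Longrightarrow> (\<And>S. r * b S - koszul_diff f e S \<in> ideal_gen (range y)) \<Longrightarrow> r \<in> ideal_gen (range f)"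
    by blast
  have b0: "b S = 0" if "S \<noteq> UNIV" for S
    using b(1) that psubset_card_mono[of UNIV S] by (force simp: koszul_chain_def psubset_eq)
  have fb: "f i * b UNIV \<in> ideal_gen (range y)" for i
  proof -
    have "koszul_diff f b (-{i}) = koszul_sign i (-{i}) * f i * b UNIV"
    proof -
      have "insert i (-{i}) = UNIV" by auto
      then show ?thesis by (simp add: koszul_diff_def)
    qed
    then have "koszul_sign i (-{i}) * (koszul_sign i (-{i}) * (f i * b UNIV)) \<in> ideal_gen (range y)"
      using b(2)[of "-{i}"] by (metis ideal.span_scale mult.assoc)
    then show ?thesis by (simp only: koszul_sign_square(2))
  qed
  show ?thesis
  proof (intro exI[of _ "b UNIV"] allI iffI)
    fix r assume "r \<in> ideal_gen (range f)"
    then obtain c where "r = (\<Sum>i\<in>UNIV. c i * f i)" by (auto simp: ideal_gen_range_iff)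
    then show "r * b UNIV \<in> ideal_gen (range y)"
      by (simp only: sum_distrib_right mult.assoc) (intro ideal.span_sum ideal.span_scale fb)
  next
    fix r assume r: "r * b UNIV \<in> ideal_gen (range y)"
    show "r \<in> ideal_gen (range f)"
    proof (rule b(3)[of "\<lambda>_. 0"])
      fix S show "r * b S - koszul_diff f (\<lambda>_. 0) S \<in> ideal_gen (range y)"
        using r b0[of S] by (cases "S = UNIV") (auto simp: koszul_diff_def ideal.span_zero)
    qed (simp add: koszul_chain_def)
  qed
qed

end

section \<open>Powers of the variables and a Gorenstein functional\<close>

abbreviation "lookup \<equiv> Poly_Mapping.lookup"
abbreviation "single \<equiv> Poly_Mapping.single"
abbreviation "keys \<equiv> Poly_Mapping.keys"

lemma vector_space_const_scale: "vector_space (const_scale :: 'k::field \<Rightarrow> ('v, 'k) mpoly \<Rightarrow> _)"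
  unfolding module_iff_vector_space[symmetric] by (rule module_const_scale)

interpretation coeff: vector_space "const_scale :: 'k::field \<Rightarrow> ('v, 'k) mpoly \<Rightarrow> ('v, 'k) mpoly"
  by (rule vector_space_const_scale)

interpretation coeff_form: vector_space_pair
  "const_scale :: 'k::field \<Rightarrow> ('v, 'k) mpoly \<Rightarrow> ('v, 'k) mpoly" "(*) :: 'k \<Rightarrow> 'k \<Rightarrow> 'k"
  by (intro vector_space_pair.intro vector_space_const_scale)
     (unfold module_iff_vector_space[symmetric], rule module_ring)

declare coeff.scale_scale [simp del]

lemma const_scale_mult: "const_scale c p * q = const_scale c (p * q)"
  "p * const_scale c q = const_scale c (p * q)"
  by (simp_all add: const_scale_def ac_simps)

lemma is_ideal_imp_coeff_subspace: "is_ideal K \<Longrightarrow> coeff.subspace (K :: ('v, 'k::field) mpoly set)"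
  unfolding coeff.subspace_def by (auto simp: const_scale_def ideal.subspace_0 ideal.subspace_add ideal.subspace_scale)

lemma mpoly_sum_monomials: "p = (\<Sum>m\<in>keys p. single m (lookup p m))"
  by (rule poly_mapping_eqI) (simp add: lookup_sum lookup_single when_def not_in_keys_iff_lookup_eq_zero)

lemma lookup_single_mult:
  fixes p :: "'m::cancel_comm_monoid_add \<Rightarrow>\<^sub>0 'b::comm_ring_1"
  shows "lookup (single m c * p) (m + l) = c * lookup p l"
  by (simp add: lookup_mult lookup_single when_mult)

lemma var_power: "var i ^ N = single (single i N) (1::'b::comm_ring_1)"
  by (induction N) (simp_all add: var_def mult_single single_add[symmetric])

lemma exponent_cancel:
  fixes m :: "'v \<Rightarrow>\<^sub>0 nat"
  assumes "\<And>i. lookup l i \<le> lookup m i"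
  shows "l + (m - l) = m"
  by (rule poly_mapping_eqI) (simp add: lookup_add lookup_minus assms)

text \<open>
  The ideal generated by the \<open>N\<close>-th powers of the variables in \<open>T\<close>, see \<open>ideal_gen_var_powers\<close>. The
  description by exponents makes membership a condition on single monomials.
\<close>

definition box_ideal :: "nat \<Rightarrow> 'v set \<Rightarrow> ('v, 'b::comm_ring_1) mpoly set"
  where "box_ideal N T = {p. \<forall>m\<in>keys p. \<exists>i\<in>T. N \<le> lookup m i}"

lemma is_ideal_box_ideal: "is_ideal (box_ideal N T :: ('v, 'b::comm_ring_1) mpoly set)"
proof (rule ideal.subspaceI)
  show "0 \<in> box_ideal N T" by (simp add: box_ideal_def)
  show "p + q \<in> box_ideal N T" if "p \<in> box_ideal N T" "q \<in> box_ideal N T"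
    for p q :: "('v, 'b) mpoly"
    using that keys_add[of p q] by (auto simp: box_ideal_def)
  show "c * p \<in> box_ideal N T" if p: "p \<in> box_ideal N T" for c p :: "('v, 'b) mpoly"
    unfolding box_ideal_def
  proof (clarify)
    fix m assume "m \<in> keys (c * p)"
    then obtain a b where "m = a + b" "b \<in> keys p" using keys_mult[of c p] by blast
    moreover from this obtain i where "i \<in> T" "N \<le> lookup b i"
      using p by (auto simp: box_ideal_def)
    ultimately show "\<exists>i\<in>T. N \<le> lookup m i"
      by (intro bexI[of _ i]) (simp_all add: lookup_add)
  qed
qed

lemma ideal_gen_var_powers: "ideal_gen ((\<lambda>i. var i ^ N) ` T) = (box_ideal N T :: ('v, 'b::comm_ring_1) mpoly set)"
proof
  show "ideal_gen ((\<lambda>i. var i ^ N) ` T) \<subseteq> (box_ideal N T :: ('v, 'b) mpoly set)"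
    by (rule ideal.span_minimal[OF _ is_ideal_box_ideal])
       (auto simp: box_ideal_def var_power, metis lookup_single_eq order_refl)
  show "(box_ideal N T :: ('v, 'b) mpoly set) \<subseteq> ideal_gen ((\<lambda>i. var i ^ N) ` T)"
  proof
    fix p :: "('v, 'b) mpoly" assume p: "p \<in> box_ideal N T"
    have "single m (lookup p m) \<in> ideal_gen ((\<lambda>i. var i ^ N) ` T)"
      if "m \<in> keys p" for m
    proof -
      from that p have "\<exists>i\<in>T. N \<le> lookup m i" by (auto simp: box_ideal_def)
      then obtain i where i: "i \<in> T" "N \<le> lookup m i" by blast
      then have "single i N + (m - single i N) = m"
        by (intro exponent_cancel) (auto simp: lookup_single when_def)
      then have "single m (lookup p m)
         = single (m - single i N) (lookup p m) * var i ^ N"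
        by (simp add: var_power mult_single add.commute)
      then show ?thesis using i(1) by (metis ideal.span_base ideal.span_scale imageI)
    qed
    then show "p \<in> ideal_gen ((\<lambda>i. var i ^ N) ` T)"
      by (subst mpoly_sum_monomials) (rule ideal.span_sum)
  qed
qed

lemma var_powers_regular:
  fixes p :: "('v, 'b::comm_ring_1) mpoly"
  assumes "i \<notin> T" and "var i ^ N * p \<in> ideal_gen ((\<lambda>i. var i ^ N) ` T)"
  shows "p \<in> ideal_gen ((\<lambda>i. var i ^ N) ` T)"
  unfolding ideal_gen_var_powers box_ideal_def
proof clarify
  fix m assume m: "m \<in> keys p"
  have "single i N + m \<in> keys (var i ^ N * p)"
    using m by (simp add: in_keys_iff var_power lookup_single_mult)
  then obtain j where j: "j \<in> T" "N \<le> lookup (single i N + m) j"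
    using assms(2) unfolding ideal_gen_var_powers box_ideal_def by blast
  moreover have "j \<noteq> i" using j assms(1) by auto
  ultimately show "\<exists>i\<in>T. N \<le> lookup m i"
    by (intro bexI[of _ j]) (simp_all add: lookup_add lookup_single when_def split: if_splits)
qed

text \<open>
  The exponent of the only monomial, up to scalars, in the socle of the quotient by the \<open>N\<close>-th powers of
  all variables.
\<close>

definition corner :: "nat \<Rightarrow> 'v::finite \<Rightarrow>\<^sub>0 nat"
  where "corner N = Abs_poly_mapping (\<lambda>_. N - 1)"

lemma lookup_corner [simp]: "lookup (corner N) i = N - 1"
  by (simp add: corner_def)

text \<open>
  A monomial with all exponents below \<open>N\<close> has a complementary monomial that multiplies it to the corner;
  this makes the pairing by the corner coefficient nondegenerate modulo the powers.
\<close>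

lemma box_ideal_iff_corner:
  fixes p :: "('v::finite, 'b::comm_ring_1) mpoly"
  assumes "N > 0"
  shows "p \<in> box_ideal N UNIV \<longleftrightarrow> (\<forall>q. lookup (q * p) (corner N) = 0)"
proof (intro iffI allI)
  fix q assume "p \<in> box_ideal N UNIV"
  then have "q * p \<in> box_ideal N UNIV" by (rule ideal.subspace_scale[OF is_ideal_box_ideal])
  then show "lookup (q * p) (corner N) = 0"
  proof (rule contrapos_pp)
    assume "lookup (q * p) (corner N) \<noteq> 0"
    then have "corner N \<in> keys (q * p)" by (simp add: in_keys_iff)
    then show "q * p \<notin> box_ideal N UNIV" using assms unfolding box_ideal_def by fastforce
  qed
next
  assume *: "\<forall>q. lookup (q * p) (corner N) = 0"
  show "p \<in> box_ideal N UNIV"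
    unfolding box_ideal_def
  proof clarify
    fix m assume m: "m \<in> keys p"
    show "\<exists>i\<in>UNIV. N \<le> lookup m i"
    proof (rule ccontr)
      assume "\<not> ?thesis"
      then have lt: "lookup m i < N" for i by (simp add: not_le)
      have "lookup m i \<le> lookup (corner N) i" for i
        using lt[of i] unfolding lookup_corner by linarith
      then have "m + (corner N - m) = corner N" by (rule exponent_cancel)
      then have "lookup (single (corner N - m) 1 * p) (corner N) = lookup p m"
        using lookup_single_mult[of "corner N - m" 1 p m] by (simp add: add.commute)
      then show False using * m by (simp add: in_keys_iff)
    qed
  qed
qed

lemma finite_box: "finite {m :: 'v::finite \<Rightarrow>\<^sub>0 nat. \<forall>i. lookup m i < N}"
proof (rule finite_imageD)
  show "inj_on lookup {m :: 'v \<Rightarrow>\<^sub>0 nat. \<forall>i. lookup m i < N}"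
    by (auto intro!: inj_onI poly_mapping_eqI)
  have "lookup ` {m :: 'v \<Rightarrow>\<^sub>0 nat. \<forall>i. lookup m i < N} \<subseteq> (UNIV \<rightarrow>\<^sub>E {..<N})"
    by (auto simp: PiE_def)
  then show "finite (lookup ` {m :: 'v \<Rightarrow>\<^sub>0 nat. \<forall>i. lookup m i < N})"
    by (rule finite_subset) (intro finite_PiE, auto)
qed

text \<open>
  The representing polynomial \<open>w\<close> has the values of \<open>g\<close> on monomials as its coefficients, placed at the
  complementary exponents.
\<close>

lemma corner_represents:
  fixes g :: "('v::finite, 'k::field) mpoly \<Rightarrow> 'k"
  assumes "N > 0" and g: "Vector_Spaces.linear const_scale (*) g" and "\<And>p. p \<in> box_ideal N UNIV \<Longrightarrow> g p = 0"
  shows "\<exists>w. \<forall>p. g p = lookup (w * p) (corner N)"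
proof -
  define E where "E = {m :: 'v \<Rightarrow>\<^sub>0 nat. \<forall>i. lookup m i < N}"
  have finE: "finite E" unfolding E_def by (rule finite_box)
  define w where "w = (\<Sum>l\<in>E. single (corner N - l) (g (single l 1)))"
  have mono: "g (single m c) = lookup (w * single m c) (corner N)" for m c
  proof (cases "m \<in> E")
    case True
    have *: "corner N - l + m = corner N \<longleftrightarrow> l = m" if "l \<in> E" for l
    proof -
      have "lookup l i \<le> lookup (corner N) i" for i
      proof -
        have "lookup l i < N" using that by (simp add: E_def)
        then show ?thesis unfolding lookup_corner by linarith
      qed
      then have "corner N - l + l = corner N" using exponent_cancel[of l "corner N"] by (simp add: add.commute)
      then show ?thesis by (metis add_left_cancel)
    qed
    have "lookup (w * single m c) (corner N)
      = (\<Sum>l\<in>E. if l = m then g (single l 1) * c else 0)"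
      unfolding w_def sum_distrib_right lookup_sum
      by (rule sum.cong) (simp_all add: mult_single lookup_single when_def *)
    also have "\<dots> = c * g (single m 1)"
      using True finE by simp
    also have "\<dots> = g (const_scale c (single m 1))"
      by (simp add: coeff_form.linear_scale[OF g])
    finally show ?thesis by (simp add: const_scale_def mult_single)
  next
    case False
    then have "single m c \<in> box_ideal N UNIV"
      by (auto simp: E_def box_ideal_def not_less)
    then show ?thesis using assms(3) box_ideal_iff_corner[OF assms(1)] by metis
  qed
  have "g p = lookup (w * p) (corner N)" for p
  proof -
    have "g p = (\<Sum>m\<in>keys p. g (single m (lookup p m)))"
      by (subst mpoly_sum_monomials) (rule coeff_form.linear_sum[OF g])
    also have "\<dots> = lookup (w * (\<Sum>m\<in>keys p. single m (lookup p m))) (corner N)"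
      by (simp add: mono sum_distrib_left lookup_sum)
    finally show ?thesis by (simp flip: mpoly_sum_monomials)
  qed
  then show ?thesis by blast
qed

lemma separating_form:
  fixes W :: "('v::finite, 'k::field) mpoly set"
  assumes W: "coeff.subspace W" and "v \<notin> W"
  shows "\<exists>g. Vector_Spaces.linear const_scale (*) g \<and> (\<forall>x\<in>W. g x = 0) \<and> g v = (1::'k)"
proof -
  obtain B where B: "B \<subseteq> W" "coeff.independent B" "W \<subseteq> coeff.span B"
    by (rule coeff.maximal_independent_subset)
  have v: "v \<notin> coeff.span B" using B(1) W assms(2) coeff.span_minimal by blast
  have "coeff.independent (insert v B)" by (rule coeff.independent_insertI[OF v B(2)])
  then obtain g where g: "Vector_Spaces.linear const_scale (*) g" "\<forall>x\<in>insert v B. g x = (if x = v then 1 else (0::'k))"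
    using coeff_form.linear_independent_extend[of "insert v B" "\<lambda>x. if x = v then 1 else 0"] by blast
  have "g x = 0" if "x \<in> B" for x using g(2) that v coeff.span_base by auto
  then have "g x = 0" if "x \<in> W" for x
    using that B(3) coeff_form.linear_eq_0_on_span[OF g(1), of B x] by auto
  then show ?thesis using g by auto
qed

lemma var_powers_regular_sequence:
  fixes f :: "'v::{finite,linorder} \<Rightarrow> ('v, 'b::comm_ring_1) mpoly"
  assumes "\<And>i. var i ^ N \<in> ideal_gen (range f)"
  shows "regular_sequence_in_ideal f (\<lambda>i. var i ^ N)"
  by (rule regular_sequence_in_ideal.intro[OF var_powers_regular assms])

text \<open>
  The functional \<open>\<psi>\<close> generates the dual of \<open>R / J\<close> as an \<open>R\<close>-module, with annihilator \<open>J\<close>; this is one of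
  the characterizations of Gorenstein among Artinian quotients of a polynomial ring.
\<close>

locale gorenstein_form =
  fixes J :: "('v::finite, 'k::field) mpoly set" and \<psi> :: "('v, 'k) mpoly \<Rightarrow> 'k" and N :: nat
  assumes ideal_J: "is_ideal J"
    and linear_\<psi>: "Vector_Spaces.linear const_scale (*) \<psi>"
    and mem_J_iff: "r \<in> J \<longleftrightarrow> (\<forall>p. \<psi> (p * r) = 0)"
    and represents: "Vector_Spaces.linear const_scale (*) g \<Longrightarrow> (\<And>r. r \<in> J \<Longrightarrow> g r = 0) \<Longrightarrow>
      \<exists>w. \<forall>p. g p = \<psi> (w * p)"
    and box: "box_ideal N UNIV \<subseteq> J"

text \<open>
  With \<open>D\<close> from \<open>ideal_gen_colon_generator\<close>, the functional is the corner coefficient of \<open>D p\<close>. A functional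
  that vanishes on \<open>J\<close> is the corner coefficient of \<open>u p\<close> for some \<open>u\<close>, and \<open>u\<close> has to be shown to lie in
  \<open>W = (D) + (x\<^sub>1\<^sup>N, \<dots>, x\<^sub>d\<^sup>N)\<close>. If it did not, a functional separating \<open>u\<close> from \<open>W\<close> would be given by
  some \<open>s\<close> with \<open>s D\<close> in the box ideal, that is, \<open>s\<close> in \<open>J\<close>; but then the given functional
  vanishes at \<open>s\<close>, while its value at \<open>s\<close> is that of the separating one at \<open>u\<close>.
\<close>

lemma gorenstein_form_exists:
  fixes f :: "'v::{finite,linorder} \<Rightarrow> ('v, 'k::field) mpoly"
  assumes N: "N > 0" and f: "\<And>i. var i ^ N \<in> ideal_gen (range f)"
  shows "\<exists>\<psi>. gorenstein_form (ideal_gen (range f)) \<psi> N"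
proof -
  obtain D where D: "\<And>r. r \<in> ideal_gen (range f) \<longleftrightarrow> r * D \<in> box_ideal N UNIV"
    using regular_sequence_in_ideal.ideal_gen_colon_generator[OF var_powers_regular_sequence[OF f]]
    unfolding ideal_gen_var_powers by blast
  define \<psi> where "\<psi> p = lookup (D * p) (corner N)" for p
  have lin: "Vector_Spaces.linear const_scale (*) \<psi>"
    unfolding module_hom_iff_linear[symmetric]
    by (intro module_hom.intro module_const_scale module_ring module_hom_axioms.intro)
       (simp_all add: \<psi>_def distrib_left lookup_add const_scale_mult,
        simp add: const_scale_def lookup_single_mult[of 0, simplified])
  have J: "r \<in> ideal_gen (range f) \<longleftrightarrow> (\<forall>p. \<psi> (p * r) = 0)" for r
    unfolding D box_ideal_iff_corner[OF N] \<psi>_def by (simp add: ac_simps)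
  have Q: "p \<in> box_ideal N UNIV \<Longrightarrow> p \<in> ideal_gen (range f)" for p :: "('v, 'k) mpoly"
    unfolding D by (metis ideal.subspace_scale is_ideal_box_ideal mult.commute)
  have "\<exists>w. \<forall>p. g p = \<psi> (w * p)"
    if g: "Vector_Spaces.linear const_scale (*) g" "\<And>r. r \<in> ideal_gen (range f) \<Longrightarrow> g r = 0" for g
  proof -
    obtain u where u: "\<And>p. g p = lookup (u * p) (corner N)"
      using corner_represents[OF N g(1)] g(2) Q by blast
    define W where "W = {D * w + q |w q. q \<in> box_ideal N (UNIV :: 'v set)}"
    have W: "coeff.subspace W"
    proof (rule is_ideal_imp_coeff_subspace, rule ideal.subspaceI)
      show "0 \<in> W"
        unfolding W_def using ideal.subspace_0[OF is_ideal_box_ideal] by (auto intro!: exI[of _ 0])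
    next
      fix x y assume "x \<in> W" "y \<in> W"
      then obtain w q w' q' where "x = D * w + q" "y = D * w' + q'"
        "q \<in> box_ideal N UNIV" "q' \<in> box_ideal N UNIV"
        by (auto simp: W_def)
      then have "x + y = D * (w + w') + (q + q')" "q + q' \<in> box_ideal N UNIV"
        by (auto simp: distrib_left intro: ideal.subspace_add[OF is_ideal_box_ideal])
      then show "x + y \<in> W" unfolding W_def by blast
    next
      fix c x assume "x \<in> W"
      then obtain w q where "x = D * w + q" "q \<in> box_ideal N UNIV"
        by (auto simp: W_def)
      then have "c * x = D * (c * w) + c * q" "c * q \<in> box_ideal N UNIV"
        by (auto simp: distrib_left mult.left_commute intro: ideal.subspace_scale[OF is_ideal_box_ideal])
      then show "c * x \<in> W" unfolding W_def by blast
    qed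
    have "u \<in> W"
    proof (rule ccontr)
      assume "u \<notin> W"
      then obtain h where h: "Vector_Spaces.linear const_scale (*) h" "\<forall>x\<in>W. h x = 0" "h u = (1::'k)"
        using separating_form[OF W] by blast
      have QW: "box_ideal N UNIV \<subseteq> W" unfolding W_def by (metis (mono_tags, lifting) add_0 mem_Collect_eq mult_zero_right subsetI)
      then obtain s where s: "\<And>p. h p = lookup (s * p) (corner N)"
        using corner_represents[OF N h(1)] h(2) by blast
      have "lookup (p * (s * D)) (corner N) = 0" for p
      proof -
        have "D * p \<in> W"
          unfolding W_def using ideal.subspace_0[OF is_ideal_box_ideal]
          by (intro CollectI exI[of _ p] exI[of _ 0]) simp
        then show ?thesis using h(2) s[of "D * p"] by (simp add: ac_simps)
      qed
      then have "s \<in> ideal_gen (range f)" unfolding D box_ideal_iff_corner[OF N] by blast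
      then have "g s = 0" using g(2) by blast
      then show False using u[of s] s[of u] h(3) by (simp add: mult.commute)
    qed
    then obtain w q where w: "u = D * w + q" "q \<in> box_ideal N UNIV" by (auto simp: W_def)
    have "g p = \<psi> (w * p)" for p
      using w(2) box_ideal_iff_corner[OF N, of q] unfolding u w(1) \<psi>_def
      by (simp add: distrib_right lookup_add mult.assoc) (metis mult.commute)
    then show ?thesis by blast
  qed
  then have "gorenstein_form (ideal_gen (range f)) \<psi> N"
    by (intro gorenstein_form.intro) (use lin J Q in auto)
  then show ?thesis by blast
qed

section \<open>Numbers of generators of quotient modules\<close>

lemma mem_coset: "x \<in> y +o N \<longleftrightarrow> x - y \<in> (N :: 'b::ab_group_add set)"
  by (auto simp: elt_set_plus_def algebra_simps intro: bexI[of _ "x - y"])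

context module
begin

lemma coset_eq_iff:
  assumes "subspace N" shows "x +o N = y +o N \<longleftrightarrow> x - y \<in> N"
proof
  assume "x +o N = y +o N"
  moreover have "x \<in> x +o N" using subspace_0[OF assms] by (simp add: mem_coset)
  ultimately show "x - y \<in> N" by (simp add: mem_coset)
next
  assume *: "x - y \<in> N"
  have "z - x \<in> N \<longleftrightarrow> z - y \<in> N" for z
    using subspace_add[OF assms _ *, of "z - x"] subspace_diff[OF assms _ *, of "z - y"] by auto
  then show "x +o N = y +o N" by (auto simp: mem_coset)
qed

lemma coset_zero: "0 +o N = (N :: 'b set)" by (auto simp: mem_coset)

lemma coset_add:
  assumes "subspace N" shows "(x +o N) + (y +o N) = (x + y) +o N"
proof (intro set_eqI iffI)
  fix z assume "z \<in> (x +o N) + (y +o N)"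
  then obtain u v where "z = (x + u) + (y + v)" "u \<in> N" "v \<in> N"
    by (auto simp: set_plus_def elt_set_plus_def)
  then show "z \<in> (x + y) +o N"
    using subspace_add[OF assms, of u v] by (simp add: mem_coset algebra_simps)
next
  fix z assume "z \<in> (x + y) +o N"
  then have "z - (x + y) \<in> N" by (simp add: mem_coset)
  then have "z = (x + (z - (x + y))) + (y + 0)" "x + (z - (x + y)) \<in> x +o N" "y + 0 \<in> y +o N"
    using subspace_0[OF assms] by (auto simp: mem_coset diff_diff_eq2 algebra_simps)
  then show "z \<in> (x +o N) + (y +o N)" by (metis set_plus_intro)
qed

lemma coset_scale:
  assumes "subspace N" shows "quot_scale scale N r (x +o N) = (scale r x) +o N"
proof (intro set_eqI iffI)
  fix z assume "z \<in> quot_scale scale N r (x +o N)"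
  then obtain u v where "z = scale r (x + u) + v" "u \<in> N" "v \<in> N"
    by (auto simp: quot_scale_def set_plus_def elt_set_plus_def)
  then show "z \<in> scale r x +o N"
    using subspace_add[OF assms subspace_scale[OF assms, of u r], of v] by (simp add: mem_coset algebra_simps)
next
  fix z assume "z \<in> scale r x +o N"
  then have "z - scale r x \<in> N" by (simp add: mem_coset)
  moreover have "x \<in> x +o N" using subspace_0[OF assms] by (simp add: mem_coset)
  ultimately have "scale r x + (z - scale r x) \<in> quot_scale scale N r (x +o N)"
    unfolding quot_scale_def by (intro set_plus_intro imageI)
  then show "z \<in> quot_scale scale N r (x +o N)" by simp
qed

lemma quot_submodule_quot:
  assumes "subspace N" "subspace M" shows "quot_submodule scale N (quot M N)"
  unfolding quot_submodule_def
proof (intro conjI ballI allI)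
  show "quot M N \<subseteq> quot UNIV N" by (auto simp: quot_def)
  show "N \<in> quot M N"
    unfolding quot_def using subspace_0[OF assms(2)] coset_zero by (auto intro!: image_eqI[of _ _ 0])
qed (auto simp: quot_def coset_add[OF assms(1)] coset_scale[OF assms(1)]
      intro!: imageI intro: subspace_add[OF assms(2)] subspace_scale[OF assms(2)])

lemma quot_submodule_sum:
  assumes N: "subspace N" and P: "quot_submodule scale N P" and "finite A" "\<And>i. i \<in> A \<Longrightarrow> g i +o N \<in> P"
  shows "(\<Sum>i\<in>A. scale (c i) (g i)) +o N \<in> P"
  using assms(3,4)
proof (induction A)
  case empty
  show ?case using P by (simp add: coset_zero quot_submodule_def)
next
  case (insert i A)
  have "quot_scale scale N (c i) (g i +o N) + ((\<Sum>i\<in>A. scale (c i) (g i)) +o N) \<in> P"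
    using P insert unfolding quot_submodule_def by blast
  then show ?case using insert by (simp add: coset_scale[OF N] coset_add[OF N])
qed

end

text \<open>
  A family of length \<open>r\<close> may have repetitions, so this means that at most \<open>r\<close> generators suffice. It
  describes generation of \<open>M / N\<close> by representatives in \<open>M\<close>, which is easier to handle than cosets.
\<close>

definition generated_mod ::
    "('a::comm_ring_1 \<Rightarrow> 'b::ab_group_add \<Rightarrow> 'b) \<Rightarrow> 'b set \<Rightarrow> 'b set \<Rightarrow> nat \<Rightarrow> bool"
  where "generated_mod smul M N r \<longleftrightarrow> (\<exists>g. (\<forall>i<r. g i \<in> M) \<and>
    (\<forall>m\<in>M. \<exists>c. m - (\<Sum>i<r. smul (c i) (g i)) \<in> N))"

lemma (in module) nu_eq_Inf_generated_mod:
  assumes N: "subspace N" and M: "subspace M"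
  shows "nu scale M N = (INF r \<in> {r. generated_mod scale M N r}. enat r)"
proof (rule antisym)
  show "nu scale M N \<le> (INF r \<in> {r. generated_mod scale M N r}. enat r)"
  proof (rule INF_greatest)
    fix r assume "r \<in> {r. generated_mod scale M N r}"
    then obtain g where g: "\<And>i. i < r \<Longrightarrow> g i \<in> M"
      "\<And>m. m \<in> M \<Longrightarrow> \<exists>c. m - (\<Sum>i<r. scale (c i) (g i)) \<in> N"
      unfolding generated_mod_def by auto
    define G where "G = (\<lambda>i. g i +o N) ` {..<r}"
    have sub: "G \<subseteq> quot M N" using g(1) by (auto simp: G_def quot_def)
    have "quot_span scale N G = quot M N"
    proof
      show "quot_span scale N G \<subseteq> quot M N"
        unfolding quot_span_def using quot_submodule_quot[OF N M] sub by blast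
      show "quot M N \<subseteq> quot_span scale N G"
        unfolding quot_span_def
      proof clarify
        fix C P assume C: "C \<in> quot M N" and P: "quot_submodule scale N P" "G \<subseteq> P"
        obtain m where m: "m \<in> M" "C = m +o N" using C by (auto simp: quot_def)
        obtain c where c: "m - (\<Sum>i<r. scale (c i) (g i)) \<in> N" using g(2)[OF m(1)] by blast
        then have "C = (\<Sum>i<r. scale (c i) (g i)) +o N" unfolding m(2) by (simp add: coset_eq_iff[OF N])
        then show "C \<in> P" using quot_submodule_sum[OF N P(1), of "{..<r}" g c] P(2) by (auto simp: G_def)
      qed
    qed
    then have "nu scale M N \<le> enat (card G)"
      unfolding nu_def using sub by (intro INF_lower) (auto simp: G_def)
    also have "card G \<le> r" unfolding G_def using card_image_le[of "{..<r}" "\<lambda>i. g i +o N"] by simp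
    finally show "nu scale M N \<le> enat r" by simp
  qed
  show "(INF r \<in> {r. generated_mod scale M N r}. enat r) \<le> nu scale M N"
    unfolding nu_def
  proof (rule INF_greatest)
    fix G assume G: "G \<in> {G. finite G \<and> G \<subseteq> quot M N \<and> quot_span scale N G = quot M N}"
    then have "finite G" by simp
    then obtain h where h: "bij_betw h {..<card G} G"
      using ex_bij_betw_nat_finite[of G] by (auto simp: atLeast0LessThan)
    have "\<forall>i<card G. \<exists>m. m \<in> M \<and> h i = m +o N"
    proof (intro allI impI)
      fix i assume "i < card G"
      then have "h i \<in> quot M N" using h G by (auto simp: bij_betw_def)
      then show "\<exists>m. m \<in> M \<and> h i = m +o N" by (auto simp: quot_def)
    qed
    then obtain g where g: "\<And>i. i < card G \<Longrightarrow> g i \<in> M" "\<And>i. i < card G \<Longrightarrow> h i = g i +o N" by metis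
    define P where "P = {(\<Sum>i<card G. scale (c i) (g i)) +o N |c. True}"
    have "quot_submodule scale N P"
      unfolding quot_submodule_def
    proof (intro conjI ballI allI)
      show "P \<subseteq> quot UNIV N" by (auto simp: P_def quot_def)
      show "N \<in> P" unfolding P_def by (auto intro!: exI[of _ "\<lambda>_. 0"] simp: coset_zero)
      fix C assume "C \<in> P"
      then obtain c where c: "C = (\<Sum>i<card G. scale (c i) (g i)) +o N" by (auto simp: P_def)
      show "quot_scale scale N s C \<in> P" for s
        unfolding c P_def coset_scale[OF N]
        by (auto intro!: exI[of _ "\<lambda>i. s * c i"] simp: scale_sum_right)
      fix D assume "D \<in> P"
      then obtain d where d: "D = (\<Sum>i<card G. scale (d i) (g i)) +o N" by (auto simp: P_def)
      show "C + D \<in> P"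
        unfolding c d P_def coset_add[OF N]
        by (auto intro!: exI[of _ "\<lambda>i. c i + d i"] simp: scale_left_distrib sum.distrib)
    qed
    moreover have "G \<subseteq> P"
    proof
      fix C assume "C \<in> G"
      then obtain j where j: "j < card G" "C = h j" using h by (auto simp: bij_betw_def)
      have "(\<Sum>i<card G. scale (if i = j then 1 else 0) (g i)) = (\<Sum>i<card G. if i = j then g i else 0)"
        by (rule sum.cong) auto
      then have "C = (\<Sum>i<card G. scale (if i = j then 1 else 0) (g i)) +o N" using j g(2) by simp
      then show "C \<in> P" unfolding P_def by (intro CollectI exI[of _ "\<lambda>i. if i = j then 1 else 0"]) simp
    qed
    ultimately have sub: "quot M N \<subseteq> P" using G unfolding quot_span_def by blast
    have "generated_mod scale M N (card G)"
      unfolding generated_mod_def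
    proof (intro exI[of _ g] conjI allI impI ballI)
      fix m assume "m \<in> M"
      then have "m +o N \<in> P" using sub by (auto simp: quot_def)
      then obtain c where "m +o N = (\<Sum>i<card G. scale (c i) (g i)) +o N" by (auto simp: P_def)
      then show "\<exists>c. m - (\<Sum>i<card G. scale (c i) (g i)) \<in> N" by (auto simp: coset_eq_iff[OF N])
    qed (use g in auto)
    then show "(INF r \<in> {r. generated_mod scale M N r}. enat r) \<le> enat (card G)"
      by (intro INF_lower) auto
  qed
qed

lemma (in module) nu_eqI:
  assumes "subspace N" "subspace M" and "generated_mod scale M N r"
    and "\<And>q. generated_mod scale M N q \<Longrightarrow> r \<le> q"
  shows "nu scale M N = enat r"
  unfolding nu_eq_Inf_generated_mod[OF assms(1,2)]
  by (rule antisym) (auto intro!: INF_lower INF_greatest assms)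

text \<open>
  The hypotheses say that \<open>f\<close> induces an isomorphism from \<open>M1 / N1\<close> to \<open>M2 / N2\<close>; \<open>f\<close> need not map onto
  \<open>M2\<close> itself.
\<close>

lemma generated_mod_iso:
  assumes f: "module_hom s1 s2 f"
    and M: "module.subspace s1 M1" "module.subspace s2 N2"
    and into: "\<And>x. x \<in> M1 \<Longrightarrow> f x \<in> M2" and onto: "\<And>y. y \<in> M2 \<Longrightarrow> \<exists>x\<in>M1. y - f x \<in> N2"
    and ker: "\<And>x. x \<in> M1 \<Longrightarrow> f x \<in> N2 \<longleftrightarrow> x \<in> N1"
  shows "generated_mod s1 M1 N1 r \<longleftrightarrow> generated_mod s2 M2 N2 r"
proof -
  interpret f: module_hom s1 s2 f by (rule f)
  have hom: "f (m - (\<Sum>i<r. s1 (c i) (g i))) = f m - (\<Sum>i<r. s2 (c i) (f (g i)))" for m c g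
    by (simp add: f.diff f.sum f.scale)
  show ?thesis
  proof
    assume "generated_mod s1 M1 N1 r"
    then obtain g where g: "\<And>i. i < r \<Longrightarrow> g i \<in> M1"
      "\<And>m. m \<in> M1 \<Longrightarrow> \<exists>c. m - (\<Sum>i<r. s1 (c i) (g i)) \<in> N1"
      unfolding generated_mod_def by auto
    have "\<exists>c. y - (\<Sum>i<r. s2 (c i) (f (g i))) \<in> N2" if "y \<in> M2" for y
    proof -
      obtain x where x: "x \<in> M1" "y - f x \<in> N2" using onto[OF \<open>y \<in> M2\<close>] by blast
      obtain c where c: "x - (\<Sum>i<r. s1 (c i) (g i)) \<in> N1" using g(2)[OF x(1)] by blast
      have "x - (\<Sum>i<r. s1 (c i) (g i)) \<in> M1"
        by (intro f.m1.subspace_diff[OF M(1)] f.m1.subspace_sum[OF M(1)] f.m1.subspace_scale[OF M(1)] x) (use g in auto)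
      then have "f x - (\<Sum>i<r. s2 (c i) (f (g i))) \<in> N2" using ker c hom by metis
      then have "(y - f x) + (f x - (\<Sum>i<r. s2 (c i) (f (g i)))) \<in> N2"
        using x(2) by (intro f.m2.subspace_add[OF M(2)])
      then show ?thesis by auto
    qed
    then show "generated_mod s2 M2 N2 r"
      unfolding generated_mod_def using g(1) into by (intro exI[of _ "\<lambda>i. f (g i)"]) auto
  next
    assume "generated_mod s2 M2 N2 r"
    then obtain h where h: "\<And>i. i < r \<Longrightarrow> h i \<in> M2"
      "\<And>m. m \<in> M2 \<Longrightarrow> \<exists>c. m - (\<Sum>i<r. s2 (c i) (h i)) \<in> N2"
      unfolding generated_mod_def by auto
    have "\<forall>i<r. \<exists>x. x \<in> M1 \<and> h i - f x \<in> N2" using h(1) onto by blast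
    then obtain g where g: "\<And>i. i < r \<Longrightarrow> g i \<in> M1" "\<And>i. i < r \<Longrightarrow> h i - f (g i) \<in> N2" by metis
    have "\<exists>c. x - (\<Sum>i<r. s1 (c i) (g i)) \<in> N1" if x: "x \<in> M1" for x
    proof -
      obtain c where c: "f x - (\<Sum>i<r. s2 (c i) (h i)) \<in> N2" using h(2)[OF into[OF x]] by blast
      have "(\<Sum>i<r. s2 (c i) (h i - f (g i))) \<in> N2"
        by (intro f.m2.subspace_sum[OF M(2)] f.m2.subspace_scale[OF M(2)]) (use g in auto)
      from f.m2.subspace_add[OF M(2) c this]
      have "f (x - (\<Sum>i<r. s1 (c i) (g i))) \<in> N2"
        unfolding hom by (simp add: f.m2.scale_right_diff_distrib sum_subtractf)
      moreover have "x - (\<Sum>i<r. s1 (c i) (g i)) \<in> M1"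
        by (intro f.m1.subspace_diff[OF M(1)] f.m1.subspace_sum[OF M(1)] f.m1.subspace_scale[OF M(1)] x) (use g in auto)
      ultimately show ?thesis using ker by blast
    qed
    then show "generated_mod s1 M1 N1 r"
      unfolding generated_mod_def using g(1) by blast
  qed
qed

lemma nu_iso:
  assumes f: "module_hom s1 s2 f"
    and sub: "module.subspace s1 M1" "module.subspace s1 N1" "module.subspace s2 M2" "module.subspace s2 N2"
    and "\<And>x. x \<in> M1 \<Longrightarrow> f x \<in> M2" "\<And>y. y \<in> M2 \<Longrightarrow> \<exists>x\<in>M1. y - f x \<in> N2"
    and "\<And>x. x \<in> M1 \<Longrightarrow> f x \<in> N2 \<longleftrightarrow> x \<in> N1"
  shows "nu s1 M1 N1 = nu s2 M2 N2"
proof -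
  have m: "module s1" "module s2" using f by (auto simp: module_hom_def)
  have "generated_mod s1 M1 N1 = generated_mod s2 M2 N2"
    by (rule ext) (rule generated_mod_iso[OF f sub(1,4) assms(6-8)])
  then show ?thesis
    unfolding module.nu_eq_Inf_generated_mod[OF m(1) sub(2,1)] module.nu_eq_Inf_generated_mod[OF m(2) sub(4,3)]
    by simp
qed

section \<open>Linear algebra modulo a subspace\<close>

interpretation coeff_endo: vector_space_pair
  "const_scale :: 'k::field \<Rightarrow> ('v, 'k) mpoly \<Rightarrow> ('v, 'k) mpoly"
  "const_scale :: 'k \<Rightarrow> ('v, 'k) mpoly \<Rightarrow> ('v, 'k) mpoly"
  by (intro vector_space_pair.intro vector_space_const_scale)

text \<open>
  Projection along \<open>U\<close> onto a complement; it replaces the quotient space by \<open>U\<close>.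
\<close>

lemma linear_map_with_kernel:
  fixes U :: "('v, 'k::field) mpoly set"
  assumes U: "coeff.subspace U"
  shows "\<exists>g. Vector_Spaces.linear const_scale const_scale g \<and> (\<forall>x. g x = (0 :: ('v, 'k) mpoly) \<longleftrightarrow> x \<in> U)"
proof -
  obtain B where B: "B \<subseteq> U" "coeff.independent B" "U \<subseteq> coeff.span B"
    by (rule coeff.maximal_independent_subset)
  have BU: "coeff.span B = U" using B U coeff.span_minimal by blast
  define C where "C = coeff.extend_basis B"
  have C: "B \<subseteq> C" "coeff.independent C" "coeff.span C = UNIV"
    unfolding C_def using coeff.extend_basis_superset coeff.independent_extend_basis coeff.span_extend_basis B(2) by auto
  obtain g where g: "Vector_Spaces.linear const_scale const_scale g"
    "\<forall>x\<in>C. g x = (if x \<in> B then 0 else (x :: ('v, 'k) mpoly))"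
    using coeff_endo.linear_independent_extend[OF C(2), of "\<lambda>x. if x \<in> B then 0 else x"] by blast
  have "g x = 0" if "x \<in> B" for x using g(2) C(1) that by auto
  then have zero: "g x = 0" if "x \<in> coeff.span B" for x
    using coeff_endo.linear_eq_0_on_span[OF g(1) _ that] by blast
  have fix_id: "g x = x" if "x \<in> coeff.span (C - B)" for x
  proof -
    have "Vector_Spaces.linear const_scale const_scale (\<lambda>x :: ('v, 'k) mpoly. x)"
      unfolding module_hom_iff_linear[symmetric] by (intro module_hom.intro module_const_scale module_hom_axioms.intro) simp_all
    from coeff_endo.linear_eq_on[OF g(1) this that] show ?thesis using g(2) by auto
  qed
  have "x \<in> U" if "g x = 0" for x
  proof -
    have "x \<in> coeff.span (B \<union> (C - B))" using C(1,3) by (simp add: Un_absorb1)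
    then obtain b c where bc: "x = b + c" "b \<in> coeff.span B" "c \<in> coeff.span (C - B)"
      unfolding coeff.span_Un by blast
    then have "g x = c" using zero fix_id by (simp add: coeff_endo.linear_add[OF g(1)])
    then show ?thesis using bc that BU by simp
  qed
  then show ?thesis using g(1) zero BU by blast
qed

definition independent_mod :: "('v, 'k::field) mpoly set \<Rightarrow> nat \<Rightarrow> (nat \<Rightarrow> ('v, 'k) mpoly) \<Rightarrow> bool"
  where "independent_mod U r v \<longleftrightarrow>
    (\<forall>c. (\<Sum>i<r. const_scale (c i) (v i)) \<in> U \<longrightarrow> (\<forall>i<r. c i = 0))"

lemma independent_mod_le_spanning:
  fixes U :: "('v, 'k::field) mpoly set"
  assumes U: "coeff.subspace U" and v: "independent_mod U r v"
    and span: "\<And>i. i < r \<Longrightarrow> \<exists>c. v i - (\<Sum>l<q. const_scale (c l) (w l)) \<in> U"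
  shows "r \<le> q"
proof -
  obtain g where g: "Vector_Spaces.linear const_scale const_scale g" "\<And>x. g x = (0 :: ('v, 'k) mpoly) \<longleftrightarrow> x \<in> U"
    using linear_map_with_kernel[OF U] by blast
  note lin = coeff_endo.linear_sum[OF g(1)] coeff_endo.linear_scale[OF g(1)] coeff_endo.linear_diff[OF g(1)]
  have ind: "c i = 0" if "(\<Sum>i<r. const_scale (c i) (g (v i))) = 0" "i < r" for c i
    using that v g(2)[of "\<Sum>i<r. const_scale (c i) (v i)"] unfolding independent_mod_def by (simp add: lin)
  have inj: "inj_on (\<lambda>i. g (v i)) {..<r}"
  proof (rule inj_onI, rule ccontr)
    fix i j assume ij: "i \<in> {..<r}" "j \<in> {..<r}" "g (v i) = g (v j)" "i \<noteq> j"
    have "(\<Sum>l<r. const_scale (if l = i then 1 else if l = j then -1 else 0) (g (v l)))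
      = (\<Sum>l<r. (if l = i then g (v i) else 0) - (if l = j then g (v j) else 0))"
      by (rule sum.cong) (use ij in auto)
    also have "\<dots> = 0" using ij by (simp add: sum_subtractf)
    finally show False using ind[of "\<lambda>l. if l = i then 1 else if l = j then -1 else 0" i] ij by auto
  qed
  have "coeff.independent ((\<lambda>i. g (v i)) ` {..<r})"
  proof (rule coeff.independent_if_scalars_zero)
    fix c x assume s: "(\<Sum>x\<in>(\<lambda>i. g (v i)) ` {..<r}. const_scale (c x) x) = 0" and x: "x \<in> (\<lambda>i. g (v i)) ` {..<r}"
    have "(\<Sum>i<r. const_scale (c (g (v i))) (g (v i))) = 0"
      using s by (simp add: sum.reindex[OF inj])
    then show "c x = 0" using ind[of "\<lambda>i. c (g (v i))"] x by auto
  qed simp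
  moreover have "(\<lambda>i. g (v i)) ` {..<r} \<subseteq> coeff.span ((\<lambda>l. g (w l)) ` {..<q})"
  proof clarify
    fix i assume "i < r"
    then obtain c where "v i - (\<Sum>l<q. const_scale (c l) (w l)) \<in> U" using span by blast
    then have "g (v i) = (\<Sum>l<q. const_scale (c l) (g (w l)))"
      unfolding g(2)[symmetric] by (simp add: lin)
    then show "g (v i) \<in> coeff.span ((\<lambda>l. g (w l)) ` {..<q})"
      by (auto intro!: coeff.span_sum coeff.span_scale intro: coeff.span_base)
  qed
  ultimately have "card ((\<lambda>i. g (v i)) ` {..<r}) \<le> card ((\<lambda>l. g (w l)) ` {..<q})"
    using coeff.independent_span_bound by blast
  also have "\<dots> \<le> q" using card_image_le[of "{..<q}"] by simp
  finally show ?thesis by (simp add: card_image[OF inj])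
qed

text \<open>
  \<open>V / U\<close> is finite-dimensional because the monomials with all exponents below \<open>N\<close> span the ring modulo
  the box ideal, hence modulo \<open>U\<close>.
\<close>

lemma basis_mod_exists:
  fixes U V :: "('v::finite, 'k::field) mpoly set"
  assumes U: "coeff.subspace U" and V: "coeff.subspace V" and box: "box_ideal N UNIV \<subseteq> U"
  shows "\<exists>r v. (\<forall>i<r. v i \<in> V) \<and> independent_mod U r v \<and>
    (\<forall>x\<in>V. \<exists>c. x - (\<Sum>i<r. const_scale (c i) (v i)) \<in> U)"
proof -
  obtain g where g: "Vector_Spaces.linear const_scale const_scale g" "\<And>x. g x = (0 :: ('v, 'k) mpoly) \<longleftrightarrow> x \<in> U"
    using linear_map_with_kernel[OF U] by blast
  note lin = coeff_endo.linear_sum[OF g(1)] coeff_endo.linear_scale[OF g(1)] coeff_endo.linear_diff[OF g(1)]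
  obtain B where B: "B \<subseteq> g ` V" "coeff.independent B" "g ` V \<subseteq> coeff.span B"
    by (rule coeff.maximal_independent_subset)
  define E where "E = {m :: 'v \<Rightarrow>\<^sub>0 nat. \<forall>i. lookup m i < N}"
  have finE: "finite E" unfolding E_def by (rule finite_box)
  have "g x \<in> coeff.span ((\<lambda>m. g (single m 1)) ` E)" for x
  proof -
    have "g (single m c) \<in> coeff.span ((\<lambda>m. g (single m 1)) ` E)" for m c
    proof (cases "m \<in> E")
      case True
      have "single m c = const_scale c (single m 1)"
        by (simp add: const_scale_def mult_single)
      then show ?thesis using True by (auto simp: lin intro!: coeff.span_scale intro: coeff.span_base)
    next
      case False
      then have "single m c \<in> box_ideal N UNIV"
        by (auto simp: E_def box_ideal_def not_less)
      then have "g (single m c) = 0" using box g(2) by blast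
      then show ?thesis by (simp add: coeff.span_zero)
    qed
    then show ?thesis
      by (subst mpoly_sum_monomials) (auto simp: lin intro!: coeff.span_sum)
  qed
  then have finB: "finite B"
    using coeff.independent_span_bound[OF finite_imageI[OF finE] B(2)] B(1) by blast
  then obtain h where h: "bij_betw h {..<card B} B"
    using ex_bij_betw_nat_finite[of B] by (auto simp: atLeast0LessThan)
  have "\<forall>i<card B. \<exists>y. y \<in> V \<and> g y = h i"
  proof (intro allI impI)
    fix i assume "i < card B"
    then have "h i \<in> g ` V" using h B(1) by (auto simp: bij_betw_def)
    then show "\<exists>y. y \<in> V \<and> g y = h i" by auto
  qed
  then obtain v where v: "\<And>i. i < card B \<Longrightarrow> v i \<in> V" "\<And>i. i < card B \<Longrightarrow> g (v i) = h i" by metis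
  have gs: "g (\<Sum>i<card B. const_scale (c i) (v i)) = (\<Sum>i<card B. const_scale (c i) (h i))" for c
    by (simp add: lin v)
  have "independent_mod U (card B) v"
    unfolding independent_mod_def g(2)[symmetric] gs
  proof (intro allI impI)
    fix c i assume c: "(\<Sum>i<card B. const_scale (c i) (h i)) = 0" and i: "i < card B"
    define d where "d b = c (the_inv_into {..<card B} h b)" for b
    have inv: "d (h l) = c l" if "l < card B" for l
      using that h the_inv_into_f_f[of h "{..<card B}" l] by (simp add: d_def bij_betw_def)
    have "(\<Sum>b\<in>B. const_scale (d b) b) = (\<Sum>l<card B. const_scale (d (h l)) (h l))"
      by (rule sum.reindex_bij_betw[OF h, symmetric])
    also have "\<dots> = 0" using c by (simp add: inv)
    finally have "d (h i) = 0"
      using coeff.independentD[OF B(2) finB subset_refl] h i by (auto simp: bij_betw_def)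
    then show "c i = 0" using inv i by simp
  qed
  moreover have "\<exists>c. x - (\<Sum>i<card B. const_scale (c i) (v i)) \<in> U" if "x \<in> V" for x
  proof -
    have "g x \<in> coeff.span B" using B(3) that by (meson image_eqI subsetD)
    then obtain u where u: "g x = (\<Sum>b\<in>B. const_scale (u b) b)"
      unfolding coeff.span_finite[OF finB] by (elim rangeE)
    have "(\<Sum>b\<in>B. const_scale (u b) b) = (\<Sum>l<card B. const_scale (u (h l)) (h l))"
      by (rule sum.reindex_bij_betw[OF h, symmetric])
    then have "g (x - (\<Sum>i<card B. const_scale (u (h i)) (v i))) = 0"
      using u gs[of "\<lambda>i. u (h i)"] coeff_endo.linear_diff[OF g(1)] by simp
    then show ?thesis unfolding g(2) by (intro exI[of _ "\<lambda>i. u (h i)"])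
  qed
  ultimately show ?thesis using v(1) by blast
qed

definition exponent_degree :: "('v::finite \<Rightarrow>\<^sub>0 nat) \<Rightarrow> nat"
  where "exponent_degree m = (\<Sum>i\<in>UNIV. lookup m i)"

lemma exponent_degree_add: "exponent_degree (m + l) = exponent_degree m + exponent_degree l"
  by (simp add: exponent_degree_def lookup_add sum.distrib)

lemma exponent_degree_zero [simp]: "exponent_degree 0 = 0"
  by (simp add: exponent_degree_def)

lemma exponent_degree_single [simp]: "exponent_degree (single i e) = e"
  by (simp add: exponent_degree_def lookup_single when_def)

lemma exponent_degree_eq_0_iff [simp]: "exponent_degree m = 0 \<longleftrightarrow> m = 0"
  by (auto simp: exponent_degree_def poly_mapping_eq_iff fun_eq_iff)

lemma exponent_nonzero_split:
  fixes m :: "'v \<Rightarrow>\<^sub>0 nat"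
  assumes "m \<noteq> 0" obtains i l where "m = single i 1 + l"
proof -
  obtain i where "lookup m i \<noteq> 0"
    using assms poly_mapping_eqI[of m 0] by (auto simp del: lookup_not_eq_zero_eq_in_keys)
  then have "single i 1 + (m - single i 1) = m"
    by (intro exponent_cancel) (auto simp: lookup_single when_def)
  from this[symmetric] show ?thesis by (rule that)
qed

text \<open>
  By the pigeonhole principle, a monomial of degree at least \<open>d N\<close> has an exponent that is at least \<open>N\<close>.
\<close>

lemma high_degree_in_box:
  assumes "card (UNIV :: 'v set) * N \<le> exponent_degree (m :: 'v::finite \<Rightarrow>\<^sub>0 nat)"
  shows "single m c \<in> box_ideal N UNIV"
proof -
  have "\<exists>i. N \<le> lookup m i"
  proof (rule ccontr)
    assume "\<not> ?thesis"
    then have "exponent_degree m < (\<Sum>i\<in>(UNIV :: 'v set). N)"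
      unfolding exponent_degree_def by (intro sum_strict_mono) (auto simp: not_le)
    then show False using assms by simp
  qed
  then show ?thesis by (simp add: box_ideal_def)
qed

text \<open>
  If the variables map \<open>M\<close> into \<open>U\<close>, then modulo \<open>U\<close> a polynomial acts on \<open>M\<close> through its constant
  term, because all its other monomials contain a variable.
\<close>

lemma mult_minus_constant_term:
  fixes M U :: "('v::finite, 'k::field) mpoly set"
  assumes M: "is_ideal M" and U: "coeff.subspace U" and mM: "\<And>i x. x \<in> M \<Longrightarrow> var i * x \<in> U" and x: "x \<in> M"
  shows "p * x - const_scale (lookup p 0) x \<in> U"
proof -
  have "p * x - const_scale (lookup p 0) x =
     (\<Sum>m\<in>keys p - {0}. single m (lookup p m)) * x"
  proof (cases "0 \<in> keys p")
    case True
    then have "p = single 0 (lookup p 0) + (\<Sum>m\<in>keys p - {0}. single m (lookup p m))"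
      by (subst mpoly_sum_monomials) (simp add: sum.remove)
    from arg_cong[OF this, of "\<lambda>t. t * x"] show ?thesis
      by (simp add: const_scale_def distrib_right)
  next
    case False
    then show ?thesis
      by (subst (1) mpoly_sum_monomials) (simp add: const_scale_def not_in_keys_iff_lookup_eq_zero)
  qed
  also have "\<dots> \<in> U"
    unfolding sum_distrib_right
  proof (rule coeff.subspace_sum[OF U])
    fix m assume "m \<in> keys p - {0}"
    then obtain i l where "m = single i 1 + l" using exponent_nonzero_split[of m] by auto
    then have "single m (lookup p m) * x = var i * (single l (lookup p m) * x)"
      by (simp add: var_def mult_single flip: mult.assoc)
    then show "single m (lookup p m) * x \<in> U"
      using mM ideal.subspace_scale[OF M x] by metis
  qed
  finally show ?thesis .
qed

text \<open>
  Ring generators of \<open>M / N\<close> span \<open>M / U\<close> over the field, as coefficients act through their constant terms.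
  This gives the lower bounds for numbers of generators.
\<close>

lemma independent_mod_le_generated_mod:
  fixes M N U :: "('v::finite, 'k::field) mpoly set"
  assumes M: "is_ideal M" and U: "coeff.subspace U" "N \<subseteq> U" and mM: "\<And>i x. x \<in> M \<Longrightarrow> var i * x \<in> U"
    and v: "independent_mod U r v" "\<And>i. i < r \<Longrightarrow> v i \<in> M" and gen: "generated_mod (*) M N q"
  shows "r \<le> q"
proof -
  obtain g where g: "\<And>i. i < q \<Longrightarrow> g i \<in> M" "\<And>m. m \<in> M \<Longrightarrow> \<exists>c. m - (\<Sum>i<q. c i * g i) \<in> N"
    using gen unfolding generated_mod_def by auto
  show ?thesis
  proof (rule independent_mod_le_spanning[OF U(1) v(1)])
    fix i assume "i < r"
    then obtain c where c: "v i - (\<Sum>l<q. c l * g l) \<in> N" using g(2) v(2) by blast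
    have "(\<Sum>l<q. c l * g l - const_scale (lookup (c l) 0) (g l)) \<in> U"
      by (rule coeff.subspace_sum[OF U(1)]) (use g(1) in \<open>auto intro: mult_minus_constant_term[OF M U(1) mM]\<close>)
    then have "(v i - (\<Sum>l<q. c l * g l)) + (\<Sum>l<q. c l * g l - const_scale (lookup (c l) 0) (g l)) \<in> U"
      using c U by (intro coeff.subspace_add[OF U(1)]) auto
    then show "\<exists>c. v i - (\<Sum>l<q. const_scale (c l) (g l)) \<in> U"
      by (intro exI[of _ "\<lambda>l. lookup (c l) 0"]) (simp add: sum_subtractf)
  qed
qed

text \<open>
  Nakayama's lemma for a module on which some power of the maximal ideal acts as zero: vectors that span
  \<open>M\<close> modulo \<open>N + \<mm> M\<close> over the field generate \<open>M\<close> modulo \<open>N\<close>.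
\<close>

lemma nilpotent_nakayama:
  fixes M N :: "('v::finite, 'k::field) mpoly set"
  assumes M: "is_ideal M" and N: "is_ideal N" and box: "box_ideal e UNIV \<subseteq> N"
    and v: "\<And>i. i < r \<Longrightarrow> v i \<in> M"
    and span: "\<And>x. x \<in> M \<Longrightarrow> \<exists>c n y. n \<in> N \<and> (\<forall>j. y j \<in> M) \<and>
      x = (\<Sum>i<r. const_scale (c i) (v i)) + n + (\<Sum>j\<in>UNIV. var j * y j)"
  shows "generated_mod (*) M N r"
proof -
  define M' where "M' = {x. \<exists>c. x - (\<Sum>i<r. c i * v i) \<in> N}"
  have M': "is_ideal M'"
  proof (rule ideal.subspaceI)
    show "0 \<in> M'" unfolding M'_def using ideal.subspace_0[OF N] by (auto intro!: exI[of _ "\<lambda>_. 0"])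
  next
    fix x y assume "x \<in> M'" "y \<in> M'"
    then obtain c d where "x - (\<Sum>i<r. c i * v i) \<in> N" "y - (\<Sum>i<r. d i * v i) \<in> N"
      by (auto simp: M'_def)
    from ideal.subspace_add[OF N this] show "x + y \<in> M'"
      unfolding M'_def by (intro CollectI exI[of _ "\<lambda>i. c i + d i"]) (simp add: algebra_simps sum.distrib)
  next
    fix p x assume "x \<in> M'"
    then obtain c where "x - (\<Sum>i<r. c i * v i) \<in> N" by (auto simp: M'_def)
    from ideal.subspace_scale[OF N this, of p] show "p * x \<in> M'"
      unfolding M'_def by (intro CollectI exI[of _ "\<lambda>i. p * c i"]) (simp add: algebra_simps sum_distrib_left)
  qed
  have NM': "N \<subseteq> M'" unfolding M'_def by (auto intro!: exI[of _ "\<lambda>_. 0"])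
  have vM': "(\<Sum>i<r. const_scale (c i) (v i)) \<in> M'" for c
    unfolding M'_def const_scale_def using ideal.subspace_0[OF N]
    by (intro CollectI exI[of _ "\<lambda>i. single 0 (c i)"]) simp
  \<comment> \<open>Monomials of large degree multiply everything into \<open>N\<close>; each use of the spanning hypothesis
      lowers the degree needed by one.\<close>
  have "single m 1 * x \<in> M'" if "card (UNIV :: 'v set) * e \<le> exponent_degree m + t" "x \<in> M" for m t x
    using that
  proof (induction t arbitrary: m x)
    case 0
    then have "single m 1 \<in> N" using high_degree_in_box box by fastforce
    then show ?case using ideal.subspace_scale[OF N, of _ x] NM' by (metis mult.commute subsetD)
  next
    case (Suc t)
    obtain c n y where *: "n \<in> N" "\<forall>j. y j \<in> M" "x = (\<Sum>i<r. const_scale (c i) (v i)) + n + (\<Sum>j\<in>UNIV. var j * y j)"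
      using span[OF Suc.prems(2)] by blast
    have "single m 1 * x = single m 1 * ((\<Sum>i<r. const_scale (c i) (v i)) + n)
      + (\<Sum>j\<in>UNIV. single (m + single j 1) 1 * y j)"
      unfolding *(3) by (simp add: distrib_left sum_distrib_left var_def mult_single flip: mult.assoc)
    moreover have "single (m + single j 1) 1 * y j \<in> M'" for j
      using Suc.prems(1) *(2) by (intro Suc.IH) (auto simp: exponent_degree_add)
    moreover have "single m 1 * ((\<Sum>i<r. const_scale (c i) (v i)) + n) \<in> M'"
      using vM' *(1) NM' by (intro ideal.subspace_scale[OF M'] ideal.subspace_add[OF M']) auto
    ultimately show ?case
      by (simp add: ideal.subspace_add[OF M'] ideal.subspace_sum[OF M'])
  qed
  from this[of 0 "card (UNIV :: 'v set) * e"] have "x \<in> M'" if "x \<in> M" for x using that by simp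
  then show ?thesis unfolding generated_mod_def M'_def using v by blast
qed

section \<open>Duality\<close>

lemma is_ideal_colon:
  assumes "is_ideal A" shows "is_ideal (colon A B)"
  unfolding colon_def
  by (rule ideal.subspaceI)
     (auto simp: ideal.subspace_0[OF assms] distrib_right mult.assoc
       intro: ideal.subspace_add[OF assms] ideal.subspace_scale[OF assms])

lemma colon_span:
  assumes "is_ideal A" shows "colon A (ideal_gen X) = {r. \<forall>b\<in>X. r * b \<in> A}"
proof
  show "colon A (ideal_gen X) \<subseteq> {r. \<forall>b\<in>X. r * b \<in> A}"
    unfolding colon_def using ideal.span_base by blast
  show "{r. \<forall>b\<in>X. r * b \<in> A} \<subseteq> colon A (ideal_gen X)"
    unfolding colon_def
  proof clarify
    fix r b assume r: "\<forall>b\<in>X. r * b \<in> A" and b: "b \<in> ideal_gen X"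
    from b show "r * b \<in> A"
    proof (induction rule: ideal.span_induct_alt)
      case base show ?case using ideal.subspace_0[OF assms] by simp
    next
      case (step c x y)
      have "r * (c * x + y) = c * (r * x) + r * y" by (simp add: algebra_simps)
      then show ?case
        using ideal.subspace_add[OF assms ideal.subspace_scale[OF assms]] step r by metis
    qed
  qed
qed

lemma subset_colon:
  assumes "is_ideal A" shows "A \<subseteq> colon A B"
  unfolding colon_def using ideal.subspace_scale[OF assms] by (auto simp: mult.commute)

context gorenstein_form
begin

lemmas psi_linear = coeff_form.linear_add[OF linear_\<psi>] coeff_form.linear_diff[OF linear_\<psi>]
  coeff_form.linear_scale[OF linear_\<psi>] coeff_form.linear_sum[OF linear_\<psi>] coeff_form.linear_0[OF linear_\<psi>]

lemma psi_J: "r \<in> J \<Longrightarrow> \<psi> r = 0"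
  using mem_J_iff[of r] by (metis mult_1)

text \<open>
  In other words, a subspace containing \<open>J\<close> equals its double orthogonal complement for the pairing
  \<open>\<psi> (w * x)\<close>.
\<close>

lemma separating_multiplier:
  assumes W: "coeff.subspace W" "J \<subseteq> W" and "v \<notin> W"
  shows "\<exists>w. (\<forall>x\<in>W. \<psi> (w * x) = 0) \<and> \<psi> (w * v) = 1"
proof -
  obtain g where g: "Vector_Spaces.linear const_scale (*) g" "\<forall>x\<in>W. g x = 0" "g v = (1::'k)"
    using separating_form[OF W(1) assms(3)] by blast
  then obtain w where "\<And>p. g p = \<psi> (w * p)" using represents[OF g(1)] W(2) by blast
  then show ?thesis using g by (intro exI[of _ w]) simp
qed

text \<open>
  The colon ideal \<open>J : K\<close> is the orthogonal complement of \<open>K\<close> because \<open>K\<close> is closed under multiplication.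
\<close>

lemma colon_colon:
  assumes K: "is_ideal K" "J \<subseteq> K"
  shows "colon J (colon J K) = K"
proof
  show "K \<subseteq> colon J (colon J K)" by (auto simp: colon_def mult.commute)
  show "colon J (colon J K) \<subseteq> K"
  proof (rule subsetI, rule ccontr)
    fix v assume v: "v \<in> colon J (colon J K)" "v \<notin> K"
    obtain w where w: "\<forall>x\<in>K. \<psi> (w * x) = 0" "\<psi> (w * v) = 1"
      using separating_multiplier[OF is_ideal_imp_coeff_subspace[OF K(1)] K(2) v(2)] by blast
    have "w * x \<in> J" if "x \<in> K" for x
      unfolding mem_J_iff
    proof
      fix p
      have "\<psi> (w * (p * x)) = 0" using w(1) ideal.subspace_scale[OF K(1) that] by blast
      then show "\<psi> (p * (w * x)) = 0" by (simp add: mult.left_commute)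
    qed
    then have "v * w \<in> J" using v(1) by (simp add: colon_def)
    then show False using psi_J[of "v * w"] w(2) by (simp add: mult.commute)
  qed
qed

text \<open>
  Let \<open>M = J : K\<close> and \<open>U = J + \<mm> M\<close>. By Nakayama's lemma the number of generators of \<open>M / J\<close> is the
  dimension \<open>r\<close> of \<open>M / U\<close>. The orthogonal complements of \<open>M\<close> and \<open>U\<close> are \<open>K\<close> and \<open>K : \<mm>\<close>, so a
  family dual to a basis \<open>v\<close> of \<open>M / U\<close> is a basis of \<open>(K : \<mm>) / K\<close>, on which the maximal ideal acts as
  zero.
\<close>

theorem nu_colon_dual:
  assumes K: "is_ideal K" "J \<subseteq> K"
  shows "nu (*) (colon J K) J = nu (*) (colon K max_ideal) K"
proof -
  define M where "M = colon J K"
  have M: "is_ideal M" unfolding M_def by (rule is_ideal_colon[OF ideal_J])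
  have JM: "J \<subseteq> M" unfolding M_def by (rule subset_colon[OF ideal_J])
  have KM: "x \<in> K \<longleftrightarrow> (\<forall>y\<in>M. x * y \<in> J)" for x
    using colon_colon[OF K] by (auto simp: colon_def M_def)
  have Km: "x \<in> colon K max_ideal \<longleftrightarrow> (\<forall>i. x * var i \<in> K)" for x
    unfolding max_ideal_def colon_span[OF K(1)] by auto
  define U where "U = {n + (\<Sum>j\<in>UNIV. var j * y j) |n y. n \<in> J \<and> (\<forall>j. y j \<in> M)}"
  have U: "is_ideal U"
  proof (rule ideal.subspaceI)
    show "0 \<in> U"
      unfolding U_def using ideal.subspace_0[OF ideal_J] ideal.subspace_0[OF M]
      by (intro CollectI exI[of _ 0] exI[of _ "\<lambda>_. 0"]) simp
  next
    fix x x' assume "x \<in> U" "x' \<in> U"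
    then obtain n y n' y' where "x = n + (\<Sum>j\<in>UNIV. var j * y j)" "x' = n' + (\<Sum>j\<in>UNIV. var j * y' j)"
      "n \<in> J" "n' \<in> J" "\<forall>j. y j \<in> M" "\<forall>j. y' j \<in> M"
      by (auto simp: U_def)
    then show "x + x' \<in> U"
      unfolding U_def using ideal.subspace_add[OF ideal_J] ideal.subspace_add[OF M]
      by (intro CollectI exI[of _ "n + n'"] exI[of _ "\<lambda>j. y j + y' j"]) (simp add: sum.distrib algebra_simps)
  next
    fix c x assume "x \<in> U"
    then obtain n y where "x = n + (\<Sum>j\<in>UNIV. var j * y j)" "n \<in> J" "\<forall>j. y j \<in> M"
      by (auto simp: U_def)
    then show "c * x \<in> U"
      unfolding U_def using ideal.subspace_scale[OF ideal_J] ideal.subspace_scale[OF M]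
      by (intro CollectI exI[of _ "c * n"] exI[of _ "\<lambda>j. c * y j"])
         (simp add: sum_distrib_left distrib_left mult.left_commute)
  qed
  note U' = is_ideal_imp_coeff_subspace[OF U]
  have JU: "J \<subseteq> U"
    unfolding U_def using ideal.subspace_0[OF M] by (auto intro!: exI[of _ "\<lambda>_. 0"])
  have mMU: "var i * x \<in> U" if "x \<in> M" for i x
  proof -
    have "(\<Sum>j\<in>UNIV. var j * (if j = i then x else 0)) = var i * x"
      by (subst if_distrib) (simp cong: if_cong)
    then show ?thesis
      unfolding U_def using that ideal.subspace_0[OF M] ideal.subspace_0[OF ideal_J]
      by (intro CollectI exI[of _ 0] exI[of _ "\<lambda>j. if j = i then x else 0"]) simp
  qed
  obtain r v where v: "\<And>i. i < r \<Longrightarrow> v i \<in> M" "independent_mod U r v"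
    "\<And>x. x \<in> M \<Longrightarrow> \<exists>c. x - (\<Sum>i<r. const_scale (c i) (v i)) \<in> U"
    using basis_mod_exists[OF U' is_ideal_imp_coeff_subspace[OF M], of N] box JU by blast

  have nu1: "nu (*) M J = enat r"
  proof (rule ideal.nu_eqI[OF ideal_J M])
    show "generated_mod (*) M J r"
    proof (rule nilpotent_nakayama[OF M ideal_J box v(1)])
      fix x assume "x \<in> M"
      then obtain c where "x - (\<Sum>i<r. const_scale (c i) (v i)) \<in> U" using v(3) by blast
      then obtain n y where "x - (\<Sum>i<r. const_scale (c i) (v i)) = n + (\<Sum>j\<in>UNIV. var j * y j)" "n \<in> J" "\<forall>j. y j \<in> M"
        unfolding U_def by blast
      then show "\<exists>c n y. n \<in> J \<and> (\<forall>j. y j \<in> M) \<and>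
          x = (\<Sum>i<r. const_scale (c i) (v i)) + n + (\<Sum>j\<in>UNIV. var j * y j)"
        by (intro exI[of _ c] exI[of _ n] exI[of _ y]) (simp add: algebra_simps)
    qed
    show "r \<le> q" if "generated_mod (*) M J q" for q
      by (rule independent_mod_le_generated_mod[OF M U' JU mMU v(2,1) that])
  qed

  \<comment> \<open>The dual family: \<open>w\<close> separates \<open>v i\<close> from the span of \<open>U\<close> and the other \<open>v l\<close>.\<close>
  have "\<exists>w. (\<forall>x\<in>U. \<psi> (w * x) = 0) \<and> (\<forall>l<r. \<psi> (w * v l) = (if l = i then 1 else 0))" if i: "i < r" for i
  proof -
    define W where "W = {u + (\<Sum>l<r. const_scale (c l) (v l)) |u c. u \<in> U \<and> c i = (0::'k)}"
    have W: "coeff.subspace W"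
    proof (rule coeff.subspaceI)
      show "0 \<in> W" unfolding W_def using coeff.subspace_0[OF U']
        by (intro CollectI exI[of _ 0] exI[of _ "\<lambda>_. 0"]) simp
    next
      fix x x' assume "x \<in> W" "x' \<in> W"
      then obtain u c u' c' where "x = u + (\<Sum>l<r. const_scale (c l) (v l))" "x' = u' + (\<Sum>l<r. const_scale (c' l) (v l))"
        "u \<in> U" "u' \<in> U" "c i = 0" "c' i = 0" by (auto simp: W_def)
      then show "x + x' \<in> W"
        unfolding W_def using coeff.subspace_add[OF U']
        by (intro CollectI exI[of _ "u + u'"] exI[of _ "\<lambda>l. c l + c' l"]) (simp add: coeff.scale_left_distrib sum.distrib)
    next
      fix d x assume "x \<in> W"
      then obtain u c where "x = u + (\<Sum>l<r. const_scale (c l) (v l))" "u \<in> U" "c i = 0" by (auto simp: W_def)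
      then show "const_scale d x \<in> W"
        unfolding W_def using coeff.subspace_scale[OF U']
        by (intro CollectI exI[of _ "const_scale d u"] exI[of _ "\<lambda>l. d * c l"])
           (simp add: coeff.scale_right_distrib coeff.scale_sum_right coeff.scale_scale)
    qed
    have UW: "U \<subseteq> W"
    proof
      fix u assume "u \<in> U" then show "u \<in> W"
        unfolding W_def by (intro CollectI exI[of _ u] exI[of _ "\<lambda>_. 0"]) simp
    qed
    have delta: "(\<Sum>l<r. const_scale (if l = j then 1 else 0) (v l)) = v j" if "j < r" for j
    proof -
      have "(\<Sum>l<r. const_scale (if l = j then 1 else 0) (v l)) = (\<Sum>l<r. if l = j then v l else 0)"
        by (rule sum.cong) auto
      then show ?thesis using that by simp
    qed
    have vW: "v l \<in> W" if "l < r" "l \<noteq> i" for l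
      unfolding W_def using coeff.subspace_0[OF U'] delta[OF that(1)] that(2)
      by (intro CollectI exI[of _ 0] exI[of _ "\<lambda>j. if j = l then 1 else 0"]) simp
    have "v i \<notin> W"
    proof
      assume "v i \<in> W"
      then obtain u c where uc: "v i = u + (\<Sum>l<r. const_scale (c l) (v l))" "u \<in> U" "c i = 0" by (auto simp: W_def)
      have "(\<Sum>l<r. const_scale ((if l = i then 1 else 0) - c l) (v l)) = v i - (\<Sum>l<r. const_scale (c l) (v l))"
        by (simp add: coeff.scale_left_diff_distrib sum_subtractf delta[OF i])
      also have "\<dots> \<in> U" using uc by simp
      finally show False
        using v(2)[unfolded independent_mod_def, rule_format, of "\<lambda>l. (if l = i then 1 else 0) - c l", OF _ i] uc(3)
        by simp
    qed
    then obtain w where "\<forall>x\<in>W. \<psi> (w * x) = 0" "\<psi> (w * v i) = 1"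
      using separating_multiplier[OF W] UW JU by blast
    then show ?thesis using UW vW by (intro exI[of _ w]) auto
  qed
  then obtain w where w: "\<And>i x. i < r \<Longrightarrow> x \<in> U \<Longrightarrow> \<psi> (w i * x) = 0"
    "\<And>i l. i < r \<Longrightarrow> l < r \<Longrightarrow> \<psi> (w i * v l) = (if l = i then 1 else 0)" by metis
  have Uperp: "x \<in> colon K max_ideal \<longleftrightarrow> (\<forall>u\<in>U. \<psi> (x * u) = 0)" for x
  proof
    assume x: "x \<in> colon K max_ideal"
    show "\<forall>u\<in>U. \<psi> (x * u) = 0"
    proof
      fix u assume "u \<in> U"
      then obtain n y where u: "u = n + (\<Sum>j\<in>UNIV. var j * y j)" "n \<in> J" "\<forall>j. y j \<in> M" by (auto simp: U_def)
      have "(\<Sum>j\<in>UNIV. x * var j * y j) \<in> J"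
        by (rule ideal.subspace_sum[OF ideal_J]) (use x u(3) Km KM in blast)
      then have "x * n + (\<Sum>j\<in>UNIV. x * var j * y j) \<in> J"
        by (rule ideal.subspace_add[OF ideal_J ideal.subspace_scale[OF ideal_J u(2)]])
      then show "\<psi> (x * u) = 0"
        unfolding u(1) by (intro psi_J) (simp add: distrib_left sum_distrib_left mult.assoc)
    qed
  next
    assume x: "\<forall>u\<in>U. \<psi> (x * u) = 0"
    show "x \<in> colon K max_ideal"
      unfolding Km KM
    proof (intro allI ballI)
      fix i y assume "y \<in> M"
      show "x * var i * y \<in> J"
        unfolding mem_J_iff
      proof
        fix p
        have "var i * (p * y) \<in> U" using mMU ideal.subspace_scale[OF M \<open>y \<in> M\<close>] by blast
        then have "\<psi> (x * (var i * (p * y))) = 0" using x by blast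
        then show "\<psi> (p * (x * var i * y)) = 0" by (simp only: ac_simps)
      qed
    qed
  qed
  have Kperp: "x \<in> K \<longleftrightarrow> (\<forall>y\<in>M. \<psi> (x * y) = 0)" for x
  proof
    assume "x \<in> K" then show "\<forall>y\<in>M. \<psi> (x * y) = 0" using KM psi_J by blast
  next
    assume x: "\<forall>y\<in>M. \<psi> (x * y) = 0"
    show "x \<in> K"
      unfolding KM mem_J_iff
    proof (intro ballI allI)
      fix y p assume "y \<in> M"
      then have "p * y \<in> M" by (rule ideal.subspace_scale[OF M])
      then have "\<psi> (x * (p * y)) = 0" using x by blast
      then show "\<psi> (p * (x * y)) = 0" by (simp only: ac_simps)
    qed
  qed
  have wKm: "w i \<in> colon K max_ideal" if "i < r" for i using w(1)[OF that] Uperp by blast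
  have comb: "\<psi> ((\<Sum>i<r. const_scale (c i) (w i)) * y) = (\<Sum>i<r. c i * \<psi> (w i * y))" for c y
    by (simp add: sum_distrib_right const_scale_mult psi_linear)
  have nu2: "nu (*) (colon K max_ideal) K = enat r"
  proof (rule ideal.nu_eqI[OF K(1) is_ideal_colon[OF K(1)]])
    show "generated_mod (*) (colon K max_ideal) K r"
      unfolding generated_mod_def
    proof (rule exI[of _ w], intro conjI allI impI ballI wKm)
      fix x assume x: "x \<in> colon K max_ideal"
      define c where "c i = \<psi> (x * v i)" for i
      have "x - (\<Sum>i<r. const_scale (c i) (w i)) \<in> K"
        unfolding Kperp
      proof
        fix y assume "y \<in> M"
        then obtain d where d: "y - (\<Sum>i<r. const_scale (d i) (v i)) \<in> U" using v(3) by blast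
        define u where "u = y - (\<Sum>i<r. const_scale (d i) (v i))"
        have y: "y = (\<Sum>l<r. const_scale (d l) (v l)) + u" by (simp add: u_def)
        have xy: "\<psi> (x * y) = (\<Sum>l<r. d l * c l)"
        proof -
          have "\<psi> (x * u) = 0" using x d Uperp unfolding u_def by blast
          then show ?thesis
            unfolding y c_def by (simp add: distrib_left sum_distrib_left const_scale_mult psi_linear)
        qed
        have wy: "\<psi> (w i * y) = d i" if "i < r" for i
        proof -
          have "\<psi> (w i * y) = (\<Sum>l<r. d l * \<psi> (w i * v l))"
            unfolding y using w(1)[OF that d[folded u_def]]
            by (simp add: distrib_left sum_distrib_left const_scale_mult psi_linear)
          also have "\<dots> = (\<Sum>l<r. if l = i then d l else 0)"
            by (rule sum.cong) (use w(2) that in auto)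
          finally show ?thesis using that by simp
        qed
        have "\<psi> ((\<Sum>i<r. const_scale (c i) (w i)) * y) = (\<Sum>i<r. c i * d i)"
          unfolding comb by (rule sum.cong) (use wy in auto)
        then show "\<psi> ((x - (\<Sum>i<r. const_scale (c i) (w i))) * y) = 0"
          unfolding left_diff_distrib psi_linear(2) xy by (simp add: mult.commute)
      qed
      then show "\<exists>c. x - (\<Sum>i<r. c i * w i) \<in> K"
        unfolding const_scale_def by (intro exI[of _ "\<lambda>i. single 0 (c i)"])
    qed
    fix q assume gen: "generated_mod (*) (colon K max_ideal) K q"
    show "r \<le> q"
    proof (rule independent_mod_le_generated_mod[OF is_ideal_colon[OF K(1)] is_ideal_imp_coeff_subspace[OF K(1)] order_refl _ _ wKm gen])
      show "var i * x \<in> K" if "x \<in> colon K max_ideal" for i x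
        using that Km by (metis mult.commute)
      show "independent_mod K r w"
        unfolding independent_mod_def
      proof (intro allI impI)
        fix c l assume "(\<Sum>i<r. const_scale (c i) (w i)) \<in> K" "l < r"
        then have "(\<Sum>i<r. c i * \<psi> (w i * v l)) = 0"
          using Kperp v(1) comb by metis
        also have "(\<Sum>i<r. c i * \<psi> (w i * v l)) = (\<Sum>i<r. if i = l then c i else 0)"
          by (rule sum.cong) (use w(2) \<open>l < r\<close> in auto)
        finally show "c l = 0" using \<open>l < r\<close> by simp
      qed
    qed
  qed
  show ?thesis using nu1 nu2 unfolding M_def by simp
qed

end

section \<open>Linear and quadratic forms in the variables of the Rees algebra\<close>

interpretation S_module: module "const_scale :: 'a::comm_ring_1 \<Rightarrow> ('g, 'a) mpoly \<Rightarrow> ('g, 'a) mpoly"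
  by (rule module_const_scale)

declare S_module.scale_scale [simp del]

lemma sum_UNIV_option: "(\<Sum>i\<in>UNIV. g i) = g None + (\<Sum>j\<in>UNIV. g (Some j))" for g :: "'n::finite option \<Rightarrow> 'a::comm_monoid_add"
  by (simp add: UNIV_option_conv sum.reindex)

definition linear_form :: "('g::finite \<Rightarrow> 'a::comm_ring_1) \<Rightarrow> ('g, 'a) mpoly"
  where "linear_form z = (\<Sum>i\<in>UNIV. single (single i 1) (z i))"

text \<open>
  The matrix \<open>c\<close> is not assumed symmetric or triangular, so it is determined by the form only up to
  alternating matrices (\<open>quadratic_form_alternating\<close>). This freedom is used to rearrange relations.
\<close>

definition quadratic_form :: "('g::finite \<Rightarrow> 'g \<Rightarrow> 'a::comm_ring_1) \<Rightarrow> ('g, 'a) mpoly"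
  where "quadratic_form c =
    (\<Sum>i\<in>UNIV. \<Sum>j\<in>UNIV. single (single i 1 + single j 1) (c i j))"

lemma linear_form_mult: "linear_form u * linear_form z = quadratic_form (\<lambda>i j. u i * z j)"
  by (simp add: linear_form_def quadratic_form_def sum_product mult_single)

lemma quadratic_form_add: "quadratic_form c + quadratic_form d = quadratic_form (\<lambda>i j. c i j + d i j)"
  by (simp add: quadratic_form_def single_add sum.distrib)

lemma quadratic_form_diff: "quadratic_form c - quadratic_form d = quadratic_form (\<lambda>i j. c i j - d i j)"
  by (simp add: quadratic_form_def single_diff sum_subtractf)

lemma quadratic_form_sum: "(\<Sum>x\<in>A. quadratic_form (c x)) = quadratic_form (\<lambda>i j. \<Sum>x\<in>A. c x i j)"
  by (induction A rule: infinite_finite_induct) (simp_all add: quadratic_form_add, simp_all add: quadratic_form_def)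

lemma quadratic_form_alternating:
  fixes c :: "'g::finite \<Rightarrow> 'g \<Rightarrow> 'a::comm_ring_1"
  assumes anti: "\<And>i j. c i j = - c j i" and diag: "\<And>i. c i i = 0"
  shows "quadratic_form c = 0"
proof (rule poly_mapping_eqI)
  fix m
  define g where "g i j = (c i j when single i (1::nat) + single j 1 = m)" for i j
  have g: "g i j = - g j i" for i j
    unfolding g_def by (subst anti) (simp add: when_def add.commute)
  have "lookup (quadratic_form c) m = (\<Sum>i\<in>UNIV. \<Sum>j\<in>UNIV. g i j)"
    unfolding quadratic_form_def lookup_sum lookup_single g_def ..
  also have "\<dots> = 0" by (rule sum_alternating[OF finite g]) (simp add: g_def diag)
  finally show "lookup (quadratic_form c) m = lookup 0 m" by simp
qed

lemma exponent_sum_eq_double: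
  "single i (1::nat) + single j 1 = single l 1 + single l 1 \<longleftrightarrow> i = l \<and> j = l"
proof
  assume *: "single i (1::nat) + single j 1 = single l 1 + single l 1"
  show "i = l \<and> j = l"
    using arg_cong[OF *, of "\<lambda>m. lookup m l"]
    by (auto simp: lookup_add lookup_single when_def split: if_splits)
qed simp

lemma lookup_quadratic_form_square:
  "lookup (quadratic_form c) (single l 1 + single l 1) = c l l"
proof -
  have "lookup (quadratic_form c) (single l 1 + single l 1)
    = (\<Sum>i\<in>UNIV. \<Sum>j\<in>UNIV. if j = l then (if i = l then c i j else 0) else 0)"
    unfolding quadratic_form_def lookup_sum lookup_single exponent_sum_eq_double
    by (intro sum.cong) (auto simp: when_def)
  then show ?thesis by simp
qed

definition rees_monomial :: "'a::comm_ring_1 ^ 'g \<Rightarrow> ('g::finite \<Rightarrow>\<^sub>0 nat) \<Rightarrow> 'a poly"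
  where "rees_monomial a m = (\<Prod>i\<in>UNIV. monom (a $ i) 1 ^ lookup m i)"

lemma rees_monomial_add: "rees_monomial a (m + l) = rees_monomial a m * rees_monomial a l"
  by (simp add: rees_monomial_def lookup_add power_add prod.distrib)

lemma rees_monomial_single: "rees_monomial a (single i 1) = monom (a $ i) 1"
proof -
  have "rees_monomial a (single i 1) = (\<Prod>j\<in>UNIV. if j = i then monom (a $ i) 1 else 1)"
    unfolding rees_monomial_def by (rule prod.cong) (auto simp: lookup_single when_def)
  then show ?thesis by simp
qed

lemma rees_map_superset:
  assumes "finite A" "keys F \<subseteq> A"
  shows "rees_map a F = (\<Sum>m\<in>A. [:lookup F m:] * rees_monomial a m)"
  unfolding rees_map_def rees_monomial_def[symmetric]
  by (rule sum.mono_neutral_left[OF assms]) (auto simp: in_keys_iff)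

lemma rees_map_add: "rees_map a (F + G) = rees_map a F + rees_map a G"
proof -
  let ?A = "keys F \<union> keys G"
  have "rees_map a (F + G) = (\<Sum>m\<in>?A. [:lookup (F + G) m:] * rees_monomial a m)"
    by (rule rees_map_superset) (use keys_add[of F G] in auto)
  also have "\<dots> = (\<Sum>m\<in>?A. [:lookup F m:] * rees_monomial a m) + (\<Sum>m\<in>?A. [:lookup G m:] * rees_monomial a m)"
    by (simp add: lookup_add sum.distrib[symmetric] smult_add_left)
  also have "\<dots> = rees_map a F + rees_map a G"
    using rees_map_superset[of ?A F a] rees_map_superset[of ?A G a] by simp
  finally show ?thesis .
qed

lemma rees_map_single: "rees_map a (single m r) = [:r:] * rees_monomial a m"
  by (subst rees_map_superset[of "{m}"]) auto

lemma rees_map_zero: "rees_map a 0 = 0"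
  by (simp add: rees_map_def)

lemma rees_map_sum: "rees_map a (sum F A) = (\<Sum>x\<in>A. rees_map a (F x))"
  by (induction A rule: infinite_finite_induct) (simp_all add: rees_map_zero rees_map_add)

lemma rees_map_linear_form: "rees_map a (linear_form z) = monom (\<Sum>i\<in>UNIV. z i * a $ i) 1"
  by (simp add: linear_form_def rees_map_sum rees_map_single rees_monomial_single smult_monom monom_sum
      del: One_nat_def)

lemma rees_map_quadratic_form:
  "rees_map a (quadratic_form c) = monom (\<Sum>i\<in>UNIV. \<Sum>j\<in>UNIV. c i j * (a $ i * a $ j)) 2"
  by (simp add: quadratic_form_def rees_map_sum rees_map_single rees_monomial_add rees_monomial_single
      mult_monom smult_monom monom_sum del: One_nat_def)

lemma S_comp_1_iff: "F \<in> S_comp 1 \<longleftrightarrow> (\<exists>z. F = linear_form z)" for F :: "('g::finite, 'a::comm_ring_1) mpoly"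
proof
  assume F: "F \<in> S_comp 1"
  have "F = linear_form (\<lambda>i. lookup F (single i 1))"
  proof (rule poly_mapping_eqI)
    fix m
    show "lookup F m = lookup (linear_form (\<lambda>i. lookup F (single i 1))) m"
    proof (cases "exponent_degree m = 1")
      case True
      then have "m \<noteq> 0" by auto
      then obtain i l where m: "m = single i 1 + l"
        by (rule exponent_nonzero_split)
      then have "l = 0" using True by (simp add: exponent_degree_add)
      then have m: "m = single i 1" using m by simp
      have eq: "single j (1::nat) = single i 1 \<longleftrightarrow> j = i" for j
        by (metis lookup_single_eq lookup_single_not_eq zero_neq_one)
      show ?thesis unfolding m linear_form_def lookup_sum lookup_single eq by (simp add: when_def)
    next
      case False
      then have "lookup F m = 0"
        using F by (auto simp: S_comp_def homogeneous_def exponent_degree_def in_keys_iff)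
      moreover have "single i 1 \<noteq> m" for i using False exponent_degree_single by metis
      ultimately show ?thesis by (simp add: linear_form_def lookup_sum lookup_single when_def)
    qed
  qed
  then show "\<exists>z. F = linear_form z" by blast
next
  assume "\<exists>z. F = linear_form z"
  then obtain z where F: "F = linear_form z" by blast
  have "exponent_degree m = 1" if "m \<in> keys F" for m
  proof (rule ccontr)
    assume "exponent_degree m \<noteq> 1"
    then have "single i 1 \<noteq> m" for i using exponent_degree_single by metis
    then show False using that by (simp add: F in_keys_iff linear_form_def lookup_sum lookup_single when_def)
  qed
  then show "F \<in> S_comp 1" by (auto simp: S_comp_def homogeneous_def exponent_degree_def)
qed

lemma S_comp_2_iff: "F \<in> S_comp 2 \<longleftrightarrow> (\<exists>c. F = quadratic_form c)" for F :: "('g::finite, 'a::comm_ring_1) mpoly"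
proof
  assume F: "F \<in> S_comp 2"
  have "\<exists>c. single m r = quadratic_form c" if "exponent_degree m = 2" for m :: "'g \<Rightarrow>\<^sub>0 nat" and r :: 'a
  proof -
    have "m \<noteq> 0" using that by auto
    then obtain i l where m: "m = single i 1 + l"
      by (rule exponent_nonzero_split)
    then have l: "exponent_degree l = 1" using that by (simp add: exponent_degree_add)
    then have "l \<noteq> 0" by auto
    then obtain j l' where l': "l = single j 1 + l'"
      by (rule exponent_nonzero_split)
    then have "l' = 0" using l by (simp add: exponent_degree_add)
    then have "m = single i 1 + single j 1" using m l' by simp
    moreover have "quadratic_form (\<lambda>k l. if l = j then if k = i then r else 0 else 0)
       = single (single i 1 + single j 1) r"
    proof -
      have "quadratic_form (\<lambda>k l. if l = j then if k = i then r else 0 else 0)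
        = (\<Sum>k\<in>UNIV. \<Sum>l\<in>UNIV. if l = j then if k = i then single (single i 1 + single j 1) r else 0 else 0)"
        unfolding quadratic_form_def by (intro sum.cong refl) auto
      then show ?thesis by simp
    qed
    ultimately show ?thesis by metis
  qed
  note form = this
  define C where "C m r = (SOME c. single m r = quadratic_form c)" for m :: "'g \<Rightarrow>\<^sub>0 nat" and r :: 'a
  have C: "single m r = quadratic_form (C m r)" if "exponent_degree m = 2" for m r
    unfolding C_def by (rule someI_ex[OF form[OF that]])
  have "F = (\<Sum>m\<in>keys F. quadratic_form (C m (lookup F m)))"
    by (subst mpoly_sum_monomials)
       (use F in \<open>auto intro!: sum.cong C simp: S_comp_def homogeneous_def exponent_degree_def\<close>)
  then show "\<exists>c. F = quadratic_form c" unfolding quadratic_form_sum by blast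
next
  assume "\<exists>c. F = quadratic_form c"
  then obtain c where F: "F = quadratic_form c" by blast
  have "exponent_degree m = 2" if "m \<in> keys F" for m
  proof (rule ccontr)
    assume "exponent_degree m \<noteq> 2"
    then have "single i 1 + single j 1 \<noteq> m" for i j
      using exponent_degree_add[of "single i 1" "single j 1"] by auto
    then show False using that by (simp add: F in_keys_iff quadratic_form_def lookup_sum lookup_single when_def)
  qed
  then show "F \<in> S_comp 2" by (auto simp: S_comp_def homogeneous_def exponent_degree_def)
qed

lemma L_comp_1_iff: "F \<in> L_comp a 1 \<longleftrightarrow> (\<exists>z\<in>syzygies a. F = linear_form (($) z))"
proof -
  have "F \<in> L_comp a 1 \<longleftrightarrow> (\<exists>z. F = linear_form z \<and> (\<Sum>i\<in>UNIV. z i * a $ i) = 0)"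
    unfolding L_comp_def using S_comp_1_iff[of F] by (auto simp: rees_map_linear_form)
  also have "\<dots> \<longleftrightarrow> (\<exists>z\<in>syzygies a. F = linear_form (($) z))"
  proof
    assume "\<exists>z. F = linear_form z \<and> (\<Sum>i\<in>UNIV. z i * a $ i) = 0"
    then obtain z where z: "F = linear_form z" "(\<Sum>i\<in>UNIV. z i * a $ i) = 0" by blast
    have "($) (\<chi> i. z i) = z" by (rule ext) simp
    then show "\<exists>z\<in>syzygies a. F = linear_form (($) z)"
      using z by (intro bexI[of _ "\<chi> i. z i"]) (simp_all add: syzygies_def)
  qed (auto simp: syzygies_def)
  finally show ?thesis .
qed

lemma L_comp_2_iff:
  "F \<in> L_comp a 2 \<longleftrightarrow> (\<exists>c. F = quadratic_form c \<and> (\<Sum>i\<in>UNIV. \<Sum>j\<in>UNIV. c i j * (a $ i * a $ j)) = 0)"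
  unfolding L_comp_def using S_comp_2_iff[of F] by (auto simp: rees_map_quadratic_form)

section \<open>Syzygies of an almost complete intersection\<close>

interpretation syz_module: module "(*s) :: 'a::comm_ring_1 \<Rightarrow> 'a ^ 'g \<Rightarrow> 'a ^ 'g"
  by (rule module_vec)

declare syz_module.scale_scale [simp del]

lemma subspace_koszul_relations: "syz_module.subspace (koszul_relations a)"
  by (simp add: koszul_relations_def)

lemma subspace_syzygies: "syz_module.subspace (syzygies a)"
  by (rule syz_module.subspaceI)
     (simp_all add: syzygies_def distrib_right sum.distrib mult.assoc flip: sum_distrib_left)

lemma koszul_relation_mem: "axis j (a $ i) - axis i (a $ j) \<in> koszul_relations a"
proof (cases "i = j")
  case True
  then show ?thesis by (simp add: koszul_relations_def syz_module.span_zero)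
next
  case False
  then show ?thesis unfolding koszul_relations_def by (intro syz_module.span_base) blast
qed

lemma koszul_relations_subset_syzygies: "koszul_relations a \<subseteq> syzygies a"
  unfolding koszul_relations_def
proof (rule syz_module.span_minimal[OF _ subspace_syzygies], clarify)
  fix i j :: 'b
  have "(\<Sum>l\<in>UNIV. axis j (a $ i) $ l * a $ l) = a $ i * a $ j" for i j
  proof -
    have "(\<Sum>l\<in>UNIV. axis j (a $ i) $ l * a $ l) = (\<Sum>l\<in>UNIV. if l = j then a $ i * a $ l else 0)"
      by (rule sum.cong) (auto simp: axis_def)
    then show ?thesis by simp
  qed
  then show "axis j (a $ i) - axis i (a $ j) \<in> syzygies a"
    by (simp add: syzygies_def left_diff_distrib sum_subtractf mult.commute[of "a $ i" "a $ j"])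
qed

definition syzygy_entries_ideal :: "'a::comm_ring_1 ^ 'g \<Rightarrow> 'a set"
  where "syzygy_entries_ideal a = ideal_gen {z $ i |z i. z \<in> syzygies a}"

text \<open>
  The columns of \<open>\<phi>\<close> generate the syzygies, so the entries of any syzygy are combinations of entries of
  \<open>\<phi>\<close>.
\<close>

lemma entries_ideal_minimal_presentation:
  fixes a :: "('v::finite, 'b::comm_ring_1) mpoly ^ 'g"
  assumes "minimal_presentation a \<phi>"
  shows "entries_ideal \<phi> = syzygy_entries_ideal a"
proof -
  have syz: "module.span (*s) (range (\<lambda>j. column j \<phi>)) = syzygies a"
    using assms by (simp add: minimal_presentation_def minimally_generates_def)
  show ?thesis
  proof
    have "\<phi> $ i $ j \<in> syzygy_entries_ideal a" for i j
    proof -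
      have "column j \<phi> \<in> syzygies a" unfolding syz[symmetric] by (rule syz_module.span_base) simp
      then have "column j \<phi> $ i \<in> syzygy_entries_ideal a"
        unfolding syzygy_entries_ideal_def by (intro ideal.span_base) blast
      then show ?thesis by (simp add: column_def)
    qed
    then show "entries_ideal \<phi> \<subseteq> syzygy_entries_ideal a"
      unfolding entries_ideal_def
      by (intro ideal.span_minimal) (auto simp: syzygy_entries_ideal_def)
    have "\<forall>i. z $ i \<in> entries_ideal \<phi>" if "z \<in> syzygies a" for z
      using that unfolding syz[symmetric]
    proof (induction rule: syz_module.span_induct_alt)
      case base show ?case by (simp add: entries_ideal_def ideal.span_zero)
    next
      case (step c x y)
      then obtain j where j: "x = column j \<phi>" by blast
      have "x $ i \<in> entries_ideal \<phi>" for i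
        unfolding j column_def entries_ideal_def by (intro ideal.span_base) auto
      then show ?case
        using step(2) by (auto simp: entries_ideal_def intro!: ideal.span_add ideal.span_scale)
    qed
    then show "syzygy_entries_ideal a \<subseteq> entries_ideal \<phi>"
      unfolding syzygy_entries_ideal_def
      by (intro ideal.span_minimal) (auto simp: entries_ideal_def)
  qed
qed

text \<open>
  The generators indexed by \<open>Some j\<close> generate \<open>J\<close> and have only Koszul syzygies; \<open>None\<close> is the index of
  the additional generator. The condition \<open>double_colon\<close> holds if the quotient by \<open>J\<close> is Gorenstein.
\<close>

locale almost_complete_intersection =
  fixes a :: "'a::comm_ring_1 ^ ('n::finite option)" and I J :: "'a set"
  assumes I_def: "I = ideal_gen (range (($) a))"
    and J_def: "J = ideal_gen (range (\<lambda>i. a $ Some i))"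
    and koszul: "(\<Sum>i\<in>UNIV. z i * a $ Some i) = 0 \<Longrightarrow>
      \<exists>e. (\<forall>i j. e i j = - e j i) \<and> (\<forall>i. e i i = 0) \<and> (\<forall>i. z i = (\<Sum>j\<in>UNIV. e i j * a $ Some j))"
    and double_colon: "colon J (colon J I) = I"
begin

lemma J_iff: "p \<in> J \<longleftrightarrow> (\<exists>c. p = (\<Sum>i\<in>UNIV. c i * a $ Some i))"
  unfolding J_def by (rule ideal_gen_range_iff)

lemma I_iff: "p \<in> I \<longleftrightarrow> (\<exists>c. p = (\<Sum>i\<in>UNIV. c i * a $ i))"
  unfolding I_def by (rule ideal_gen_range_iff)

lemma ideal_J: "is_ideal J" and ideal_I: "is_ideal I"
  by (simp_all add: I_def J_def)

lemma syzygy_iff: "z \<in> syzygies a \<longleftrightarrow> z $ None * a $ None + (\<Sum>j\<in>UNIV. z $ Some j * a $ Some j) = 0"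
  by (simp add: syzygies_def sum_UNIV_option)

lemma syzygy_last: "z \<in> syzygies a \<Longrightarrow> z $ None * a $ None \<in> J"
  unfolding syzygy_iff J_iff
  by (intro exI[of _ "\<lambda>j. - (z $ Some j)"]) (simp add: sum_negf eq_neg_iff_add_eq_0)

lemma syzygy_of_last:
  assumes "u * a $ None \<in> J" shows "\<exists>z\<in>syzygies a. z $ None = u"
proof -
  obtain c where c: "u * a $ None = (\<Sum>i\<in>UNIV. c i * a $ Some i)" using assms by (auto simp: J_iff)
  show ?thesis
    by (rule bexI[of _ "\<chi> i. case i of None \<Rightarrow> u | Some j \<Rightarrow> - c j"])
       (simp_all add: syzygy_iff c sum_negf)
qed

lemma colon_J_I: "colon J I = {u. u * a $ None \<in> J}"
proof -
  have "range (($) a) = insert (a $ None) (range (\<lambda>i. a $ Some i))"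
    by (simp add: UNIV_option_conv image_image)
  then show ?thesis
    unfolding I_def colon_span[OF ideal_J]
    by (auto simp: J_def intro: ideal.span_scale ideal.span_base)
qed

text \<open>
  The combination of \<open>z\<close> and \<open>w\<close> that cancels their last entries is a syzygy of the generators of \<open>J\<close>. Such
  syzygies are alternating combinations of the generators, so their entries lie in \<open>J\<close>.
\<close>

lemma syzygy_exchange:
  assumes z: "z \<in> syzygies a" and w: "w \<in> syzygies a"
  shows "z $ None * w $ i - z $ i * w $ None \<in> J"
proof (cases i)
  case None
  then show ?thesis using ideal.subspace_0[OF ideal_J] by (simp add: mult.commute)
next
  case (Some j)
  have "(\<Sum>l\<in>UNIV. (z $ None * w $ Some l - z $ Some l * w $ None) * a $ Some l)
    = z $ None * (\<Sum>l\<in>UNIV. w $ Some l * a $ Some l) - w $ None * (\<Sum>l\<in>UNIV. z $ Some l * a $ Some l)"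
    unfolding left_diff_distrib sum_subtractf sum_distrib_left
    by (simp only: mult.left_commute mult.commute mult.assoc)
  also have "\<dots> = 0"
  proof -
    have "(\<Sum>l\<in>UNIV. w $ Some l * a $ Some l) = - (w $ None * a $ None)"
      "(\<Sum>l\<in>UNIV. z $ Some l * a $ Some l) = - (z $ None * a $ None)"
      using z w by (simp_all add: syzygy_iff eq_neg_iff_add_eq_0 add.commute)
    then show ?thesis by simp
  qed
  finally have "(\<Sum>l\<in>UNIV. (z $ None * w $ Some l - z $ Some l * w $ None) * a $ Some l) = 0" .
  from koszul[OF this] obtain e where "\<forall>l. z $ None * w $ Some l - z $ Some l * w $ None = (\<Sum>j\<in>UNIV. e l j * a $ Some j)"
    by blast
  then show ?thesis unfolding Some J_iff by blast
qed

lemma colon_entries: "colon J (syzygy_entries_ideal a) = {u. \<forall>w\<in>syzygies a. \<forall>i. u * w $ i \<in> J}"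
  unfolding syzygy_entries_ideal_def colon_span[OF ideal_J] by blast

text \<open>
  By \<open>syzygy_exchange\<close>, for every syzygy \<open>w\<close> the product of the last entry of \<open>z\<close> with \<open>w $ i\<close> is congruent
  modulo \<open>J\<close> to \<open>z $ i\<close> times the last entry of \<open>w\<close>. The last entries of syzygies are exactly the elements
  of \<open>J : I\<close>, so the second product lies in \<open>J\<close> for all \<open>w\<close> if and only if \<open>z $ i\<close> lies in
  \<open>J : (J : I) = I\<close>.
\<close>

lemma syzygy_entries_in_I_iff:
  assumes z: "z \<in> syzygies a"
  shows "(\<forall>i. z $ i \<in> I) \<longleftrightarrow> z $ None \<in> colon J (syzygy_entries_ideal a)"
proof
  assume zI: "\<forall>i. z $ i \<in> I"
  show "z $ None \<in> colon J (syzygy_entries_ideal a)"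
    unfolding colon_entries
  proof (intro CollectI ballI allI)
    fix w i assume w: "w \<in> syzygies a"
    have "w $ None \<in> colon J I" using syzygy_last[OF w] by (simp add: colon_J_I)
    then have "z $ i * w $ None \<in> J" using zI by (simp add: colon_def mult.commute[of "z $ i"])
    from ideal.subspace_add[OF ideal_J syzygy_exchange[OF z w, of i] this]
    show "z $ None * w $ i \<in> J" by simp
  qed
next
  assume zK: "z $ None \<in> colon J (syzygy_entries_ideal a)"
  show "\<forall>i. z $ i \<in> I"
  proof
    fix i
    have "z $ i * u \<in> J" if u: "u \<in> colon J I" for u
    proof -
      obtain w where w: "w \<in> syzygies a" "w $ None = u" using syzygy_of_last u by (auto simp: colon_J_I)
      have "z $ None * w $ i \<in> J" using zK w(1) by (auto simp: colon_entries)
      from ideal.subspace_diff[OF ideal_J this syzygy_exchange[OF z w(1), of i]]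
      show ?thesis using w(2) by simp
    qed
    then have "z $ i \<in> colon J (colon J I)" by (simp add: colon_def)
    then show "z $ i \<in> I" by (simp add: double_colon)
  qed
qed

lemma I_subset_entries: "I \<subseteq> syzygy_entries_ideal a"
proof -
  have rel: "axis j (a $ i) - axis i (a $ j) \<in> syzygies a" for i j
    using koszul_relation_mem koszul_relations_subset_syzygies by blast
  have "a $ i \<in> syzygy_entries_ideal a" for i
  proof -
    obtain j :: "'n option" where j: "j \<noteq> i" by (cases i) auto
    have "(axis j (a $ i) - axis i (a $ j)) $ j \<in> syzygy_entries_ideal a"
      unfolding syzygy_entries_ideal_def using rel by (intro ideal.span_base) blast
    then show ?thesis using j by (simp add: axis_def)
  qed
  then show ?thesis
    unfolding I_def by (intro ideal.span_minimal) (auto simp: syzygy_entries_ideal_def)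
qed

text \<open>
  Hence the last entry embeds the first Koszul homology into \<open>R / J\<close>. If the last entry lies in \<open>J\<close>,
  it can be removed by Koszul relations that involve \<open>None\<close>, and what is left is a syzygy of the generators
  of \<open>J\<close>.
\<close>

lemma syzygy_koszul_iff:
  assumes z: "z \<in> syzygies a"
  shows "z \<in> koszul_relations a \<longleftrightarrow> z $ None \<in> J"
proof -
  have entry: "(axis j r :: 'a ^ 'n option) $ l = (if l = j then r else 0)" for j r l
    by (simp add: axis_def)
  show ?thesis
  proof
    assume "z \<in> koszul_relations a"
    then show "z $ None \<in> J"
      unfolding koszul_relations_def
    proof (induction rule: syz_module.span_induct_alt)
      case base show ?case using ideal.subspace_0[OF ideal_J] by simp
    next
      case (step c x y)
      then obtain i j where x: "x = axis j (a $ i) - axis i (a $ j)" "i \<noteq> j" by blast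
      have aJ: "a $ Some l \<in> J" for l unfolding J_def by (rule ideal.span_base) simp
      have "x $ None \<in> J"
        using x aJ ideal.subspace_0[OF ideal_J] ideal.subspace_neg[OF ideal_J]
        by (cases i; cases j) (auto simp: entry)
      then show ?case
        using step(2) by (simp add: ideal.subspace_add[OF ideal_J] ideal.subspace_scale[OF ideal_J])
    qed
  next
    assume "z $ None \<in> J"
    then obtain r where r: "z $ None = (\<Sum>j\<in>UNIV. r j * a $ Some j)" by (auto simp: J_iff)
    define y where "y = z - (\<Sum>j\<in>UNIV. r j *s (axis None (a $ Some j) - axis (Some j) (a $ None)))"
    have yN: "y $ None = 0" by (simp add: y_def r entry)
    have yS: "y $ Some l = z $ Some l + r l * a $ None" for l
    proof -
      have "(\<Sum>j\<in>UNIV. r j * (if l = j then a $ None else 0)) = r l * a $ None"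
        by (subst if_distrib) (simp cong: if_cong)
      then show ?thesis by (simp add: y_def entry sum_negf)
    qed
    have "(\<Sum>l\<in>UNIV. y $ Some l * a $ Some l) = (\<Sum>l\<in>UNIV. z $ Some l * a $ Some l) + z $ None * a $ None"
      unfolding yS r distrib_right sum.distrib sum_distrib_right
      by (simp only: mult.assoc mult.commute[of "a $ None"])
    also have "\<dots> = 0" using z by (simp add: syzygy_iff add.commute)
    finally have "(\<Sum>l\<in>UNIV. y $ Some l * a $ Some l) = 0" .
    from koszul[OF this] obtain e where e: "\<And>i j. e i j = - e j i" "\<And>i. e i i = 0" "\<And>i. y $ Some i = (\<Sum>j\<in>UNIV. e i j * a $ Some j)"
      by blast
    \<comment> \<open>The injection \<open>h\<close> orders the indices, so that every pair of them contributes once.\<close>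
    obtain h :: "'n \<Rightarrow> nat" where h: "inj h"
      using finite_imp_inj_to_nat_seg[of "UNIV :: 'n set"] by auto
    have "y = (\<Sum>i\<in>UNIV. \<Sum>j\<in>UNIV. (if h i < h j then e i j else 0) *s (axis (Some i) (a $ Some j) - axis (Some j) (a $ Some i)))"
      (is "y = ?rhs")
    proof (rule vec_eq_iff[THEN iffD2], rule allI)
      fix l
      show "y $ l = ?rhs $ l"
      proof (cases l)
        case None
        then show ?thesis by (simp add: yN entry)
      next
        case (Some p)
        define g where "g i j = (if h i < h j then e i j else 0)" for i j
        have inner: "(\<Sum>j\<in>UNIV. g i j * ((if p = i then a $ Some j else 0) - (if p = j then a $ Some i else 0)))
          = (if i = p then \<Sum>j\<in>UNIV. g p j * a $ Some j else 0) - g i p * a $ Some i" for i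
        proof -
          have "(\<Sum>j\<in>UNIV. g i j * (if p = j then a $ Some i else 0)) = (\<Sum>j\<in>UNIV. if p = j then g i j * a $ Some i else 0)"
            by (rule sum.cong) auto
          then show ?thesis by (simp add: right_diff_distrib sum_subtractf)
        qed
        have "?rhs $ l = (\<Sum>i\<in>UNIV. \<Sum>j\<in>UNIV. g i j * ((if p = i then a $ Some j else 0) - (if p = j then a $ Some i else 0)))"
          by (simp add: Some entry g_def right_diff_distrib)
        also have "\<dots> = (\<Sum>j\<in>UNIV. (if h p < h j then e p j else 0) * a $ Some j)
           - (\<Sum>i\<in>UNIV. (if h i < h p then e i p else 0) * a $ Some i)"
          unfolding inner sum_subtractf by (simp add: g_def)
        also have "\<dots> = (\<Sum>j\<in>UNIV. e p j * a $ Some j)"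
          unfolding sum_subtractf[symmetric]
        proof (rule sum.cong[OF refl])
          fix j
          have "h p = h j \<Longrightarrow> p = j" using h by (simp add: inj_eq)
          then show "(if h p < h j then e p j else 0) * a $ Some j - (if h j < h p then e j p else 0) * a $ Some j = e p j * a $ Some j"
            using e(1)[of p j] e(2)[of p] by (cases "h p" "h j" rule: linorder_cases) auto
        qed
        finally show ?thesis using e(3) by (simp add: Some)
      qed
    qed
    also have "\<dots> \<in> koszul_relations a"
      by (intro syz_module.subspace_sum[OF subspace_koszul_relations] syz_module.subspace_scale[OF subspace_koszul_relations] koszul_relation_mem)
    finally have "y \<in> koszul_relations a" .
    moreover have "(\<Sum>j\<in>UNIV. r j *s (axis None (a $ Some j) - axis (Some j) (a $ None))) \<in> koszul_relations a"
      by (intro syz_module.subspace_sum[OF subspace_koszul_relations] syz_module.subspace_scale[OF subspace_koszul_relations] koszul_relation_mem)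
    ultimately have "y + (\<Sum>j\<in>UNIV. r j *s (axis None (a $ Some j) - axis (Some j) (a $ None))) \<in> koszul_relations a"
      by (rule syz_module.subspace_add[OF subspace_koszul_relations])
    then show "z \<in> koszul_relations a" by (simp add: y_def)
  qed
qed

end

section \<open>The quadratic part of the Rees ideal\<close>

lemma subspace_S_comp: "S_module.subspace (S_comp i)"
proof (rule S_module.subspaceI)
  show "0 \<in> S_comp i" by (simp add: S_comp_def homogeneous_def)
  show "F + G \<in> S_comp i" if "F \<in> S_comp i" "G \<in> S_comp i" for F G
    using that keys_add[of F G] by (auto simp: S_comp_def homogeneous_def)
  show "const_scale r F \<in> S_comp i" if F: "F \<in> S_comp i" for r F
    unfolding S_comp_def homogeneous_def
  proof (intro CollectI ballI)
    fix m assume "m \<in> keys (const_scale r F)"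
    then have "m \<in> keys F"
      using lookup_single_mult[of 0 r F m] by (auto simp: const_scale_def in_keys_iff)
    then show "(\<Sum>i\<in>UNIV. lookup m i) = i"
      using F by (simp add: S_comp_def homogeneous_def)
  qed
qed

lemma lookup_const_scale: "lookup (const_scale r F) m = r * lookup F m"
  using lookup_single_mult[of 0 r F m] by (simp add: const_scale_def)

lemma rees_map_const_scale: "rees_map a (const_scale r F) = [:r:] * rees_map a F"
proof -
  have "rees_map a (const_scale r F) = (\<Sum>m\<in>keys F. [:r * lookup F m:] * rees_monomial a m)"
    by (subst rees_map_superset[of "keys F"]) (auto simp: lookup_const_scale in_keys_iff)
  also have "\<dots> = [:r:] * (\<Sum>m\<in>keys F. [:lookup F m:] * rees_monomial a m)"
    unfolding sum_distrib_left by (intro sum.cong refl) (simp add: mult.commute)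
  finally show ?thesis
    by (simp only: rees_map_superset[OF finite_keys subset_refl, where F = F and a = a])
qed

lemma subspace_L_comp: "S_module.subspace (L_comp a i)"
  using subspace_S_comp[of i]
  by (auto simp: L_comp_def S_module.subspace_def rees_map_add rees_map_zero rees_map_const_scale)

lemma subspace_S1L1: "S_module.subspace (S1L1 a)"
  by (simp add: S1L1_def)

lemma module_hom_square_coeff:
  "module_hom const_scale (*) (\<lambda>F. lookup F m * (b :: 'a::comm_ring_1))"
  by (intro module_hom.intro module_const_scale module_ring module_hom_axioms.intro)
     (simp_all add: lookup_add lookup_const_scale algebra_simps)

context almost_complete_intersection
begin

abbreviation square_coeff :: "('n option, 'a) mpoly \<Rightarrow> 'a"
  where "square_coeff F \<equiv> lookup F (single None 1 + single None 1)"

text \<open>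
  The value of a quadratic form at the generators, sorted by multiples of the generators of \<open>J\<close>. The mixed terms
  with \<open>None\<close> are attributed to these generators, and only the square of the last generator remains.
\<close>

lemma relation_sum_split:
  fixes c :: "'n option \<Rightarrow> 'n option \<Rightarrow> 'a"
  shows "(\<Sum>i\<in>UNIV. \<Sum>j\<in>UNIV. c i j * (a $ i * a $ j)) = c None None * (a $ None * a $ None)
    + (\<Sum>j\<in>UNIV. ((\<Sum>l\<in>UNIV. c (Some j) l * a $ l) + c None (Some j) * a $ None) * a $ Some j)"
proof -
  have "(\<Sum>i\<in>UNIV. \<Sum>j\<in>UNIV. c i j * (a $ i * a $ j)) = (\<Sum>j\<in>UNIV. c None j * (a $ None * a $ j))
    + (\<Sum>j\<in>UNIV. \<Sum>l\<in>UNIV. c (Some j) l * (a $ Some j * a $ l))"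
    by (simp add: sum_UNIV_option[of "\<lambda>i. \<Sum>j\<in>UNIV. c i j * (a $ i * a $ j)"])
  also have "(\<Sum>j\<in>UNIV. c None j * (a $ None * a $ j)) = c None None * (a $ None * a $ None)
    + (\<Sum>j\<in>UNIV. c None (Some j) * (a $ None * a $ Some j))"
    by (simp add: sum_UNIV_option[of "\<lambda>j. c None j * (a $ None * a $ j)"])
  also have "(\<Sum>j\<in>UNIV. \<Sum>l\<in>UNIV. c (Some j) l * (a $ Some j * a $ l)) = (\<Sum>j\<in>UNIV. (\<Sum>l\<in>UNIV. c (Some j) l * a $ l) * a $ Some j)"
    unfolding sum_distrib_right by (intro sum.cong refl) (simp add: ac_simps)
  finally show ?thesis
    unfolding distrib_right sum.distrib by (simp add: ac_simps)
qed

text \<open>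
  The factors of the generators in \<open>relation_sum_split\<close> form a syzygy with all entries in \<open>I\<close> whose last entry is
  \<open>square_coeff F * a $ None\<close>.
\<close>

lemma L2_square_coeff:
  assumes "F \<in> L_comp a 2"
  shows "square_coeff F * a $ None \<in> colon J (syzygy_entries_ideal a)"
proof -
  obtain c where F: "F = quadratic_form c" and c: "(\<Sum>i\<in>UNIV. \<Sum>j\<in>UNIV. c i j * (a $ i * a $ j)) = 0"
    using assms by (auto simp: L_comp_2_iff)
  define z where "z = (\<chi> i. case i of None \<Rightarrow> c None None * a $ None
      | Some j \<Rightarrow> (\<Sum>l\<in>UNIV. c (Some j) l * a $ l) + c None (Some j) * a $ None)"
  have z: "z \<in> syzygies a"
    unfolding syzygy_iff using c unfolding relation_sum_split by (simp add: z_def mult.assoc)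
  have aI: "a $ i \<in> I" for i unfolding I_def by (rule ideal.span_base) simp
  have "z $ i \<in> I" for i
    unfolding z_def
    by (cases i) (auto intro!: ideal.subspace_add[OF ideal_I] ideal.subspace_sum[OF ideal_I] ideal.subspace_scale[OF ideal_I] aI)
  then have "z $ None \<in> colon J (syzygy_entries_ideal a)" using syzygy_entries_in_I_iff[OF z] by blast
  then show ?thesis unfolding F lookup_quadratic_form_square by (simp add: z_def)
qed

text \<open>
  An element of \<open>J : K\<close> is the last entry of a syzygy with all entries in \<open>I\<close>; expressing these entries by
  the generators produces the matrix of a quadratic relation.
\<close>

lemma L2_square_coeff_onto:
  assumes u: "u \<in> colon J (syzygy_entries_ideal a)"
  shows "\<exists>F\<in>L_comp a 2. u - square_coeff F * a $ None \<in> J"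
proof -
  have "a $ None \<in> syzygy_entries_ideal a"
    using I_subset_entries ideal.span_base[of "a $ None" "range (($) a)"] by (auto simp: I_def)
  then have "u * a $ None \<in> J" using u by (auto simp: colon_def)
  then obtain z where z: "z \<in> syzygies a" "z $ None = u" using syzygy_of_last by blast
  then have "\<forall>i. z $ i \<in> I" using syzygy_entries_in_I_iff[OF z(1)] u by simp
  then have "\<forall>i. \<exists>c. z $ i = (\<Sum>j\<in>UNIV. c j * a $ j)" by (simp add: I_iff)
  then obtain c where c: "\<And>i. z $ i = (\<Sum>j\<in>UNIV. c i j * a $ j)" by metis
  have "(\<Sum>i\<in>UNIV. \<Sum>j\<in>UNIV. c i j * (a $ i * a $ j)) = (\<Sum>i\<in>UNIV. z $ i * a $ i)"
    unfolding c sum_distrib_right by (intro sum.cong refl) (simp add: ac_simps)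
  also have "\<dots> = 0" using z(1) by (simp add: syzygies_def)
  finally have "quadratic_form c \<in> L_comp a 2" by (auto simp: L_comp_2_iff)
  moreover have "u - square_coeff (quadratic_form c) * a $ None \<in> J"
    unfolding lookup_quadratic_form_square J_iff z(2)[symmetric] c sum_UNIV_option[of "\<lambda>j. c None j * a $ j"]
    by (intro exI[of _ "\<lambda>j. c None (Some j)"]) simp
  ultimately show ?thesis by blast
qed

lemma S1L1_square_coeff:
  assumes "F \<in> S1L1 a" shows "square_coeff F * a $ None \<in> J"
  using assms unfolding S1L1_def
proof (induction rule: S_module.span_induct_alt)
  case base
  show ?case using ideal.subspace_0[OF ideal_J] by simp
next
  case (step r x y)
  then obtain u z where x: "x = linear_form u * linear_form (($) z)" and z: "z \<in> syzygies a"
    by (auto simp: S_comp_1_iff[unfolded One_nat_def] L_comp_1_iff[unfolded One_nat_def] S_comp_1_iff L_comp_1_iff)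
  have "square_coeff x = u None * z $ None"
    unfolding x linear_form_mult by (rule lookup_quadratic_form_square)
  then have "square_coeff (const_scale r x + y) * a $ None = r * u None * (z $ None * a $ None) + square_coeff y * a $ None"
    by (simp add: lookup_add lookup_const_scale algebra_simps del: One_nat_def)
  then show ?case
    using ideal.subspace_add[OF ideal_J ideal.subspace_scale[OF ideal_J syzygy_last[OF z]] step(2)] by simp
qed

lemma variable_times_L1_in_S1L1:
  assumes "z \<in> syzygies a" shows "quadratic_form (\<lambda>i j. u i * z $ j) \<in> S1L1 a"
proof -
  have "linear_form u * linear_form (($) z) \<in> S1L1 a"
  proof -
    have "linear_form u \<in> S_comp 1" "linear_form (($) z) \<in> L_comp a 1"
      using assms unfolding S_comp_1_iff L_comp_1_iff by blast+
    then show ?thesis unfolding S1L1_def by (intro S_module.span_base) blast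
  qed
  then show ?thesis by (simp add: linear_form_mult)
qed

text \<open>
  If \<open>square_coeff F * a $ None\<close> lies in \<open>J\<close>, then \<open>square_coeff F\<close> is the last entry of a syzygy \<open>w\<close>, and
  subtracting \<open>T\<^bsub>None\<^esub>\<close> times the linear relation of \<open>w\<close> removes the square of \<open>T\<^bsub>None\<^esub>\<close>. The remaining
  relation is a syzygy \<open>y\<close> of the generators of \<open>J\<close>, given by an alternating matrix \<open>e\<close>. Subtracting
  \<open>e\<close> from the coefficients does not change the quadratic form, and afterwards every row is itself a
  linear relation.
\<close>

lemma L2_square_coeff_kernel:
  assumes F: "F \<in> L_comp a 2" and J: "square_coeff F * a $ None \<in> J"
  shows "F \<in> S1L1 a"
proof -
  obtain c where F: "F = quadratic_form c" and c: "(\<Sum>i\<in>UNIV. \<Sum>j\<in>UNIV. c i j * (a $ i * a $ j)) = 0"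
    using F by (auto simp: L_comp_2_iff)
  have "c None None * a $ None \<in> J" using J unfolding F lookup_quadratic_form_square .
  then obtain w where w: "w \<in> syzygies a" "w $ None = c None None" using syzygy_of_last by blast
  define c' where "c' i j = c i j - (if i = None then 1 else 0) * w $ j" for i j
  have c'N: "c' None None = 0" by (simp add: c'_def w)
  have c': "(\<Sum>i\<in>UNIV. \<Sum>j\<in>UNIV. c' i j * (a $ i * a $ j)) = 0"
  proof -
    have "(\<Sum>i\<in>UNIV. \<Sum>j\<in>UNIV. c' i j * (a $ i * a $ j))
      = (\<Sum>i\<in>UNIV. (\<Sum>j\<in>UNIV. c i j * (a $ i * a $ j)) - (if i = None then a $ None * (\<Sum>j\<in>UNIV. w $ j * a $ j) else 0))"
    proof (rule sum.cong[OF refl])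
      fix i :: "'n option"
      show "(\<Sum>j\<in>UNIV. c' i j * (a $ i * a $ j)) = (\<Sum>j\<in>UNIV. c i j * (a $ i * a $ j)) - (if i = None then a $ None * (\<Sum>j\<in>UNIV. w $ j * a $ j) else 0)"
        by (cases i) (simp_all add: c'_def left_diff_distrib right_diff_distrib sum_subtractf sum_distrib_left mult.left_commute)
    qed
    also have "\<dots> = (\<Sum>i\<in>UNIV. \<Sum>j\<in>UNIV. c i j * (a $ i * a $ j)) - a $ None * (\<Sum>j\<in>UNIV. w $ j * a $ j)"
      by (simp add: sum_subtractf)
    finally show ?thesis using c w(1) by (simp add: syzygies_def)
  qed
  define y where "y j = (\<Sum>l\<in>UNIV. c' (Some j) l * a $ l) + c' None (Some j) * a $ None" for j
  have "(\<Sum>j\<in>UNIV. y j * a $ Some j) = 0"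
    using c' unfolding relation_sum_split c'N y_def by simp
  from koszul[OF this] obtain e where e: "\<And>i j. e i j = - e j i" "\<And>i. e i i = 0" "\<And>i. y i = (\<Sum>j\<in>UNIV. e i j * a $ Some j)"
    by blast
  define z where "z j = (\<chi> i. case i of None \<Rightarrow> c' (Some j) None + c' None (Some j)
     | Some l \<Rightarrow> c' (Some j) (Some l) - e j l)" for j
  have z: "z j \<in> syzygies a" for j
  proof -
    have "y j = (c' (Some j) None + c' None (Some j)) * a $ None + (\<Sum>l\<in>UNIV. c' (Some j) (Some l) * a $ Some l)"
      unfolding y_def sum_UNIV_option[of "\<lambda>l. c' (Some j) l * a $ l"] by (simp add: distrib_right)
    then show ?thesis
      unfolding syzygy_iff z_def using e(3)[of j] by (simp add: left_diff_distrib sum_subtractf)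
  qed
  have "quadratic_form c = quadratic_form (\<lambda>i j. (if i = None then 1 else 0) * w $ j) + quadratic_form c'"
    by (simp add: quadratic_form_add c'_def)
  moreover have "quadratic_form c' = (\<Sum>p\<in>UNIV. quadratic_form (\<lambda>i j. (if i = Some p then 1 else 0) * z p $ j))"
  proof -
    have "c' i j - (\<Sum>p\<in>UNIV. (if i = Some p then 1 else 0) * z p $ j)
       = (case i of None \<Rightarrow> (case j of None \<Rightarrow> 0 | Some l \<Rightarrow> c' None (Some l))
          | Some p \<Rightarrow> (case j of None \<Rightarrow> - c' None (Some p) | Some l \<Rightarrow> e p l))" for i j
    proof (cases i)
      case None
      then show ?thesis by (cases j) (simp_all add: c'N)
    next
      case (Some q)
      have "(\<Sum>p\<in>UNIV. (if q = p then 1 else 0) * z p $ j) = (\<Sum>p\<in>UNIV. if q = p then z p $ j else 0)"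
        by (rule sum.cong) auto
      then show ?thesis by (cases j) (simp_all add: Some z_def)
    qed
    moreover have "quadratic_form (\<lambda>i j. (case i of None \<Rightarrow> (case j of None \<Rightarrow> 0 | Some l \<Rightarrow> c' None (Some l))
          | Some p \<Rightarrow> (case j of None \<Rightarrow> - c' None (Some p) | Some l \<Rightarrow> e p l))) = 0" (is "quadratic_form ?d = 0")
    proof (rule quadratic_form_alternating)
      show "?d i j = - ?d j i" for i j by (cases i; cases j) (simp_all, rule e(1))
      show "?d i i = 0" for i using e(2) by (simp split: option.split)
    qed
    ultimately have "quadratic_form c' - quadratic_form (\<lambda>i j. \<Sum>p\<in>UNIV. (if i = Some p then 1 else 0) * z p $ j) = 0"
      unfolding quadratic_form_diff by simp
    then show ?thesis by (simp add: quadratic_form_sum)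
  qed
  ultimately show ?thesis
    unfolding F
    by (simp only:) (intro S_module.subspace_add[OF subspace_S1L1] S_module.subspace_sum[OF subspace_S1L1] variable_times_L1_in_S1L1 w(1) z)
qed

theorem nu_L2_mod_S1L1:
  "nu const_scale (L_comp a 2) (S1L1 a) = nu (*) (colon J (syzygy_entries_ideal a)) J"
proof (rule nu_iso[OF module_hom_square_coeff[of "single None 1 + single None 1" "a $ None"]])
  fix F assume "F \<in> L_comp a 2"
  then show "square_coeff F * a $ None \<in> J \<longleftrightarrow> F \<in> S1L1 a"
    using L2_square_coeff_kernel S1L1_square_coeff by blast
qed (fact subspace_L_comp subspace_S1L1 ideal_J is_ideal_colon[OF ideal_J] L2_square_coeff L2_square_coeff_onto)+

end

section \<open>Homogeneous parts and powers of the maximal ideal\<close>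

lemma homogeneous_iff: "homogeneous e p \<longleftrightarrow> (\<forall>m\<in>keys p. exponent_degree m = e)"
  by (simp add: homogeneous_def exponent_degree_def)

lemma homogeneous_mult:
  fixes p q :: "('v::finite, 'b::comm_ring_1) mpoly"
  assumes "homogeneous d p" "homogeneous e q" shows "homogeneous (d + e) (p * q)"
  unfolding homogeneous_iff
proof
  fix m assume "m \<in> keys (p * q)"
  then obtain k l where "m = k + l" "k \<in> keys p" "l \<in> keys q"
    using keys_mult[of p q] by blast
  then show "exponent_degree m = d + e"
    using assms by (simp add: homogeneous_iff exponent_degree_add)
qed

definition homogeneous_part :: "nat \<Rightarrow> ('v::finite, 'b::comm_ring_1) mpoly \<Rightarrow> ('v, 'b) mpoly"
  where "homogeneous_part e p =
    (\<Sum>m\<in>{m \<in> keys p. exponent_degree m = e}. single m (lookup p m))"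

lemma lookup_homogeneous_part:
  "lookup (homogeneous_part e p) m = (if exponent_degree m = e then lookup p m else 0)"
proof -
  have "lookup (homogeneous_part e p) m
    = (\<Sum>l\<in>{l \<in> keys p. exponent_degree l = e}. if l = m then lookup p l else 0)"
    unfolding homogeneous_part_def lookup_sum by (rule sum.cong) (auto simp: lookup_single when_def)
  then show ?thesis by (auto simp: in_keys_iff)
qed

lemma homogeneous_homogeneous_part: "homogeneous e (homogeneous_part e p)"
  by (auto simp: homogeneous_iff in_keys_iff lookup_homogeneous_part split: if_splits)

lemma homogeneous_part_add: "homogeneous_part e (p + q) = homogeneous_part e p + homogeneous_part e q"
  by (rule poly_mapping_eqI) (simp add: lookup_homogeneous_part lookup_add)

lemma homogeneous_part_diff: "homogeneous_part e (p - q) = homogeneous_part e p - homogeneous_part e q"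
  by (rule poly_mapping_eqI) (simp add: lookup_homogeneous_part lookup_minus)

lemma homogeneous_part_0 [simp]: "homogeneous_part e 0 = 0"
  by (rule poly_mapping_eqI) (simp add: lookup_homogeneous_part)

lemma homogeneous_part_sum: "homogeneous_part e (sum p A) = (\<Sum>x\<in>A. homogeneous_part e (p x))"
  by (induction A rule: infinite_finite_induct) (simp_all add: homogeneous_part_add)

lemma homogeneous_part_homogeneous:
  assumes "homogeneous d p" shows "homogeneous_part e p = (if d = e then p else 0)"
  using assms
  by (intro poly_mapping_eqI) (auto simp: lookup_homogeneous_part homogeneous_iff in_keys_iff)

lemma sum_homogeneous_parts:
  assumes "finite A" "exponent_degree ` keys p \<subseteq> A"
  shows "(\<Sum>e\<in>A. homogeneous_part e p) = p"
proof (rule poly_mapping_eqI)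
  fix m
  have "lookup (\<Sum>e\<in>A. homogeneous_part e p) m = (\<Sum>e\<in>A. if exponent_degree m = e then lookup p m else 0)"
    by (simp add: lookup_sum lookup_homogeneous_part)
  also have "\<dots> = lookup p m"
    using assms by (cases "m \<in> keys p") (auto simp: not_in_keys_iff_lookup_eq_zero)
  finally show "lookup (\<Sum>e\<in>A. homogeneous_part e p) m = lookup p m" .
qed

lemma homogeneous_part_mult_homogeneous:
  fixes p q :: "('v::finite, 'b::comm_ring_1) mpoly"
  assumes q: "homogeneous n q"
  shows "homogeneous_part e (p * q) = (if n \<le> e then homogeneous_part (e - n) p * q else 0)"
proof -
  define A where "A = insert (e - n) (exponent_degree ` keys p)"
  have A: "finite A" by (simp add: A_def)
  have "homogeneous_part e (p * q) = homogeneous_part e ((\<Sum>d\<in>A. homogeneous_part d p) * q)"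
    by (subst sum_homogeneous_parts) (auto simp: A_def)
  also have "\<dots> = (\<Sum>d\<in>A. homogeneous_part e (homogeneous_part d p * q))"
    by (simp add: sum_distrib_right homogeneous_part_sum)
  also have "\<dots> = (\<Sum>d\<in>A. if d + n = e then homogeneous_part d p * q else 0)"
    by (intro sum.cong refl homogeneous_part_homogeneous homogeneous_mult homogeneous_homogeneous_part q)
  also have "\<dots> = (\<Sum>d\<in>A. if d = e - n then (if n \<le> e then homogeneous_part d p * q else 0) else 0)"
    by (rule sum.cong) auto
  also have "\<dots> = (if n \<le> e then homogeneous_part (e - n) p * q else 0)"
    using A by (simp add: A_def)
  finally show ?thesis .
qed

lemma homogeneous_part_ideal:
  fixes f :: "'i::finite \<Rightarrow> ('v::finite, 'b::comm_ring_1) mpoly"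
  assumes f: "\<And>i. homogeneous n (f i)" and p: "p \<in> ideal_gen (range f)"
  shows "homogeneous_part e p \<in> ideal_gen (range f)"
proof -
  obtain c where p: "p = (\<Sum>i\<in>UNIV. c i * f i)" using p by (auto simp: ideal_gen_range_iff)
  show ?thesis
    unfolding p homogeneous_part_sum homogeneous_part_mult_homogeneous[OF f]
    by (intro ideal.span_sum) (auto intro: ideal.span_scale ideal.span_base ideal.span_zero)
qed

text \<open>
  For \<open>E = {}\<close> this says that a polynomial lies in \<open>J\<close> if all its homogeneous parts do.
\<close>

lemma ideal_member_by_parts:
  fixes p :: "('v::finite, 'b::comm_ring_1) mpoly"
  assumes J: "is_ideal J" and E: "finite E" and "\<And>e. e \<notin> E \<Longrightarrow> homogeneous_part e p \<in> J"
  shows "p - (\<Sum>e\<in>E. homogeneous_part e p) \<in> J"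
proof -
  define A where "A = E \<union> exponent_degree ` keys p"
  have "p = (\<Sum>e\<in>A. homogeneous_part e p)"
    using E by (subst sum_homogeneous_parts) (auto simp: A_def)
  also have "\<dots> = (\<Sum>e\<in>E. homogeneous_part e p) + (\<Sum>e\<in>A - E. homogeneous_part e p)"
    using E by (subst sum.subset_diff[of E]) (auto simp: A_def add.commute)
  finally have "p - (\<Sum>e\<in>E. homogeneous_part e p) = (\<Sum>e\<in>A - E. homogeneous_part e p)"
    by (simp add: algebra_simps)
  also have "\<dots> \<in> J" by (rule ideal.subspace_sum[OF J]) (use assms(3) in auto)
  finally show ?thesis .
qed

text \<open>
  The power of the maximal ideal with exponent \<open>s\<close>, see \<open>max_ideal_pow\<close>.
\<close>

definition order_ideal :: "nat \<Rightarrow> ('v::finite, 'b::comm_ring_1) mpoly set"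
  where "order_ideal s = {p. \<forall>m\<in>keys p. s \<le> exponent_degree m}"

lemma order_ideal_mult:
  assumes "p \<in> order_ideal s" "q \<in> order_ideal t" shows "p * q \<in> order_ideal (s + t)"
  unfolding order_ideal_def
proof (intro CollectI ballI)
  fix m assume "m \<in> keys (p * q)"
  then obtain k l where kl: "m = k + l" "k \<in> keys p" "l \<in> keys q"
    using keys_mult[of p q] by blast
  then have "s \<le> exponent_degree k" "t \<le> exponent_degree l" using assms by (auto simp: order_ideal_def)
  then show "s + t \<le> exponent_degree m" by (simp add: kl exponent_degree_add)
qed

lemma order_ideal_0 [simp]: "order_ideal 0 = UNIV"
  by (simp add: order_ideal_def)

lemma is_ideal_order_ideal: "is_ideal (order_ideal s :: ('v::finite, 'b::comm_ring_1) mpoly set)"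
proof (rule ideal.subspaceI)
  show "0 \<in> order_ideal s" by (simp add: order_ideal_def)
  show "p + q \<in> order_ideal s" if "p \<in> order_ideal s" "q \<in> order_ideal s" for p q :: "('v, 'b) mpoly"
    using that keys_add[of p q] by (auto simp: order_ideal_def)
  show "c * p \<in> order_ideal s" if "p \<in> order_ideal s" for c p :: "('v, 'b) mpoly"
    using order_ideal_mult[of c 0 p s] that by simp
qed

lemma var_in_order_ideal: "var i \<in> order_ideal 1"
  by (simp add: order_ideal_def var_def del: One_nat_def)

lemma homogeneous_in_order_ideal: "homogeneous e p \<Longrightarrow> s \<le> e \<Longrightarrow> p \<in> order_ideal s"
  by (auto simp: homogeneous_iff order_ideal_def)

lemma homogeneous_part_order_ideal: "p \<in> order_ideal s \<Longrightarrow> homogeneous_part e p \<in> order_ideal s"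
  by (auto simp: order_ideal_def in_keys_iff lookup_homogeneous_part split: if_splits)

lemma max_ideal_pow: "ideal_pow max_ideal s = (order_ideal s :: ('v::finite, 'b::comm_ring_1) mpoly set)"
proof (induction s)
  case 0 show ?case by simp
next
  case (Suc s)
  have max: "max_ideal \<subseteq> (order_ideal 1 :: ('v, 'b) mpoly set)"
    unfolding max_ideal_def by (rule ideal.span_minimal[OF _ is_ideal_order_ideal]) (use var_in_order_ideal in blast)
  have "ideal_prod max_ideal (order_ideal s) \<subseteq> (order_ideal (Suc s) :: ('v, 'b) mpoly set)"
    unfolding ideal_prod_def
  proof (rule ideal.span_minimal[OF _ is_ideal_order_ideal], clarify)
    fix x y :: "('v, 'b) mpoly" assume "x \<in> max_ideal" "y \<in> order_ideal s"
    then show "x * y \<in> order_ideal (Suc s)" using max order_ideal_mult[of x 1 y s] by auto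
  qed
  moreover have "order_ideal (Suc s) \<subseteq> (ideal_prod max_ideal (order_ideal s) :: ('v, 'b) mpoly set)"
  proof
    fix p :: "('v, 'b) mpoly" assume p: "p \<in> order_ideal (Suc s)"
    have "single m (lookup p m) \<in> ideal_prod max_ideal (order_ideal s)"
      if m: "m \<in> keys p" for m
    proof -
      have deg: "Suc s \<le> exponent_degree m" using p m by (auto simp: order_ideal_def)
      then have "m \<noteq> 0" by auto
      then obtain i l where il: "m = single i 1 + l" by (rule exponent_nonzero_split)
      then have "single l (lookup p m) \<in> (order_ideal s :: ('v, 'b) mpoly set)"
        using deg by (auto simp: order_ideal_def exponent_degree_add)
      moreover have "var i \<in> (max_ideal :: ('v, 'b) mpoly set)" unfolding max_ideal_def by (rule ideal.span_base) simp
      moreover have "single m (lookup p m) = var i * single l (lookup p m)"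
        by (subst (1) il) (simp add: var_def mult_single)
      ultimately show ?thesis unfolding ideal_prod_def by (intro ideal.span_base) blast
    qed
    then show "p \<in> ideal_prod max_ideal (order_ideal s)"
      by (subst mpoly_sum_monomials) (auto simp: ideal_prod_def intro!: ideal.span_sum)
  qed
  ultimately show ?case using Suc by simp
qed

lemma colon_order_ideal:
  assumes "s \<ge> 1"
  shows "colon (order_ideal s) max_ideal = (order_ideal (s - 1) :: ('v::finite, 'b::comm_ring_1) mpoly set)"
proof
  show "colon (order_ideal s) max_ideal \<subseteq> (order_ideal (s - 1) :: ('v, 'b) mpoly set)"
  proof
    fix p :: "('v, 'b) mpoly" assume p: "p \<in> colon (order_ideal s) max_ideal"
    obtain i :: 'v where True by blast
    have "var i * p \<in> order_ideal s"
      using p unfolding max_ideal_def colon_span[OF is_ideal_order_ideal] by (simp add: mult.commute[of "var i"])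
    then have "s \<le> exponent_degree (single i 1 + m)" if "m \<in> keys p" for m
      using that unfolding order_ideal_def var_def by (auto simp: in_keys_iff lookup_single_mult simp del: One_nat_def)
    then show "p \<in> order_ideal (s - 1)"
      by (force simp: order_ideal_def exponent_degree_add)
  qed
  show "order_ideal (s - 1) \<subseteq> (colon (order_ideal s) max_ideal :: ('v, 'b) mpoly set)"
  proof
    fix p :: "('v, 'b) mpoly" assume p: "p \<in> order_ideal (s - 1)"
    have "p * var i \<in> order_ideal s" for i
      using order_ideal_mult[OF p var_in_order_ideal, of i] assms by simp
    then show "p \<in> colon (order_ideal s) max_ideal"
      unfolding max_ideal_def colon_span[OF is_ideal_order_ideal] by auto
  qed
qed

lemma finite_exponents_of_degree: "finite {m :: 'v::finite \<Rightarrow>\<^sub>0 nat. exponent_degree m = e}"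
proof (rule finite_subset)
  show "{m :: 'v \<Rightarrow>\<^sub>0 nat. exponent_degree m = e} \<subseteq> {m. \<forall>i. lookup m i < Suc e}"
  proof clarify
    fix m :: "'v \<Rightarrow>\<^sub>0 nat" and i
    have "lookup m i \<le> exponent_degree m" unfolding exponent_degree_def by (rule member_le_sum) auto
    then show "lookup m i < Suc (exponent_degree m)" by simp
  qed
qed (rule finite_box)

text \<open>
  Exponent vectors of degree \<open>e\<close> are the same as multisets of \<open>e\<close> variables.
\<close>

lemma card_exponents_of_degree:
  "card {m :: 'v::finite \<Rightarrow>\<^sub>0 nat. exponent_degree m = e} = (CARD('v) + e - 1) choose e"
proof -
  have "bij_betw (\<lambda>m. Abs_multiset (lookup m)) {m :: 'v \<Rightarrow>\<^sub>0 nat. exponent_degree m = e} (multisets_of_size UNIV e)"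
  proof (rule bij_betw_byWitness[where f' = "\<lambda>X. Abs_poly_mapping (count X)"])
    show "\<forall>m\<in>{m :: 'v \<Rightarrow>\<^sub>0 nat. exponent_degree m = e}. Abs_poly_mapping (count (Abs_multiset (lookup m))) = m"
      by (auto intro!: poly_mapping_eqI)
    show "\<forall>X\<in>multisets_of_size UNIV e. Abs_multiset (lookup (Abs_poly_mapping (count X))) = (X :: 'v multiset)"
      by (auto intro!: multiset_eqI)
    have size: "size X = (\<Sum>i\<in>UNIV. count X i)" for X :: "'v multiset"
      unfolding size_multiset_overloaded_eq by (rule sum.mono_neutral_left) (auto simp: not_in_iff)
    show "(\<lambda>m. Abs_multiset (lookup m)) ` {m :: 'v \<Rightarrow>\<^sub>0 nat. exponent_degree m = e} \<subseteq> multisets_of_size UNIV e"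
      by (auto simp: multisets_of_size_def size exponent_degree_def)
    show "(\<lambda>X. Abs_poly_mapping (count X)) ` multisets_of_size UNIV e \<subseteq> {m :: 'v \<Rightarrow>\<^sub>0 nat. exponent_degree m = e}"
      by (auto simp: multisets_of_size_def size exponent_degree_def)
  qed
  then show ?thesis by (simp add: bij_betw_same_card card_multisets_of_size)
qed

text \<open>
  The monomials of degree \<open>e\<close> are a basis over the field of a quotient on which the maximal ideal acts
  as zero.
\<close>

lemma nu_order_ideal:
  "nu (*) (order_ideal e) (order_ideal (Suc e) :: ('v::finite, 'k::field) mpoly set)
    = enat ((CARD('v) + e - 1) choose e)"
proof -
  define E where "E = {m :: 'v \<Rightarrow>\<^sub>0 nat. exponent_degree m = e}"
  have "finite E" unfolding E_def by (rule finite_exponents_of_degree)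
  then obtain h where h: "bij_betw h {..<card E} E"
    using ex_bij_betw_nat_finite[of E] by (auto simp: atLeast0LessThan)
  define v where "v i = (single (h i) 1 :: ('v, 'k) mpoly)" for i
  have hE: "exponent_degree (h i) = e" if "i < card E" for i using h that by (auto simp: bij_betw_def E_def)
  have coeff_v: "lookup (\<Sum>i<card E. const_scale (c i) (v i)) (h j) = c j" if "j < card E" for c j
  proof -
    have "h i = h j \<longleftrightarrow> i = j" if "i < card E" for i
      using h that \<open>j < card E\<close> by (auto simp: bij_betw_def inj_on_def)
    then have "lookup (\<Sum>i<card E. const_scale (c i) (v i)) (h j) = (\<Sum>i<card E. if i = j then c i else 0)"
      unfolding lookup_sum lookup_const_scale v_def by (intro sum.cong) (auto simp: lookup_single when_def)
    then show ?thesis using that by simp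
  qed
  have coeff_0: "lookup (\<Sum>i<card E. const_scale (c i) (v i)) m = 0" if "exponent_degree m \<noteq> e" for c m
    unfolding lookup_sum lookup_const_scale v_def
    by (rule sum.neutral) (use hE that in \<open>auto simp: lookup_single when_def\<close>)
  have v: "v i \<in> order_ideal e" if "i < card E" for i
    using hE[OF that] by (simp add: v_def order_ideal_def)
  have "nu (*) (order_ideal e) (order_ideal (Suc e) :: ('v, 'k) mpoly set) = enat (card E)"
  proof (rule ideal.nu_eqI[OF is_ideal_order_ideal is_ideal_order_ideal])
    show "generated_mod (*) (order_ideal e) (order_ideal (Suc e) :: ('v, 'k) mpoly set) (card E)"
      unfolding generated_mod_def
    proof (rule exI[of _ v], intro conjI allI impI ballI v)
      fix p :: "('v, 'k) mpoly" assume p: "p \<in> order_ideal e"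
      have "p - (\<Sum>i<card E. const_scale (lookup p (h i)) (v i)) \<in> order_ideal (Suc e)"
        unfolding order_ideal_def
      proof (intro CollectI ballI, rule ccontr)
        fix m assume m: "m \<in> keys (p - (\<Sum>i<card E. const_scale (lookup p (h i)) (v i)))"
          "\<not> Suc e \<le> exponent_degree m"
        show False
        proof (cases "exponent_degree m = e")
          case True
          then obtain j where "j < card E" "m = h j" using h by (auto simp: bij_betw_def E_def)
          then show False using m(1) coeff_v[of j] by (simp add: in_keys_iff lookup_minus)
        next
          case False
          then have "m \<in> keys p" using m(1) coeff_0[OF False] by (simp add: in_keys_iff lookup_minus)
          then have "e \<le> exponent_degree m" using p by (simp add: order_ideal_def)
          then show False using m(2) False by simp
        qed
      qed
      then show "\<exists>c. p - (\<Sum>i<card E. c i * v i) \<in> order_ideal (Suc e)"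
        unfolding const_scale_def by (intro exI[of _ "\<lambda>i. single 0 (lookup p (h i))"])
    qed
    fix q assume gen: "generated_mod (*) (order_ideal e) (order_ideal (Suc e) :: ('v, 'k) mpoly set) q"
    show "card E \<le> q"
    proof (rule independent_mod_le_generated_mod[OF is_ideal_order_ideal is_ideal_imp_coeff_subspace[OF is_ideal_order_ideal] order_refl _ _ v gen])
      show "var i * x \<in> order_ideal (Suc e)" if "x \<in> order_ideal e" for i and x :: "('v, 'k) mpoly"
        using order_ideal_mult[OF var_in_order_ideal that] by simp
      show "independent_mod (order_ideal (Suc e)) (card E) v"
        unfolding independent_mod_def
      proof (intro allI impI)
        fix c j assume c: "(\<Sum>i<card E. const_scale (c i) (v i)) \<in> order_ideal (Suc e)" and j: "j < card E"
        have "h j \<notin> keys (\<Sum>i<card E. const_scale (c i) (v i))"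
          using c hE[OF j] by (auto simp: order_ideal_def)
        then show "c j = 0" using coeff_v[OF j] by (simp add: in_keys_iff)
      qed
    qed
  qed
  then show ?thesis by (simp add: E_def card_exponents_of_degree)
qed

section \<open>The first Koszul homology\<close>

lemma coset_eq_of_mem:
  assumes "module.subspace smul N" "module smul" "z \<in> x +o N" shows "x +o N = z +o N"
proof -
  interpret module smul by fact
  have "z - x \<in> N" using assms(3) by (simp add: mem_coset)
  then have "x - z \<in> N" using subspace_neg[OF assms(1), of "z - x"] by simp
  then show ?thesis by (simp add: coset_eq_iff[OF assms(1)])
qed

lemma ideal_times_free_module:
  fixes I :: "'a::comm_ring_1 set"
  assumes I: "is_ideal I"
  shows "module.span (*s) {r *s v |r (v :: 'a ^ 'g). r \<in> I} = {z. \<forall>i. z $ i \<in> I}"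
proof
  have I': "r * c \<in> I" if "r \<in> I" for r c
    using ideal.subspace_scale[OF I that, of c] by (simp add: mult.commute)
  have "syz_module.subspace {z :: 'a ^ 'g. \<forall>i. z $ i \<in> I}"
    by (rule syz_module.subspaceI)
       (simp_all add: ideal.subspace_0[OF I] ideal.subspace_add[OF I] ideal.subspace_scale[OF I])
  then show "module.span (*s) {r *s v |r (v :: 'a ^ 'g). r \<in> I} \<subseteq> {z. \<forall>i. z $ i \<in> I}"
    by (rule syz_module.span_minimal[rotated])
       (auto intro: I')
  show "{z. \<forall>i. z $ i \<in> I} \<subseteq> module.span (*s) {r *s v |r (v :: 'a ^ 'g). r \<in> I}"
  proof clarify
    fix z :: "'a ^ 'g" assume "\<forall>i. z $ i \<in> I"
    then have "(\<Sum>i\<in>UNIV. z $ i *s axis i 1) \<in> module.span (*s) {r *s v |r (v :: 'a ^ 'g). r \<in> I}"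
      by (intro syz_module.span_sum syz_module.span_base) blast
    then show "z \<in> module.span (*s) {r *s v |r (v :: 'a ^ 'g). r \<in> I}"
      by (simp add: basis_expansion)
  qed
qed

lemma H1_component_iff:
  "C \<in> H1_component a e \<longleftrightarrow> (\<exists>z\<in>syzygies a. homogeneous_vec e z \<and> C = z +o koszul_relations a)"
proof
  assume C: "C \<in> H1_component a e"
  then obtain z' z where z: "z' \<in> syzygies a" "C = z' +o koszul_relations a" "z \<in> C" "homogeneous_vec e z"
    by (auto simp: H1_component_def H1_def quot_def)
  have "z - z' \<in> syzygies a" using z koszul_relations_subset_syzygies[of a] by (auto simp: mem_coset)
  from syz_module.subspace_add[OF subspace_syzygies this z(1)] have "z \<in> syzygies a" by simp
  moreover have "C = z +o koszul_relations a"
    using coset_eq_of_mem[OF subspace_koszul_relations module_vec] z(2,3) by blast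
  ultimately show "\<exists>z\<in>syzygies a. homogeneous_vec e z \<and> C = z +o koszul_relations a" using z(4) by blast
next
  assume "\<exists>z\<in>syzygies a. homogeneous_vec e z \<and> C = z +o koszul_relations a"
  then obtain z where z: "z \<in> syzygies a" "homogeneous_vec e z" "C = z +o koszul_relations a" by blast
  moreover have "z \<in> z +o koszul_relations a"
    using syz_module.subspace_0[OF subspace_koszul_relations] by (simp add: mem_coset)
  ultimately show "C \<in> H1_component a e" by (auto simp: H1_component_def H1_def quot_def)
qed

lemma homogeneous_0 [simp]: "homogeneous e 0"
  by (simp add: homogeneous_def)

lemma zero_coset_in_H1_component: "koszul_relations a \<in> H1_component a e"
proof -
  have "koszul_relations a = 0 +o koszul_relations a" by (simp add: syz_module.coset_zero)
  then show ?thesis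
    unfolding H1_component_iff using syz_module.subspace_0[OF subspace_syzygies]
    by (intro bexI[of _ 0]) (simp_all add: homogeneous_vec_def)
qed

lemma homogeneous_part_const_scale:
  "homogeneous_part e (const_scale c p) = const_scale c (homogeneous_part e p)"
  by (rule poly_mapping_eqI) (simp add: lookup_const_scale lookup_homogeneous_part)

locale graded_almost_complete_intersection =
  almost_complete_intersection a I J + gorenstein_form J \<psi> N
  for a :: "('n::finite, 'k::field) mpoly ^ ('n option)" and I J :: "('n, 'k) mpoly set"
    and \<psi> :: "('n, 'k) mpoly \<Rightarrow> 'k" and N :: nat +
  fixes n :: nat
  assumes homogeneous_generators: "\<And>i. homogeneous n (a $ i)" and proper: "1 \<notin> J"
begin

lemma homogeneous_part_J: "p \<in> J \<Longrightarrow> homogeneous_part e p \<in> J"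
  unfolding J_def by (rule homogeneous_part_ideal[of n]) (simp_all add: homogeneous_generators)

lemma J_by_parts: "(\<And>e. homogeneous_part e p \<in> J) \<Longrightarrow> p \<in> J"
  using ideal_member_by_parts[OF ideal_J, of "{}" p] by simp

definition top_degree :: nat
  where "top_degree = Max {e. \<exists>u. homogeneous e u \<and> u \<notin> J}"

lemma finite_degrees: "finite {e. \<exists>u. homogeneous e u \<and> u \<notin> J}"
proof (rule finite_subset)
  show "{e. \<exists>u. homogeneous e u \<and> u \<notin> J} \<subseteq> {..<card (UNIV :: 'n set) * N}"
  proof (rule subsetI, rule ccontr)
    fix e assume "e \<in> {e. \<exists>u. homogeneous e u \<and> u \<notin> J}" and e: "e \<notin> {..<card (UNIV :: 'n set) * N}"
    then obtain u where u: "homogeneous e u" "u \<notin> J" by blast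
    have "single m (lookup u m) \<in> J" if "m \<in> keys u" for m
      using u(1) e that box high_degree_in_box[of N m] by (auto simp: homogeneous_iff)
    then have "u \<in> J"
      by (subst mpoly_sum_monomials) (rule ideal.subspace_sum[OF ideal_J])
    then show False using u(2) by simp
  qed
qed simp

lemma top_degree_attained: "\<exists>u. homogeneous top_degree u \<and> u \<notin> J"
proof -
  have "homogeneous 0 (1 :: ('n, 'k) mpoly)" by (simp add: homogeneous_def)
  then have "{e. \<exists>u. homogeneous e u \<and> u \<notin> J} \<noteq> {}" using proper by blast
  from Max_in[OF finite_degrees this] show ?thesis unfolding top_degree_def by simp
qed

lemma above_top_degree:
  assumes "homogeneous e u" "top_degree < e" shows "u \<in> J"
proof (rule ccontr)
  assume "u \<notin> J"
  then have "e \<le> top_degree" unfolding top_degree_def using assms(1) by (intro Max_ge[OF finite_degrees]) blast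
  then show False using assms(2) by simp
qed

lemma order_ideal_above_top_degree: "order_ideal (Suc top_degree) \<subseteq> J"
proof
  fix p :: "('n, 'k) mpoly" assume p: "p \<in> order_ideal (Suc top_degree)"
  have "homogeneous_part e p \<in> J" for e
  proof (cases "top_degree < e")
    case True then show ?thesis by (rule above_top_degree[OF homogeneous_homogeneous_part])
  next
    case False
    then have "homogeneous_part e p = 0"
      using p by (intro poly_mapping_eqI)
        (force simp: lookup_homogeneous_part order_ideal_def simp flip: not_in_keys_iff_lookup_eq_zero)
    then show ?thesis using mem_J_iff[of 0] psi_linear by simp
  qed
  then show "p \<in> J" by (rule J_by_parts)
qed

text \<open>
  As the generators have the same degree, the homogeneous parts of degree \<open>e\<close> of the entries of a syzygy
  form a syzygy again.
\<close>

lemma homogeneous_syzygy_of_last: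
  assumes u: "homogeneous e u" and "u * a $ None \<in> J"
  shows "\<exists>z\<in>syzygies a. z $ None = u \<and> homogeneous_vec e z"
proof -
  obtain z where z: "z \<in> syzygies a" "z $ None = u" using syzygy_of_last[OF assms(2)] by blast
  define z' where "z' = (\<chi> i. homogeneous_part e (z $ i))"
  have "(\<Sum>i\<in>UNIV. z' $ i * a $ i) = homogeneous_part (e + n) (\<Sum>i\<in>UNIV. z $ i * a $ i)"
    by (simp add: z'_def homogeneous_part_sum homogeneous_part_mult_homogeneous[OF homogeneous_generators])
  then have "z' \<in> syzygies a" using z(1) by (simp add: syzygies_def)
  moreover have "z' $ None = u" using u by (simp add: z'_def z(2) homogeneous_part_homogeneous)
  moreover have "homogeneous_vec e z'" by (simp add: homogeneous_vec_def z'_def homogeneous_homogeneous_part)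
  ultimately show ?thesis by blast
qed

text \<open>
  On a socle element a polynomial acts through its constant term, so \<open>\<psi>\<close> alone decides membership in
  \<open>J\<close>: the socle of the quotient by \<open>J\<close> is at most one-dimensional.
\<close>

lemma psi_socle:
  assumes "\<And>i. var i * y \<in> J"
  shows "y \<in> J \<longleftrightarrow> \<psi> y = 0"
proof
  assume y: "\<psi> y = 0"
  have soc: "y \<in> colon J max_ideal"
    unfolding max_ideal_def colon_span[OF ideal_J] using assms by (auto simp: mult.commute)
  show "y \<in> J"
    unfolding mem_J_iff
  proof
    fix p
    have "p * y - const_scale (lookup p 0) y \<in> J"
    proof (rule mult_minus_constant_term[OF is_ideal_colon[OF ideal_J] is_ideal_imp_coeff_subspace[OF ideal_J] _ soc])
      fix i x assume "x \<in> colon J max_ideal"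
      then show "var i * x \<in> J"
        unfolding max_ideal_def colon_span[OF ideal_J] by (auto simp: mult.commute)
    qed
    from psi_J[OF this] show "\<psi> (p * y) = 0" by (simp add: psi_linear y)
  qed
qed (rule psi_J)

text \<open>
  A form of degree \<open>top_degree\<close> outside \<open>J\<close> represents a nonzero socle element. Two socle elements are
  proportional modulo \<open>J\<close>, and forms of different degrees outside the homogeneous ideal \<open>J\<close> are not.
\<close>

lemma homogeneous_socle_degree:
  assumes y: "homogeneous d y" and d: "d < top_degree" and soc: "\<And>i. var i * y \<in> J"
  shows "y \<in> J"
proof (rule ccontr)
  assume yJ: "y \<notin> J"
  obtain u where u: "homogeneous top_degree u" "u \<notin> J" using top_degree_attained by blast
  have usoc: "var i * u \<in> J" for i
  proof -
    have "var i * u \<in> order_ideal (1 + top_degree)"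
      by (rule order_ideal_mult[OF var_in_order_ideal homogeneous_in_order_ideal[OF u(1) order_refl]])
    then show ?thesis using order_ideal_above_top_degree by auto
  qed
  define x where "x = const_scale (\<psi> u) y - const_scale (\<psi> y) u"
  have "var i * x \<in> J" for i
    unfolding x_def right_diff_distrib const_scale_mult
    by (intro ideal.subspace_diff[OF ideal_J] coeff.subspace_scale[OF is_ideal_imp_coeff_subspace[OF ideal_J]] soc usoc)
  moreover have "\<psi> x = 0" by (simp add: x_def psi_linear)
  ultimately have "x \<in> J" using psi_socle by blast
  then have "homogeneous_part top_degree x \<in> J" by (rule homogeneous_part_J)
  also have "homogeneous_part top_degree x = const_scale (- \<psi> y) u"
    using d homogeneous_part_homogeneous[OF y, of top_degree] homogeneous_part_homogeneous[OF u(1), of top_degree]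
    unfolding x_def homogeneous_part_diff homogeneous_part_const_scale by simp
  finally have "const_scale (inverse (- \<psi> y)) (const_scale (- \<psi> y) u) \<in> J"
    by (rule coeff.subspace_scale[OF is_ideal_imp_coeff_subspace[OF ideal_J]])
  moreover have "\<psi> y \<noteq> 0" using psi_socle[OF soc] yJ by blast
  ultimately show False using u(2) by (simp add: coeff.scale_scale)
qed

text \<open>
  Take the least \<open>q\<close> such that the \<open>q\<close>-th power of the maximal ideal multiplies \<open>v\<close> into \<open>J\<close>. If \<open>v\<close>
  were not in \<open>J\<close>, some form of degree \<open>q - 1 < s\<close> would multiply \<open>v\<close> to a socle element outside \<open>J\<close>, whose
  degree would be too small.
\<close>

lemma homogeneous_annihilated_by_power:
  assumes v: "homogeneous e v" and ann: "v \<in> colon J (order_ideal s)" and e: "e + s \<le> top_degree"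
  shows "v \<in> J"
proof (rule ccontr)
  assume vJ: "v \<notin> J"
  define q where "q = (LEAST q. v \<in> colon J (order_ideal q))"
  have q: "v \<in> colon J (order_ideal q)" "q \<le> s"
    unfolding q_def using ann by (auto intro: LeastI Least_le)
  have "q \<noteq> 0"
  proof
    assume "q = 0"
    then have "v * 1 \<in> J" using q(1) by (simp add: colon_def del: mult_1_right)
    then show False using vJ by simp
  qed
  then have "v \<notin> colon J (order_ideal (q - 1))" unfolding q_def by (intro not_less_Least) simp
  then obtain k where k: "k \<in> order_ideal (q - 1)" "v * k \<notin> J" by (auto simp: colon_def)
  have "\<exists>i. v * homogeneous_part i k \<notin> J"
  proof (rule ccontr)
    assume "\<nexists>i. v * homogeneous_part i k \<notin> J"
    then have *: "v * homogeneous_part i k \<in> J" for i by blast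
    have "v * (\<Sum>i\<in>exponent_degree ` keys k. homogeneous_part i k) \<in> J"
      unfolding sum_distrib_left
      by (rule ideal.subspace_sum[OF ideal_J]) (rule *)
    then show False using k(2) by (simp add: sum_homogeneous_parts)
  qed
  then obtain i where i: "v * homogeneous_part i k \<notin> J" by blast
  have "i < q"
  proof (rule ccontr)
    assume "\<not> i < q"
    then have "homogeneous_part i k \<in> order_ideal q"
      by (intro homogeneous_in_order_ideal[OF homogeneous_homogeneous_part]) simp
    then show False using q(1) i by (simp add: colon_def)
  qed
  moreover have "homogeneous (e + i) (v * homogeneous_part i k)"
    by (rule homogeneous_mult[OF v homogeneous_homogeneous_part])
  moreover have "var j * (v * homogeneous_part i k) \<in> J" for j
  proof -
    have "var j * homogeneous_part i k \<in> order_ideal (1 + (q - 1))"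
      by (rule order_ideal_mult[OF var_in_order_ideal homogeneous_part_order_ideal[OF k(1)]])
    then have "v * (var j * homogeneous_part i k) \<in> J" using q(1) \<open>q \<noteq> 0\<close> by (simp add: colon_def)
    then show ?thesis by (simp add: mult.left_commute)
  qed
  ultimately show False using homogeneous_socle_degree[of "e + i"] i e q(2) by fastforce
qed

lemma homogeneous_part_colon:
  assumes "u \<in> colon J (order_ideal s)"
  shows "homogeneous_part e u \<in> colon J (order_ideal s)"
  unfolding colon_def
proof clarify
  fix k :: "('n, 'k) mpoly" assume k: "k \<in> order_ideal s"
  have *: "homogeneous_part e u * homogeneous_part i k \<in> J" for i
  proof -
    have "u * homogeneous_part i k \<in> J"
      using assms homogeneous_part_order_ideal[OF k] by (simp add: colon_def)
    then have "homogeneous_part (e + i) (u * homogeneous_part i k) \<in> J" by (rule homogeneous_part_J)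
    then show ?thesis by (simp add: homogeneous_part_mult_homogeneous[OF homogeneous_homogeneous_part])
  qed
  have "homogeneous_part e u * (\<Sum>i\<in>exponent_degree ` keys k. homogeneous_part i k) \<in> J"
    unfolding sum_distrib_left by (rule ideal.subspace_sum[OF ideal_J]) (rule *)
  then show "homogeneous_part e u * k \<in> J" by (simp add: sum_homogeneous_parts)
qed

lemma H1_top_degree:
  assumes "a $ None \<in> order_ideal 1"
  shows "H1_top_degree a top_degree"
  unfolding H1_top_degree_def
proof (intro conjI allI impI)
  obtain u where u: "homogeneous top_degree u" "u \<notin> J" using top_degree_attained by blast
  have "u * a $ None \<in> order_ideal (top_degree + 1)"
    by (rule order_ideal_mult[OF homogeneous_in_order_ideal[OF u(1) order_refl] assms])
  then have "u * a $ None \<in> J" using order_ideal_above_top_degree by auto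
  then obtain z where z: "z \<in> syzygies a" "z $ None = u" "homogeneous_vec top_degree z"
    using homogeneous_syzygy_of_last[OF u(1)] by blast
  have "z +o koszul_relations a \<in> H1_component a top_degree" unfolding H1_component_iff using z by blast
  moreover have "z +o koszul_relations a \<noteq> koszul_relations a"
  proof
    assume "z +o koszul_relations a = koszul_relations a"
    then have "z \<in> koszul_relations a"
      using syz_module.subspace_0[OF subspace_koszul_relations] by (metis cancel_comm_monoid_add_class.diff_cancel mem_coset)
    then show False using syzygy_koszul_iff[OF z(1)] z(2) u(2) by simp
  qed
  ultimately show "H1_component a top_degree \<noteq> {koszul_relations a}" by blast
next
  fix e assume e: "top_degree < e"
  have "C = koszul_relations a" if C: "C \<in> H1_component a e" for C
  proof -
    obtain z where z: "z \<in> syzygies a" "homogeneous_vec e z" "C = z +o koszul_relations a"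
      using C unfolding H1_component_iff by blast
    have "z $ None \<in> J" using z(2) e by (intro above_top_degree[of e]) (simp_all add: homogeneous_vec_def)
    then have "z \<in> koszul_relations a" using syzygy_koszul_iff[OF z(1)] by simp
    then have "C = 0 +o koszul_relations a"
      unfolding z(3) syz_module.coset_eq_iff[OF subspace_koszul_relations] by simp
    then show ?thesis by (simp add: syz_module.coset_zero)
  qed
  then show "H1_component a e = {koszul_relations a}" using zero_coset_in_H1_component by blast
qed

lemma syzygetic_module_eq:
  "syzygetic_module a = quot {z \<in> syzygies a. z $ None \<in> colon J (syzygy_entries_ideal a)} (koszul_relations a)"
proof -
  have "syzygies a \<inter> module.span (*s) {r *s v |r v. r \<in> ideal_gen (range (($) a))}
    = {z \<in> syzygies a. z $ None \<in> colon J (syzygy_entries_ideal a)}"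
    unfolding I_def[symmetric] ideal_times_free_module[OF ideal_I] using syzygy_entries_in_I_iff by blast
  then show ?thesis by (simp add: syzygetic_module_def)
qed

text \<open>
  The last entry \<open>u\<close> of a syzygy that represents an element of the syzygetic module lies in \<open>J : \<mm>\<^sup>s\<close>, and
  so do its homogeneous parts. Those of degree \<open>e\<close> with \<open>e + s \<le> top_degree\<close> or \<open>e > top_degree\<close> lie in \<open>J\<close>;
  the others are last entries of homogeneous syzygies. Conversely, a homogeneous last entry of degree above
  \<open>top_degree - s\<close> is multiplied by \<open>\<mm>\<^sup>s\<close> into degrees above \<open>top_degree\<close>, hence into \<open>J\<close>.
\<close>

theorem syzygetic_module_generated_by_top_components:
  assumes s: "s \<ge> 1" and K: "syzygy_entries_ideal a = order_ideal s"
  shows "syzygetic_module a = quot_span (*s) (koszul_relations a)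
     (\<Union>e\<in>{e. e \<le> top_degree \<and> top_degree < e + s}. H1_component a e)" (is "_ = quot_span _ _ ?X")
proof
  define Z where "Z = {z \<in> syzygies a. z $ None \<in> colon J (order_ideal s)}"
  have Z: "syz_module.subspace Z"
    unfolding Z_def using subspace_syzygies is_ideal_colon[OF ideal_J, of "order_ideal s"]
    by (auto simp: syz_module.subspace_def ideal.subspace_def)
  have syz: "syzygetic_module a = quot Z (koszul_relations a)"
    unfolding syzygetic_module_eq K Z_def ..
  have "?X \<subseteq> quot Z (koszul_relations a)"
  proof clarify
    fix C e assume e: "e \<le> top_degree" "top_degree < e + s" and "C \<in> H1_component a e"
    then obtain z where z: "z \<in> syzygies a" "homogeneous_vec e z" "C = z +o koszul_relations a"
      unfolding H1_component_iff by blast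
    have "z $ None * k \<in> J" if "k \<in> order_ideal s" for k
    proof -
      have "z $ None * k \<in> order_ideal (e + s)"
        using z(2) by (intro order_ideal_mult[OF homogeneous_in_order_ideal that]) (auto simp: homogeneous_vec_def)
      then have "z $ None * k \<in> order_ideal (Suc top_degree)" using e(2) by (force simp: order_ideal_def)
      then show ?thesis using order_ideal_above_top_degree by blast
    qed
    then have "z \<in> Z" using z(1) by (simp add: Z_def colon_def)
    then show "C \<in> quot Z (koszul_relations a)" unfolding z(3) quot_def by blast
  qed
  then show "quot_span (*s) (koszul_relations a) ?X \<subseteq> syzygetic_module a"
    unfolding syz quot_span_def using syz_module.quot_submodule_quot[OF subspace_koszul_relations Z] by blast
  show "syzygetic_module a \<subseteq> quot_span (*s) (koszul_relations a) ?X"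
    unfolding syz quot_span_def
  proof clarify
    fix C P assume C: "C \<in> quot Z (koszul_relations a)"
      and P: "quot_submodule (*s) (koszul_relations a) P" "?X \<subseteq> P"
    obtain z where z: "z \<in> syzygies a" "z $ None \<in> colon J (order_ideal s)" "C = z +o koszul_relations a"
      using C by (auto simp: quot_def Z_def)
    define E where "E = {e. e \<le> top_degree \<and> top_degree < e + s}"
    have E: "finite E" by (rule finite_subset[of _ "{..top_degree}"]) (auto simp: E_def)
    have aN: "a $ None \<in> order_ideal s"
    proof -
      have "a $ None \<in> I" unfolding I_def by (rule ideal.span_base) simp
      then show ?thesis using I_subset_entries K by blast
    qed
    have "\<exists>w\<in>syzygies a. w $ None = homogeneous_part e (z $ None) \<and> homogeneous_vec e w" for e
      using homogeneous_part_colon[OF z(2), of e] aN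
      by (intro homogeneous_syzygy_of_last homogeneous_homogeneous_part) (simp add: colon_def)
    then obtain w where w: "\<And>e. w e \<in> syzygies a" "\<And>e. w e $ None = homogeneous_part e (z $ None)" "\<And>e. homogeneous_vec e (w e)"
      by metis
    have wP: "w e +o koszul_relations a \<in> P" if "e \<in> E" for e
    proof -
      have "w e +o koszul_relations a \<in> H1_component a e" unfolding H1_component_iff using w(1,3) by blast
      then show ?thesis using P(2) that unfolding E_def by blast
    qed
    have sumP: "(\<Sum>e\<in>E. 1 *s w e) +o koszul_relations a \<in> P"
      by (rule syz_module.quot_submodule_sum[OF subspace_koszul_relations P(1) E wP])
    have "homogeneous_part e (z $ None) \<in> J" if "e \<notin> E" for e
    proof (cases "top_degree < e")
      case True then show ?thesis by (rule above_top_degree[OF homogeneous_homogeneous_part])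
    next
      case False
      then have "e + s \<le> top_degree" using that by (simp add: E_def)
      then show ?thesis
        by (rule homogeneous_annihilated_by_power[OF homogeneous_homogeneous_part homogeneous_part_colon[OF z(2)]])
    qed
    then have "z $ None - (\<Sum>e\<in>E. homogeneous_part e (z $ None)) \<in> J"
      by (rule ideal_member_by_parts[OF ideal_J E])
    then have "(z - (\<Sum>e\<in>E. 1 *s w e)) $ None \<in> J" by (simp add: w(2))
    moreover have "z - (\<Sum>e\<in>E. 1 *s w e) \<in> syzygies a"
      using z(1) w(1) by (intro syz_module.subspace_diff[OF subspace_syzygies] syz_module.subspace_sum[OF subspace_syzygies]) auto
    ultimately have "z - (\<Sum>e\<in>E. 1 *s w e) \<in> koszul_relations a" using syzygy_koszul_iff by blast
    then have "C = (\<Sum>e\<in>E. 1 *s w e) +o koszul_relations a"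
      unfolding z(3) by (simp add: syz_module.coset_eq_iff[OF subspace_koszul_relations])
    then show "C \<in> P" using sumP by simp
  qed
qed

end

section \<open>Powers of the variables in a reduction, and the number of generators\<close>

lemma power_mem_ideal_pow: "x \<in> A \<Longrightarrow> x ^ q \<in> ideal_pow A q"
  by (induction q) (auto simp: ideal_prod_def intro!: ideal.span_base)

lemma reduction_contains_power:
  assumes "reduction J I" "x ^ q \<in> I" shows "\<exists>N. x ^ N \<in> J"
proof -
  obtain r where J: "is_ideal J" and r: "ideal_pow I (r + 1) = ideal_prod J (ideal_pow I r)"
    using assms(1) by (auto simp: reduction_def)
  have "ideal_prod J B \<subseteq> J" for B
    unfolding ideal_prod_def
    by (rule ideal.span_minimal[OF _ J]) (use ideal.subspace_scale[OF J] in \<open>auto simp: mult.commute\<close>)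
  moreover have "(x ^ q) ^ (r + 1) \<in> ideal_pow I (r + 1)" by (rule power_mem_ideal_pow[OF assms(2)])
  ultimately have "(x ^ q) ^ (r + 1) \<in> J" unfolding r by blast
  then show ?thesis unfolding power_mult[symmetric] by blast
qed

text \<open>
  The sum of the individual exponents serves as a common one; the successor makes it positive.
\<close>

lemma common_exponent:
  fixes x :: "'i::finite \<Rightarrow> 'a::comm_ring_1"
  assumes J: "is_ideal J" and "\<And>i. \<exists>N. x i ^ N \<in> J"
  shows "\<exists>N>0. \<forall>i. x i ^ N \<in> J"
proof -
  obtain e where e: "\<And>i. x i ^ e i \<in> J" using assms(2) by metis
  define N where "N = Suc (\<Sum>i\<in>UNIV. e i)"
  have "x i ^ N \<in> J" for i
  proof -
    have "e i \<le> N" unfolding N_def using member_le_sum[of i UNIV e] by simp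
    then have "x i ^ N = x i ^ (N - e i) * x i ^ e i" by (simp flip: power_add)
    then show ?thesis using ideal.subspace_scale[OF J e] by simp
  qed
  then show ?thesis by (intro exI[of _ N]) (simp add: N_def)
qed

theorem proposition2p12:
  fixes a :: "('n::{finite,linorder}, 'k::field) mpoly ^ ('n option)"
    and \<phi> :: "('n, 'k) mpoly ^ 'c ^ ('n option)"
    and I J :: "('n, 'k) mpoly set"
    and n :: nat
  assumes "CARD('n) \<ge> 2"
    and "\<And>i. homogeneous n (a $ i)"
    and "minimally_generates (*) (($) a) I"
    and "primary_ideal I" and "ideal_radical I = max_ideal"
    and "J = ideal_gen (range (\<lambda>i. a $ Some i))"
    and "minimal_reduction J I"
    and "minimal_presentation a \<phi>"
  shows "nu const_scale (L_comp a 2) (S1L1 a) =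
      nu (*) (colon (entries_ideal \<phi>) max_ideal) (entries_ideal \<phi>)
    \<and> (\<forall>s\<ge>1. entries_ideal \<phi> = ideal_pow max_ideal s \<longrightarrow>
        nu const_scale (L_comp a 2) (S1L1 a) = enat ((CARD('n) + s - 2) choose (CARD('n) - 1))
      \<and> (\<exists>t. H1_top_degree a t \<and>
          syzygetic_module a =
            quot_span (*s) (koszul_relations a) (\<Union>e\<in>{e. e \<le> t \<and> t < e + s}. H1_component a e)))"
proof -
  have I: "I = ideal_gen (range (($) a))" using assms(3) by (simp add: minimally_generates_def)
  have red: "reduction J I" using assms(7) by (simp add: minimal_reduction_def)
  have ideal_J: "is_ideal J" by (simp add: assms(6))
  have ideal_I: "is_ideal I" by (simp add: I)
  have JI: "J \<subseteq> I" using red by (simp add: reduction_def)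
  have proper: "1 \<notin> J"
  proof
    assume "1 \<in> J"
    then have "p \<in> I" for p using ideal.subspace_scale[OF ideal_I, of 1 p] JI by auto
    then show False using assms(4) by (auto simp: primary_ideal_def)
  qed
  have "\<exists>N. var i ^ N \<in> J" for i
  proof -
    have "var i \<in> ideal_radical I" unfolding assms(5) max_ideal_def by (rule ideal.span_base) simp
    then show ?thesis using reduction_contains_power[OF red] by (auto simp: ideal_radical_def)
  qed
  then obtain N where N: "N > 0" and varN: "\<And>i. var i ^ N \<in> J" using common_exponent[OF ideal_J, of var] by blast
  define f where "f i = a $ Some i" for i
  have Jf: "J = ideal_gen (range f)" unfolding f_def by (rule assms(6))
  obtain \<psi> where \<psi>: "gorenstein_form J \<psi> N"
    using gorenstein_form_exists[OF N, of f] varN unfolding Jf by blast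
  interpret gorenstein_form J \<psi> N by (rule \<psi>)
  interpret almost_complete_intersection a I J
  proof
    show "I = ideal_gen (range (($) a))" by (rule I)
    show "J = ideal_gen (range (\<lambda>i. a $ Some i))" by (rule assms(6))
    show "colon J (colon J I) = I" by (rule colon_colon[OF ideal_I JI])
    fix z :: "'n \<Rightarrow> ('n, 'k) mpoly" assume z: "(\<Sum>i\<in>UNIV. z i * a $ Some i) = 0"
    have "regular_sequence_in_ideal f (\<lambda>i. var i ^ N)"
      by (rule var_powers_regular_sequence) (use varN in \<open>simp add: Jf\<close>)
    from regular_sequence_in_ideal.koszul_syzygies_alternating[OF this, of z] z
    show "\<exists>e. (\<forall>i j. e i j = - e j i) \<and> (\<forall>i. e i i = 0) \<and> (\<forall>i. z i = (\<Sum>j\<in>UNIV. e i j * a $ Some j))"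
      by (simp add: f_def)
  qed
  interpret graded_almost_complete_intersection a I J \<psi> N n
    by unfold_locales (fact assms(2) proper)+
  define K where "K = syzygy_entries_ideal a"
  have K: "entries_ideal \<phi> = K" unfolding K_def by (rule entries_ideal_minimal_presentation[OF assms(8)])
  have ideal_K: "is_ideal K" by (simp add: K_def syzygy_entries_ideal_def)
  have JK: "J \<subseteq> K" using JI I_subset_entries by (auto simp: K_def)
  have nu: "nu const_scale (L_comp a 2) (S1L1 a) = nu (*) (colon K max_ideal) K"
    unfolding nu_L2_mod_S1L1 K_def[symmetric] by (rule nu_colon_dual[OF ideal_K JK])
  show ?thesis
    unfolding K
  proof (intro conjI allI impI)
    show "nu const_scale (L_comp a 2) (S1L1 a) = nu (*) (colon K max_ideal) K" by (rule nu)
  next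
    fix s :: nat assume s: "s \<ge> 1" and Ks: "K = ideal_pow max_ideal s"
    have Ks: "K = order_ideal s" unfolding Ks by (rule max_ideal_pow)
    have "nu (*) (colon K max_ideal) K = nu (*) (order_ideal (s - 1)) (order_ideal (Suc (s - 1)) :: ('n, 'k) mpoly set)"
      unfolding Ks colon_order_ideal[OF s] using s by simp
    also have "\<dots> = enat ((CARD('n) + (s - 1) - 1) choose (s - 1))" by (rule nu_order_ideal)
    also have "(CARD('n) + (s - 1) - 1) choose (s - 1) = (CARD('n) + s - 2) choose (CARD('n) - 1)"
    proof -
      have "CARD('n) + (s - 1) - 1 = CARD('n) + s - 2" "CARD('n) + s - 2 - (s - 1) = CARD('n) - 1"
        using s assms(1) by simp_all
      then show ?thesis
        using binomial_symmetric[of "s - 1" "CARD('n) + s - 2"] assms(1) by simp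
    qed
    finally show "nu const_scale (L_comp a 2) (S1L1 a) = enat ((CARD('n) + s - 2) choose (CARD('n) - 1))"
      unfolding nu .
    have "a $ None \<in> order_ideal s"
      using I_subset_entries Ks ideal.span_base[of "a $ None" "range (($) a)"] unfolding K_def I by blast
    then have "a $ None \<in> order_ideal 1" using s by (force simp: order_ideal_def)
    then show "\<exists>t. H1_top_degree a t \<and>
          syzygetic_module a =
            quot_span (*s) (koszul_relations a) (\<Union>e\<in>{e. e \<le> t \<and> t < e + s}. H1_component a e)"
      using H1_top_degree syzygetic_module_generated_by_top_components[OF s] Ks unfolding K_def by blast
  qed
qed

end
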